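(* There is a functor $\mathrm{ST\lambda C}_{\mathrm{cat}}\to\mathcal E\mathrm{Lens}(\mathbf P_{\mathrm{cat}})$ defined as follows: - an object (simple type) $A$ is sent to the first projection $(z:W(A)\times\mathcal M[C(A)]\vdash_{\mathbf P}z^1:W(A))$; - an arrow $(z:A\vdash_{\mathrm{ST\lambda C}}M:B)$ from $A$ to $B$ is sent to the arrow from $(z:W(A)\times\mathcal M[C(A)]\vdash_{\mathbf P}z^1:W(A))$ to $(z:W(B)\times\mathcal M[C(B)]\vdash_{\mathbf P}z^1:W(B))$ given by $(z:W(A)\vdash_{\mathbf P}M^\bullet:W(B))$ and the span $$W(A)\times\mathcal M[C(A)]\xleftarrow{\ \langle z^1,\ z^2\mathbin{>\!\!>\!=}M_{(z^1)}\rangle\ }W(A)\times\mathcal M[C(B)]\xrightarrow{\ \langle M^\bullet\{z^1/z\},\ z^2\rangle\ }W(B)\times\mathcal M[C(B)],$$ where $M_{(z^1)}:=M_z\{z^1/z\}$.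
   Context: **The calculus $\mathbf P$.** $\mathrm{ST\lambda C}$ is the simply typed $\lambda$-calculus (types: ground types $\alpha$ and arrows $E\to F$) modulo $\beta\eta$. $\mathbf P$ is a simply typed $\lambda$-calculus with arrow types, product types $T\times U$ (pairs $\langle M,N\rangle$, projections $M^1,M^2$) and a type constructor $\mathcal M[T]$ with terms: return $[M]:\mathcal M[T]$ for $M:T$; bind $M\mathbin{>\!\!>\!=}N:\mathcal M[U]$ for $M:\mathcal M[T]$, $N:T\to\mathcal M[U]$; $0:\mathcal M[T]$; $M+N:\mathcal M[T]$. Its equational theory $=$ is the congruence generated by $\beta\eta$ (including surjective pairing), the monad laws for return/bind, the commutative monoid laws for $(0,+)$, and compatibility of bind with the monoid structure in both arguments ($0\mathbin{>\!\!>\!=}N=0$, $(M+M')\mathbin{>\!\!>\!=}N=(M\mathbin{>\!\!>\!=}N)+(M'\mathbin{>\!\!>\!=}N)$, $M\mathbin{>\!\!>\!=}\lambda x.0=0$, $M\mathbin{>\!\!>\!=}\lambda x.(N+N')=(M\mathbin{>\!\!>\!=}\lambda x.N)+(M\mathbin{>\!\!>\!=}\lambda x.N')$). **Dialectica.** For each ground type $\alpha$ fix ground $\mathbf P$-types $\alpha_W,\alpha_C$. Define $W(\alpha)=\alpha_W$, $C(\alpha)=\alpha_C$, $W(E\to F)=(W(E)\to W(F))\times(W(E)\times C(F)\to\mathcal M[C(E)])$, $C(E\to F)=W(E)\times C(F)$. On $\lambda$-terms define $\mathbf P$-terms: $x^\bullet=x$; $(\lambda x.M)^\bullet=\langle\lambda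 x.M^\bullet,\ \lambda\pi.(\lambda x.M_x)\pi^1\pi^2\rangle$; $(PQ)^\bullet=(P^\bullet)^1Q^\bullet$; and for each variable $y$: $y_y=\lambda\pi.[\pi]$; $x_y=\lambda\pi.0$ if $x\neq y$; $(\lambda x.M)_y=\lambda\pi.(\lambda x.M_y)\pi^1\pi^2$ ($x\ne y$); $(PQ)_y=\lambda\pi.\big(P_y\langle Q^\bullet,\pi\rangle+((P^\bullet)^2\langle Q^\bullet,\pi\rangle\mathbin{>\!\!>\!=}Q_y)\big)$. If $z:A\vdash M:B$ then $z:W(A)\vdash_{\mathbf P}M^\bullet:W(B)$ and $z:W(A)\vdash_{\mathbf P}M_z:C(B)\to\mathcal M[C(A)]$. **Syntactic categories.** $\mathrm{ST\lambda C}_{\mathrm{cat}}$ and $\mathbf P_{\mathrm{cat}}$ have types as objects; an arrow $A\to B$ is an equivalence class, modulo the equational theory, of terms $z:A\vdash M:B$; identities are variables; composition is substitution. **Euclidean lenses.** For a category $\mathcal L$ with binary products (diagrammatic composition), $\mathcal E\mathrm{Lens}(\mathcal L)$ has as objects the first projections $\pi_1:A\times X\to A$; an arrow from $\pi_1:A\times X\to A$ to $\pi_1:B\times Y\to B$ is an $f:A\to B$ together with a span $A\times X\xleftarrow{F}A\times Y\xrightarrow{f\times1}B\times Y$ such that $F;\pi_1=\pi_1$. Identities: $1_A$ with the identity span. The composite of $(f,F)$ and $(g,G)$, with $(g,G)$ from $\pi_1:B\times Y\to B$ to $\pi_1:C\times Z\to C$, has first component $f;g$ and span $A\times X\xleftarrow{\langle\pi_1,(f\times1);G;\pi_2\rangle;F}A\times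 Z\xrightarrow{(f;g)\times1}C\times Z$. *)

theory Defs
  imports Main
begin

section \<open>Categories, chosen binary products, functors\<close>

text \<open>Composition is written in diagrammatic order: \<open>cmp \<C> A B C f g\<close> is \<open>f;g\<close> for
  \<open>f : A \<rightarrow> B\<close> and \<open>g : B \<rightarrow> C\<close>.  Operations carry their source and target objects, so hom-sets
  need not be disjoint.\<close>

record ('o, 'a) cat =
  obj :: "'o set"
  hom :: "'o \<Rightarrow> 'o \<Rightarrow> 'a set"
  ide :: "'o \<Rightarrow> 'a"
  cmp :: "'o \<Rightarrow> 'o \<Rightarrow> 'o \<Rightarrow> 'a \<Rightarrow> 'a \<Rightarrow> 'a"

locale category =
  fixes \<C> :: "('o, 'a, 'm) cat_scheme"
  assumes ide_hom: "A \<in> obj \<C> \<Longrightarrow> ide \<C> A \<in> hom \<C> A A"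
    and cmp_hom: "\<lbrakk>A \<in> obj \<C>; B \<in> obj \<C>; C \<in> obj \<C>; f \<in> hom \<C> A B; g \<in> hom \<C> B C\<rbrakk>
      \<Longrightarrow> cmp \<C> A B C f g \<in> hom \<C> A C"
    and cmp_ide_left: "\<lbrakk>A \<in> obj \<C>; B \<in> obj \<C>; f \<in> hom \<C> A B\<rbrakk>
      \<Longrightarrow> cmp \<C> A A B (ide \<C> A) f = f"
    and cmp_ide_right: "\<lbrakk>A \<in> obj \<C>; B \<in> obj \<C>; f \<in> hom \<C> A B\<rbrakk>
      \<Longrightarrow> cmp \<C> A B B f (ide \<C> B) = f"
    and cmp_assoc: "\<lbrakk>A \<in> obj \<C>; B \<in> obj \<C>; C \<in> obj \<C>; D \<in> obj \<C>;
        f \<in> hom \<C> A B; g \<in> hom \<C> B C; h \<in> hom \<C> C D\<rbrakk>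
      \<Longrightarrow> cmp \<C> A C D (cmp \<C> A B C f g) h = cmp \<C> A B D f (cmp \<C> B C D g h)"

record ('o, 'a) prodcat = "('o, 'a) cat" +
  prd :: "'o \<Rightarrow> 'o \<Rightarrow> 'o"
  pr1 :: "'o \<Rightarrow> 'o \<Rightarrow> 'a"
  pr2 :: "'o \<Rightarrow> 'o \<Rightarrow> 'a"
  tup :: "'o \<Rightarrow> 'o \<Rightarrow> 'o \<Rightarrow> 'a \<Rightarrow> 'a \<Rightarrow> 'a"

text \<open>\<open>tup \<L> C A B f g\<close> is the pairing of \<open>f : C \<rightarrow> A\<close> and \<open>g : C \<rightarrow> B\<close>.\<close>

locale category_with_products = category \<L>
  for \<L> :: "('o, 'a, 'm) prodcat_scheme" +
  assumes prd_obj: "\<lbrakk>A \<in> obj \<L>; B \<in> obj \<L>\<rbrakk> \<Longrightarrow> prd \<L> A B \<in> obj \<L>"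
    and pr1_hom: "\<lbrakk>A \<in> obj \<L>; B \<in> obj \<L>\<rbrakk> \<Longrightarrow> pr1 \<L> A B \<in> hom \<L> (prd \<L> A B) A"
    and pr2_hom: "\<lbrakk>A \<in> obj \<L>; B \<in> obj \<L>\<rbrakk> \<Longrightarrow> pr2 \<L> A B \<in> hom \<L> (prd \<L> A B) B"
    and tup_hom: "\<lbrakk>A \<in> obj \<L>; B \<in> obj \<L>; C \<in> obj \<L>; f \<in> hom \<L> C A; g \<in> hom \<L> C B\<rbrakk>
      \<Longrightarrow> tup \<L> C A B f g \<in> hom \<L> C (prd \<L> A B)"
    and tup_pr1: "\<lbrakk>A \<in> obj \<L>; B \<in> obj \<L>; C \<in> obj \<L>; f \<in> hom \<L> C A; g \<in> hom \<L> C B\<rbrakk>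
      \<Longrightarrow> cmp \<L> C (prd \<L> A B) A (tup \<L> C A B f g) (pr1 \<L> A B) = f"
    and tup_pr2: "\<lbrakk>A \<in> obj \<L>; B \<in> obj \<L>; C \<in> obj \<L>; f \<in> hom \<L> C A; g \<in> hom \<L> C B\<rbrakk>
      \<Longrightarrow> cmp \<L> C (prd \<L> A B) B (tup \<L> C A B f g) (pr2 \<L> A B) = g"
    and tup_unique: "\<lbrakk>A \<in> obj \<L>; B \<in> obj \<L>; C \<in> obj \<L>; h \<in> hom \<L> C (prd \<L> A B);
        cmp \<L> C (prd \<L> A B) A h (pr1 \<L> A B) = f; cmp \<L> C (prd \<L> A B) B h (pr2 \<L> A B) = g\<rbrakk>
      \<Longrightarrow> h = tup \<L> C A B f g"

definition prd_map ::
  "('o, 'a, 'm) prodcat_scheme \<Rightarrow> 'o \<Rightarrow> 'o \<Rightarrow> 'o \<Rightarrow> 'o \<Rightarrow> 'a \<Rightarrow> 'a \<Rightarrow> 'a" where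
  "prd_map \<L> A X B Y f g = tup \<L> (prd \<L> A X) B Y
     (cmp \<L> (prd \<L> A X) A B (pr1 \<L> A X) f) (cmp \<L> (prd \<L> A X) X Y (pr2 \<L> A X) g)"

locale cat_functor = C: category \<C> + D: category \<D>
  for \<C> :: "('o, 'a, 'm) cat_scheme" and \<D> :: "('p, 'b, 'n) cat_scheme" +
  fixes Fo :: "'o \<Rightarrow> 'p" and Fa :: "'o \<Rightarrow> 'o \<Rightarrow> 'a \<Rightarrow> 'b"
  assumes map_obj: "A \<in> obj \<C> \<Longrightarrow> Fo A \<in> obj \<D>"
    and map_hom: "\<lbrakk>A \<in> obj \<C>; B \<in> obj \<C>; f \<in> hom \<C> A B\<rbrakk>
      \<Longrightarrow> Fa A B f \<in> hom \<D> (Fo A) (Fo B)"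
    and map_ide: "A \<in> obj \<C> \<Longrightarrow> Fa A A (ide \<C> A) = ide \<D> (Fo A)"
    and map_cmp: "\<lbrakk>A \<in> obj \<C>; B \<in> obj \<C>; C \<in> obj \<C>; f \<in> hom \<C> A B; g \<in> hom \<C> B C\<rbrakk>
      \<Longrightarrow> Fa A C (cmp \<C> A B C f g) = cmp \<D> (Fo A) (Fo B) (Fo C) (Fa A B f) (Fa B C g)"


section \<open>Euclidean lenses\<close>

text \<open>An object is a first projection, stored as \<open>(A, X, \<pi>\<^sub>1)\<close> because neither \<open>A\<close> nor \<open>X\<close> can
  be recovered from the arrow \<open>\<pi>\<^sub>1\<close> in general.  An arrow is stored as \<open>(f, F, R)\<close>, where \<open>F\<close>
  and \<open>R\<close> are the left and right legs of the span.\<close>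

definition first_projection :: "('o, 'a, 'm) prodcat_scheme \<Rightarrow> 'o \<Rightarrow> 'o \<Rightarrow> 'o \<times> 'o \<times> 'a" where
  "first_projection \<L> A X = (A, X, pr1 \<L> A X)"

definition ELens :: "('o, 'a, 'm) prodcat_scheme \<Rightarrow> ('o \<times> 'o \<times> 'a, 'a \<times> 'a \<times> 'a) cat" where
  "ELens \<L> = \<lparr>
     obj = {first_projection \<L> A X | A X. A \<in> obj \<L> \<and> X \<in> obj \<L>},
     hom = (\<lambda>(A, X, p) (B, Y, q). {(f, F, R).
        f \<in> hom \<L> A B \<and>
        F \<in> hom \<L> (prd \<L> A Y) (prd \<L> A X) \<and>
        R = prd_map \<L> A Y B Y f (ide \<L> Y) \<and>
        cmp \<L> (prd \<L> A Y) (prd \<L> A X) A F (pr1 \<L> A X) = pr1 \<L> A Y}),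
     ide = (\<lambda>(A, X, p). (ide \<L> A, ide \<L> (prd \<L> A X), ide \<L> (prd \<L> A X))),
     cmp = (\<lambda>(A, X, p) (B, Y, q) (C, Z, r) (f, F, R) (g, G, S).
       (cmp \<L> A B C f g,
        cmp \<L> (prd \<L> A Z) (prd \<L> A Y) (prd \<L> A X)
          (tup \<L> (prd \<L> A Z) A Y (pr1 \<L> A Z)
            (cmp \<L> (prd \<L> A Z) (prd \<L> B Z) Y
              (prd_map \<L> A Z B Z f (ide \<L> Z))
              (cmp \<L> (prd \<L> B Z) (prd \<L> B Y) Y G (pr2 \<L> B Y))))
          F,
        prd_map \<L> A Z C Z (cmp \<L> A B C f g) (ide \<L> Z))) \<rparr>"


section \<open>The simply typed lambda-calculus\<close>

text \<open>Both calculi are Curry style with typed equality judgements.  De Bruijn index \<open>n\<close> refers to the \<open>n\<close>-th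
  entry of the typing context.  Substitution is parallel; \<open>inst N M\<close> replaces index \<open>0\<close> of
  \<open>M\<close> by \<open>N\<close> and lowers the other indices.\<close>

datatype 'g ty = Gnd 'g | Arr "'g ty" "'g ty"

datatype tm = Var nat | Lam tm | App tm tm

fun ren_up :: "(nat \<Rightarrow> nat) \<Rightarrow> nat \<Rightarrow> nat" where
  "ren_up r 0 = 0"
| "ren_up r (Suc n) = Suc (r n)"

primrec ren :: "(nat \<Rightarrow> nat) \<Rightarrow> tm \<Rightarrow> tm" where
  "ren r (Var n) = Var (r n)"
| "ren r (Lam M) = Lam (ren (ren_up r) M)"
| "ren r (App M N) = App (ren r M) (ren r N)"

abbreviation shift :: "tm \<Rightarrow> tm" where "shift \<equiv> ren Suc"

fun sub_up :: "(nat \<Rightarrow> tm) \<Rightarrow> nat \<Rightarrow> tm" where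
  "sub_up s 0 = Var 0"
| "sub_up s (Suc n) = shift (s n)"

primrec sub :: "(nat \<Rightarrow> tm) \<Rightarrow> tm \<Rightarrow> tm" where
  "sub s (Var n) = s n"
| "sub s (Lam M) = Lam (sub (sub_up s) M)"
| "sub s (App M N) = App (sub s M) (sub s N)"

definition inst :: "tm \<Rightarrow> tm \<Rightarrow> tm" where
  "inst N M = sub (case_nat N Var) M"

inductive typed :: "'g ty list \<Rightarrow> tm \<Rightarrow> 'g ty \<Rightarrow> bool" ("_ \<turnstile> _ : _" [51, 51, 51] 50) where
  t_Var: "\<lbrakk>n < length \<Gamma>; \<Gamma> ! n = T\<rbrakk> \<Longrightarrow> \<Gamma> \<turnstile> Var n : T"
| t_Lam: "E # \<Gamma> \<turnstile> M : F \<Longrightarrow> \<Gamma> \<turnstile> Lam M : Arr E F"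
| t_App: "\<lbrakk>\<Gamma> \<turnstile> M : Arr E F; \<Gamma> \<turnstile> N : E\<rbrakk> \<Longrightarrow> \<Gamma> \<turnstile> App M N : F"

inductive eqtm :: "'g ty list \<Rightarrow> tm \<Rightarrow> tm \<Rightarrow> 'g ty \<Rightarrow> bool"
  ("_ \<turnstile> _ \<approx> _ : _" [51, 51, 51, 51] 50) where
  e_refl: "\<Gamma> \<turnstile> M : T \<Longrightarrow> \<Gamma> \<turnstile> M \<approx> M : T"
| e_sym: "\<Gamma> \<turnstile> M \<approx> N : T \<Longrightarrow> \<Gamma> \<turnstile> N \<approx> M : T"
| e_trans: "\<lbrakk>\<Gamma> \<turnstile> M \<approx> N : T; \<Gamma> \<turnstile> N \<approx> L : T\<rbrakk> \<Longrightarrow> \<Gamma> \<turnstile> M \<approx> L : T"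
| e_Lam: "E # \<Gamma> \<turnstile> M \<approx> M' : F \<Longrightarrow> \<Gamma> \<turnstile> Lam M \<approx> Lam M' : Arr E F"
| e_App: "\<lbrakk>\<Gamma> \<turnstile> M \<approx> M' : Arr E F; \<Gamma> \<turnstile> N \<approx> N' : E\<rbrakk> \<Longrightarrow> \<Gamma> \<turnstile> App M N \<approx> App M' N' : F"
| e_beta: "\<lbrakk>E # \<Gamma> \<turnstile> M : F; \<Gamma> \<turnstile> N : E\<rbrakk> \<Longrightarrow> \<Gamma> \<turnstile> App (Lam M) N \<approx> inst N M : F"
| e_eta: "\<Gamma> \<turnstile> M : Arr E F \<Longrightarrow> \<Gamma> \<turnstile> Lam (App (shift M) (Var 0)) \<approx> M : Arr E F"


section \<open>The calculus P\<close>

datatype 'p pty = PGnd 'p | PArr "'p pty" "'p pty" | PProd "'p pty" "'p pty" | PMon "'p pty"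

datatype ptm = PVar nat | PLam ptm | PApp ptm ptm
  | PPair ptm ptm | PFst ptm | PSnd ptm
  | PRet ptm | PBind ptm ptm | PZero | PPlus ptm ptm

primrec pren :: "(nat \<Rightarrow> nat) \<Rightarrow> ptm \<Rightarrow> ptm" where
  "pren r (PVar n) = PVar (r n)"
| "pren r (PLam M) = PLam (pren (ren_up r) M)"
| "pren r (PApp M N) = PApp (pren r M) (pren r N)"
| "pren r (PPair M N) = PPair (pren r M) (pren r N)"
| "pren r (PFst M) = PFst (pren r M)"
| "pren r (PSnd M) = PSnd (pren r M)"
| "pren r (PRet M) = PRet (pren r M)"
| "pren r (PBind M N) = PBind (pren r M) (pren r N)"
| "pren r PZero = PZero"
| "pren r (PPlus M N) = PPlus (pren r M) (pren r N)"

abbreviation pshift :: "ptm \<Rightarrow> ptm" where "pshift \<equiv> pren Suc"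

fun psub_up :: "(nat \<Rightarrow> ptm) \<Rightarrow> nat \<Rightarrow> ptm" where
  "psub_up s 0 = PVar 0"
| "psub_up s (Suc n) = pshift (s n)"

primrec psub :: "(nat \<Rightarrow> ptm) \<Rightarrow> ptm \<Rightarrow> ptm" where
  "psub s (PVar n) = s n"
| "psub s (PLam M) = PLam (psub (psub_up s) M)"
| "psub s (PApp M N) = PApp (psub s M) (psub s N)"
| "psub s (PPair M N) = PPair (psub s M) (psub s N)"
| "psub s (PFst M) = PFst (psub s M)"
| "psub s (PSnd M) = PSnd (psub s M)"
| "psub s (PRet M) = PRet (psub s M)"
| "psub s (PBind M N) = PBind (psub s M) (psub s N)"
| "psub s PZero = PZero"
| "psub s (PPlus M N) = PPlus (psub s M) (psub s N)"

definition pinst :: "ptm \<Rightarrow> ptm \<Rightarrow> ptm" where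
  "pinst N M = psub (case_nat N PVar) M"

inductive ptyped :: "'p pty list \<Rightarrow> ptm \<Rightarrow> 'p pty \<Rightarrow> bool"
  ("_ \<turnstile>\<^sub>P _ : _" [51, 51, 51] 50) where
  pt_Var: "\<lbrakk>n < length \<Gamma>; \<Gamma> ! n = T\<rbrakk> \<Longrightarrow> \<Gamma> \<turnstile>\<^sub>P PVar n : T"
| pt_Lam: "T # \<Gamma> \<turnstile>\<^sub>P M : U \<Longrightarrow> \<Gamma> \<turnstile>\<^sub>P PLam M : PArr T U"
| pt_App: "\<lbrakk>\<Gamma> \<turnstile>\<^sub>P M : PArr T U; \<Gamma> \<turnstile>\<^sub>P N : T\<rbrakk> \<Longrightarrow> \<Gamma> \<turnstile>\<^sub>P PApp M N : U"
| pt_Pair: "\<lbrakk>\<Gamma> \<turnstile>\<^sub>P M : T; \<Gamma> \<turnstile>\<^sub>P N : U\<rbrakk> \<Longrightarrow> \<Gamma> \<turnstile>\<^sub>P PPair M N : PProd T U"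
| pt_Fst: "\<Gamma> \<turnstile>\<^sub>P M : PProd T U \<Longrightarrow> \<Gamma> \<turnstile>\<^sub>P PFst M : T"
| pt_Snd: "\<Gamma> \<turnstile>\<^sub>P M : PProd T U \<Longrightarrow> \<Gamma> \<turnstile>\<^sub>P PSnd M : U"
| pt_Ret: "\<Gamma> \<turnstile>\<^sub>P M : T \<Longrightarrow> \<Gamma> \<turnstile>\<^sub>P PRet M : PMon T"
| pt_Bind: "\<lbrakk>\<Gamma> \<turnstile>\<^sub>P M : PMon T; \<Gamma> \<turnstile>\<^sub>P N : PArr T (PMon U)\<rbrakk> \<Longrightarrow> \<Gamma> \<turnstile>\<^sub>P PBind M N : PMon U"
| pt_Zero: "\<Gamma> \<turnstile>\<^sub>P PZero : PMon T"
| pt_Plus: "\<lbrakk>\<Gamma> \<turnstile>\<^sub>P M : PMon T; \<Gamma> \<turnstile>\<^sub>P N : PMon T\<rbrakk> \<Longrightarrow> \<Gamma> \<turnstile>\<^sub>P PPlus M N : PMon T"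

inductive peq :: "'p pty list \<Rightarrow> ptm \<Rightarrow> ptm \<Rightarrow> 'p pty \<Rightarrow> bool"
  ("_ \<turnstile>\<^sub>P _ \<approx> _ : _" [51, 51, 51, 51] 50) where
  pe_refl: "\<Gamma> \<turnstile>\<^sub>P M : T \<Longrightarrow> \<Gamma> \<turnstile>\<^sub>P M \<approx> M : T"
| pe_sym: "\<Gamma> \<turnstile>\<^sub>P M \<approx> N : T \<Longrightarrow> \<Gamma> \<turnstile>\<^sub>P N \<approx> M : T"
| pe_trans: "\<lbrakk>\<Gamma> \<turnstile>\<^sub>P M \<approx> N : T; \<Gamma> \<turnstile>\<^sub>P N \<approx> L : T\<rbrakk> \<Longrightarrow> \<Gamma> \<turnstile>\<^sub>P M \<approx> L : T"
| pe_Lam: "T # \<Gamma> \<turnstile>\<^sub>P M \<approx> M' : U \<Longrightarrow> \<Gamma> \<turnstile>\<^sub>P PLam M \<approx> PLam M' : PArr T U"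
| pe_App: "\<lbrakk>\<Gamma> \<turnstile>\<^sub>P M \<approx> M' : PArr T U; \<Gamma> \<turnstile>\<^sub>P N \<approx> N' : T\<rbrakk>
    \<Longrightarrow> \<Gamma> \<turnstile>\<^sub>P PApp M N \<approx> PApp M' N' : U"
| pe_Pair: "\<lbrakk>\<Gamma> \<turnstile>\<^sub>P M \<approx> M' : T; \<Gamma> \<turnstile>\<^sub>P N \<approx> N' : U\<rbrakk>
    \<Longrightarrow> \<Gamma> \<turnstile>\<^sub>P PPair M N \<approx> PPair M' N' : PProd T U"
| pe_Fst: "\<Gamma> \<turnstile>\<^sub>P M \<approx> M' : PProd T U \<Longrightarrow> \<Gamma> \<turnstile>\<^sub>P PFst M \<approx> PFst M' : T"
| pe_Snd: "\<Gamma> \<turnstile>\<^sub>P M \<approx> M' : PProd T U \<Longrightarrow> \<Gamma> \<turnstile>\<^sub>P PSnd M \<approx> PSnd M' : U"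
| pe_Ret: "\<Gamma> \<turnstile>\<^sub>P M \<approx> M' : T \<Longrightarrow> \<Gamma> \<turnstile>\<^sub>P PRet M \<approx> PRet M' : PMon T"
| pe_Bind: "\<lbrakk>\<Gamma> \<turnstile>\<^sub>P M \<approx> M' : PMon T; \<Gamma> \<turnstile>\<^sub>P N \<approx> N' : PArr T (PMon U)\<rbrakk>
    \<Longrightarrow> \<Gamma> \<turnstile>\<^sub>P PBind M N \<approx> PBind M' N' : PMon U"
| pe_Plus: "\<lbrakk>\<Gamma> \<turnstile>\<^sub>P M \<approx> M' : PMon T; \<Gamma> \<turnstile>\<^sub>P N \<approx> N' : PMon T\<rbrakk>
    \<Longrightarrow> \<Gamma> \<turnstile>\<^sub>P PPlus M N \<approx> PPlus M' N' : PMon T"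
| pe_beta: "\<lbrakk>T # \<Gamma> \<turnstile>\<^sub>P M : U; \<Gamma> \<turnstile>\<^sub>P N : T\<rbrakk> \<Longrightarrow> \<Gamma> \<turnstile>\<^sub>P PApp (PLam M) N \<approx> pinst N M : U"
| pe_eta: "\<Gamma> \<turnstile>\<^sub>P M : PArr T U \<Longrightarrow> \<Gamma> \<turnstile>\<^sub>P PLam (PApp (pshift M) (PVar 0)) \<approx> M : PArr T U"
| pe_fst_pair: "\<lbrakk>\<Gamma> \<turnstile>\<^sub>P M : T; \<Gamma> \<turnstile>\<^sub>P N : U\<rbrakk> \<Longrightarrow> \<Gamma> \<turnstile>\<^sub>P PFst (PPair M N) \<approx> M : T"
| pe_snd_pair: "\<lbrakk>\<Gamma> \<turnstile>\<^sub>P M : T; \<Gamma> \<turnstile>\<^sub>P N : U\<rbrakk> \<Longrightarrow> \<Gamma> \<turnstile>\<^sub>P PSnd (PPair M N) \<approx> N : U"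
| pe_surj_pair: "\<Gamma> \<turnstile>\<^sub>P M : PProd T U \<Longrightarrow> \<Gamma> \<turnstile>\<^sub>P PPair (PFst M) (PSnd M) \<approx> M : PProd T U"
| pe_ret_bind: "\<lbrakk>\<Gamma> \<turnstile>\<^sub>P M : T; \<Gamma> \<turnstile>\<^sub>P N : PArr T (PMon U)\<rbrakk>
    \<Longrightarrow> \<Gamma> \<turnstile>\<^sub>P PBind (PRet M) N \<approx> PApp N M : PMon U"
| pe_bind_ret: "\<Gamma> \<turnstile>\<^sub>P M : PMon T \<Longrightarrow> \<Gamma> \<turnstile>\<^sub>P PBind M (PLam (PRet (PVar 0))) \<approx> M : PMon T"
| pe_bind_assoc:
    "\<lbrakk>\<Gamma> \<turnstile>\<^sub>P M : PMon T; \<Gamma> \<turnstile>\<^sub>P N : PArr T (PMon U); \<Gamma> \<turnstile>\<^sub>P L : PArr U (PMon V)\<rbrakk>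
    \<Longrightarrow> \<Gamma> \<turnstile>\<^sub>P PBind (PBind M N) L
         \<approx> PBind M (PLam (PBind (PApp (pshift N) (PVar 0)) (pshift L))) : PMon V"
| pe_plus_zero: "\<Gamma> \<turnstile>\<^sub>P M : PMon T \<Longrightarrow> \<Gamma> \<turnstile>\<^sub>P PPlus M PZero \<approx> M : PMon T"
| pe_plus_comm: "\<lbrakk>\<Gamma> \<turnstile>\<^sub>P M : PMon T; \<Gamma> \<turnstile>\<^sub>P N : PMon T\<rbrakk>
    \<Longrightarrow> \<Gamma> \<turnstile>\<^sub>P PPlus M N \<approx> PPlus N M : PMon T"
| pe_plus_assoc: "\<lbrakk>\<Gamma> \<turnstile>\<^sub>P M : PMon T; \<Gamma> \<turnstile>\<^sub>P N : PMon T; \<Gamma> \<turnstile>\<^sub>P L : PMon T\<rbrakk>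
    \<Longrightarrow> \<Gamma> \<turnstile>\<^sub>P PPlus (PPlus M N) L \<approx> PPlus M (PPlus N L) : PMon T"
| pe_zero_bind: "\<Gamma> \<turnstile>\<^sub>P N : PArr T (PMon U) \<Longrightarrow> \<Gamma> \<turnstile>\<^sub>P PBind PZero N \<approx> PZero : PMon U"
| pe_plus_bind:
    "\<lbrakk>\<Gamma> \<turnstile>\<^sub>P M : PMon T; \<Gamma> \<turnstile>\<^sub>P M' : PMon T; \<Gamma> \<turnstile>\<^sub>P N : PArr T (PMon U)\<rbrakk>
    \<Longrightarrow> \<Gamma> \<turnstile>\<^sub>P PBind (PPlus M M') N \<approx> PPlus (PBind M N) (PBind M' N) : PMon U"
| pe_bind_zero: "\<Gamma> \<turnstile>\<^sub>P M : PMon T \<Longrightarrow> \<Gamma> \<turnstile>\<^sub>P PBind M (PLam PZero) \<approx> PZero : PMon U"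
| pe_bind_plus:
    "\<lbrakk>\<Gamma> \<turnstile>\<^sub>P M : PMon T; T # \<Gamma> \<turnstile>\<^sub>P N : PMon U; T # \<Gamma> \<turnstile>\<^sub>P N' : PMon U\<rbrakk>
    \<Longrightarrow> \<Gamma> \<turnstile>\<^sub>P PBind M (PLam (PPlus N N'))
         \<approx> PPlus (PBind M (PLam N)) (PBind M (PLam N')) : PMon U"


section \<open>The Dialectica translation\<close>

text \<open>\<open>gW\<close> and \<open>gC\<close> are the chosen ground P-types for each ground type.\<close>

fun WT :: "('g \<Rightarrow> 'p) \<Rightarrow> ('g \<Rightarrow> 'p) \<Rightarrow> 'g ty \<Rightarrow> 'p pty"
  and CT :: "('g \<Rightarrow> 'p) \<Rightarrow> ('g \<Rightarrow> 'p) \<Rightarrow> 'g ty \<Rightarrow> 'p pty" where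
  "WT gW gC (Gnd a) = PGnd (gW a)"
| "WT gW gC (Arr E F) = PProd (PArr (WT gW gC E) (WT gW gC F))
     (PArr (PProd (WT gW gC E) (CT gW gC F)) (PMon (CT gW gC E)))"
| "CT gW gC (Gnd a) = PGnd (gC a)"
| "CT gW gC (Arr E F) = PProd (WT gW gC E) (CT gW gC F)"

text \<open>\<open>bul M\<close> is \<open>M\<^sup>\<bullet>\<close> and \<open>der y M\<close> is \<open>M\<^sub>y\<close>.  Under a binder \<open>y\<close> becomes \<open>Suc y\<close>, hence is
  always distinct from the bound variable \<open>0\<close>.  In \<open>der\<close> and in the second component of
  \<open>bul (Lam M)\<close>, the outermost \<open>PLam\<close> binds \<open>\<pi>\<close>, and subterms not mentioning \<open>\<pi>\<close> are shifted
  past it.\<close>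

fun bul :: "tm \<Rightarrow> ptm" and der :: "nat \<Rightarrow> tm \<Rightarrow> ptm" where
  "bul (Var x) = PVar x"
| "bul (Lam M) = PPair (PLam (bul M))
     (PLam (PApp (PApp (pshift (PLam (der 0 M))) (PFst (PVar 0))) (PSnd (PVar 0))))"
| "bul (App P Q) = PApp (PFst (bul P)) (bul Q)"
| "der y (Var x) = (if x = y then PLam (PRet (PVar 0)) else PLam PZero)"
| "der y (Lam M) =
     PLam (PApp (PApp (pshift (PLam (der (Suc y) M))) (PFst (PVar 0))) (PSnd (PVar 0)))"
| "der y (App P Q) = PLam (PPlus
     (PApp (pshift (der y P)) (PPair (pshift (bul Q)) (PVar 0)))
     (PBind (PApp (PSnd (pshift (bul P))) (PPair (pshift (bul Q)) (PVar 0)))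
        (pshift (der y Q))))"


section \<open>Syntactic categories\<close>

text \<open>The single free variable \<open>z\<close> of an arrow is index \<open>0\<close> in a one-entry context.\<close>

definition eq_rel :: "'g ty \<Rightarrow> 'g ty \<Rightarrow> (tm \<times> tm) set" where
  "eq_rel A B = {(M, N). [A] \<turnstile> M \<approx> N : B}"

definition cls :: "'g ty \<Rightarrow> 'g ty \<Rightarrow> tm \<Rightarrow> tm set" where
  "cls A B M = eq_rel A B `` {M}"

definition STLC_cat :: "('g ty, tm set) cat" where
  "STLC_cat = \<lparr>
     obj = UNIV,
     hom = (\<lambda>A B. {M. [A] \<turnstile> M : B} // eq_rel A B),
     ide = (\<lambda>A. cls A A (Var 0)),
     cmp = (\<lambda>A B C f g. \<Union>M\<in>f. \<Union>N\<in>g. cls A C (inst M N)) \<rparr>"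

definition peq_rel :: "'p pty \<Rightarrow> 'p pty \<Rightarrow> (ptm \<times> ptm) set" where
  "peq_rel A B = {(M, N). [A] \<turnstile>\<^sub>P M \<approx> N : B}"

definition pcls :: "'p pty \<Rightarrow> 'p pty \<Rightarrow> ptm \<Rightarrow> ptm set" where
  "pcls A B M = peq_rel A B `` {M}"

definition P_cat :: "('p pty, ptm set) prodcat" where
  "P_cat = \<lparr>
     obj = UNIV,
     hom = (\<lambda>A B. {M. [A] \<turnstile>\<^sub>P M : B} // peq_rel A B),
     ide = (\<lambda>A. pcls A A (PVar 0)),
     cmp = (\<lambda>A B C f g. \<Union>M\<in>f. \<Union>N\<in>g. pcls A C (pinst M N)),
     prd = PProd,
     pr1 = (\<lambda>A B. pcls (PProd A B) A (PFst (PVar 0))),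
     pr2 = (\<lambda>A B. pcls (PProd A B) B (PSnd (PVar 0))),
     tup = (\<lambda>C A B f g. \<Union>M\<in>f. \<Union>N\<in>g. pcls C (PProd A B) (PPair M N)) \<rparr>"

end

theory Submission
  imports Defs
begin

text \<open>
  The translation is reverse-mode differentiation.  \<open>M\<^sup>\<bullet>\<close> computes forwards, and \<open>M\<^sub>y\<close> takes a
  counter of the result of \<open>M\<close> to a formal sum of counters of the variable \<open>y\<close>.  In a lens the first
  component is the forward map and the left leg of the span is the backward map, so functoriality
  on composites is the chain rule.  Composition of \<open>\<lambda>\<close>-terms is substitution, and the chain rule is
  the substitution lemma \<open>bul_dbody_sub\<close>: for a parallel substitution \<open>s\<close>,

    \<open>(M[s])\<^sup>\<bullet> = M\<^sup>\<bullet>[s\<^sup>\<bullet>]\<close>  and  \<open>(M[s])\<^sub>y = \<lambda>\<pi>. \<Sum>\<^sub>i (M\<^sub>i[s\<^sup>\<bullet>] \<pi> >>= (s i)\<^sub>y)\<close>,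

  the sum ranging over all variables \<open>i\<close> of the context of \<open>M\<close>.  The induction on \<open>M\<close> distributes
  this sum over application by the compatibility of bind with the commutative monoid structure, and
  passes under an abstraction because a variable that does not occur has derivative zero
  (\<open>dbody_ren_fresh\<close>).  The two equations have to be proved together: \<open>(\<lambda>x. M)\<^sup>\<bullet>\<close> contains \<open>M\<^sub>x\<close>,
  and \<open>(P Q)\<^sub>y\<close> contains \<open>P\<^sup>\<bullet>\<close> and \<open>Q\<^sup>\<bullet>\<close>.

  Two instances of the lemma carry the theorem.
  \<^item> For \<open>s = (N, id)\<close> it gives soundness of \<open>\<beta>\<close>.  The sum reduces to the summand of the bound
    variable, \<open>M\<^sub>x[N\<^sup>\<bullet>] \<pi> >>= N\<^sub>y\<close>, and the summand \<open>M\<^sub>y[N\<^sup>\<bullet>] \<pi>\<close> of \<open>y\<close> itself, because the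
    derivative of any other variable with respect to \<open>y\<close> is zero.  These are the two summands in the definition of
    \<open>((\<lambda>x. M) N)\<^sub>y\<close>.  With \<open>\<eta>\<close>, which again rests on the vanishing of \<open>M\<^sub>x\<close> for \<open>x\<close> not in \<open>M\<close>, the
    translation is well defined on arrows (\<open>translation_sound\<close>).
  \<^item> For \<open>M : A \<rightarrow> B\<close> substituted into \<open>N : B \<rightarrow> D\<close>, where the context of \<open>N\<close> is a single variable, the
    sum has one summand, and the backward map of the composite is
    \<open>z\<^sup>2 >>= (\<lambda>\<pi>. N\<^sub>z[M\<^sup>\<bullet>] \<pi> >>= M\<^sub>z)\<close> at \<open>z\<^sup>1\<close>.  The composite of the two spans is
    \<open>(z\<^sup>2 >>= N\<^sub>z[M\<^sup>\<bullet>]) >>= M\<^sub>z\<close>, and the two agree by associativity of bind (\<open>left_leg_inst\<close>).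

  That Euclidean lenses form a category holds over any category with binary products: the left leg
  of a composite is obtained by pulling back one leg along \<open>f \<times> 1\<close>, and the category laws say that
  this pullback is functorial.
\<close>

section \<open>Euclidean lenses form a category\<close>

context category_with_products
begin

text \<open>The leg of a lens over \<open>B\<close>, transported along \<open>f : A \<rightarrow> B\<close>.  When \<open>G;\<pi>\<^sub>1 = \<pi>\<^sub>1\<close> this is the
  pullback of \<open>G\<close> along \<open>f \<times> 1\<close>, so a composite lens has left leg \<open>pull f G ; F\<close>.\<close>

definition pull :: "'o \<Rightarrow> 'o \<Rightarrow> 'o \<Rightarrow> 'o \<Rightarrow> 'a \<Rightarrow> 'a \<Rightarrow> 'a" where
  "pull A B Y Z f G = tup \<L> (prd \<L> A Z) A Y (pr1 \<L> A Z)
     (cmp \<L> (prd \<L> A Z) (prd \<L> B Z) Y (prd_map \<L> A Z B Z f (ide \<L> Z))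
       (cmp \<L> (prd \<L> B Z) (prd \<L> B Y) Y G (pr2 \<L> B Y)))"

lemma tup_ext:
  assumes "A \<in> obj \<L>" "B \<in> obj \<L>" "C \<in> obj \<L>" "h \<in> hom \<L> C (prd \<L> A B)" "k \<in> hom \<L> C (prd \<L> A B)"
    and "cmp \<L> C (prd \<L> A B) A h (pr1 \<L> A B) = cmp \<L> C (prd \<L> A B) A k (pr1 \<L> A B)"
    and "cmp \<L> C (prd \<L> A B) B h (pr2 \<L> A B) = cmp \<L> C (prd \<L> A B) B k (pr2 \<L> A B)"
  shows "h = k"
  using tup_unique[OF assms(1-4) assms(6,7)] tup_unique[OF assms(1-3,5) refl refl] by simp

context
  fixes A B Z f
  assumes [simp]: "A \<in> obj \<L>" "B \<in> obj \<L>" "Z \<in> obj \<L>" "f \<in> hom \<L> A B"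
begin

lemma prd_map_ide_hom: "prd_map \<L> A Z B Z f (ide \<L> Z) \<in> hom \<L> (prd \<L> A Z) (prd \<L> B Z)"
  by (auto simp: prd_map_def intro!: tup_hom cmp_hom prd_obj pr1_hom pr2_hom ide_hom)

lemma prd_map_ide_pr1:
  "cmp \<L> (prd \<L> A Z) (prd \<L> B Z) B (prd_map \<L> A Z B Z f (ide \<L> Z)) (pr1 \<L> B Z)
    = cmp \<L> (prd \<L> A Z) A B (pr1 \<L> A Z) f"
  unfolding prd_map_def
  by (rule tup_pr1) (auto intro!: cmp_hom prd_obj pr1_hom pr2_hom ide_hom)

lemma prd_map_ide_pr2:
  "cmp \<L> (prd \<L> A Z) (prd \<L> B Z) Z (prd_map \<L> A Z B Z f (ide \<L> Z)) (pr2 \<L> B Z) = pr2 \<L> A Z"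
proof -
  have "cmp \<L> (prd \<L> A Z) (prd \<L> B Z) Z (prd_map \<L> A Z B Z f (ide \<L> Z)) (pr2 \<L> B Z)
      = cmp \<L> (prd \<L> A Z) Z Z (pr2 \<L> A Z) (ide \<L> Z)"
    unfolding prd_map_def
    by (rule tup_pr2) (auto intro!: cmp_hom prd_obj pr1_hom pr2_hom ide_hom)
  also have "\<dots> = pr2 \<L> A Z"
    by (auto intro!: cmp_ide_right prd_obj pr2_hom)
  finally show ?thesis .
qed

context
  fixes Y G
  assumes [simp]: "Y \<in> obj \<L>" "G \<in> hom \<L> (prd \<L> B Z) (prd \<L> B Y)"
begin

lemma pull_hom: "pull A B Y Z f G \<in> hom \<L> (prd \<L> A Z) (prd \<L> A Y)"
  unfolding pull_def
  by (intro tup_hom cmp_hom[where B = "prd \<L> B Z"] cmp_hom[where B = "prd \<L> B Y"])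
    (auto intro!: prd_obj pr1_hom pr2_hom prd_map_ide_hom)

lemma pull_pr1:
  "cmp \<L> (prd \<L> A Z) (prd \<L> A Y) A (pull A B Y Z f G) (pr1 \<L> A Y) = pr1 \<L> A Z"
  unfolding pull_def
  by (intro tup_pr1 cmp_hom[where B = "prd \<L> B Z"] cmp_hom[where B = "prd \<L> B Y"])
    (auto intro!: prd_obj pr1_hom pr2_hom prd_map_ide_hom)

lemma pull_pr2:
  "cmp \<L> (prd \<L> A Z) (prd \<L> A Y) Y (pull A B Y Z f G) (pr2 \<L> A Y)
    = cmp \<L> (prd \<L> A Z) (prd \<L> B Z) Y (prd_map \<L> A Z B Z f (ide \<L> Z))
        (cmp \<L> (prd \<L> B Z) (prd \<L> B Y) Y G (pr2 \<L> B Y))"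
  unfolding pull_def
  by (intro tup_pr2 cmp_hom[where B = "prd \<L> B Z"] cmp_hom[where B = "prd \<L> B Y"])
    (auto intro!: prd_obj pr1_hom pr2_hom prd_map_ide_hom)

end

end

lemma prd_map_ide_ide:
  assumes [simp]: "A \<in> obj \<L>" "Z \<in> obj \<L>"
  shows "prd_map \<L> A Z A Z (ide \<L> A) (ide \<L> Z) = ide \<L> (prd \<L> A Z)"
  by (rule tup_ext[of A Z "prd \<L> A Z"])
    (simp_all add: prd_map_ide_hom prd_map_ide_pr1 prd_map_ide_pr2 ide_hom prd_obj cmp_ide_left
      cmp_ide_right pr1_hom pr2_hom)

lemma prd_map_ide_cmp:
  assumes [simp]: "A \<in> obj \<L>" "B \<in> obj \<L>" "C \<in> obj \<L>" "Z \<in> obj \<L>"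
    and [simp]: "f \<in> hom \<L> A B" "g \<in> hom \<L> B C"
  shows "prd_map \<L> A Z C Z (cmp \<L> A B C f g) (ide \<L> Z)
    = cmp \<L> (prd \<L> A Z) (prd \<L> B Z) (prd \<L> C Z)
        (prd_map \<L> A Z B Z f (ide \<L> Z)) (prd_map \<L> B Z C Z g (ide \<L> Z))"
  (is "?l = ?r")
proof (rule tup_ext[of C Z "prd \<L> A Z"])
  have [simp]: "cmp \<L> A B C f g \<in> hom \<L> A C"
    by (rule cmp_hom) simp_all
  show "?l \<in> hom \<L> (prd \<L> A Z) (prd \<L> C Z)"
    by (rule prd_map_ide_hom) simp_all
  show "?r \<in> hom \<L> (prd \<L> A Z) (prd \<L> C Z)"
    by (rule cmp_hom[where B = "prd \<L> B Z"]) (simp_all add: prd_obj prd_map_ide_hom)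
  show "cmp \<L> (prd \<L> A Z) (prd \<L> C Z) C ?l (pr1 \<L> C Z) =
      cmp \<L> (prd \<L> A Z) (prd \<L> C Z) C ?r (pr1 \<L> C Z)"
    by (simp add: cmp_assoc[where B = "prd \<L> B Z" and C = "prd \<L> C Z"] prd_obj prd_map_ide_hom
        pr1_hom prd_map_ide_pr1
        cmp_assoc[where A = "prd \<L> A Z" and B = "prd \<L> B Z" and C = B, symmetric])
      (simp add: cmp_assoc[where A = "prd \<L> A Z" and B = A and C = B] prd_obj pr1_hom)
  show "cmp \<L> (prd \<L> A Z) (prd \<L> C Z) Z ?l (pr2 \<L> C Z) =
      cmp \<L> (prd \<L> A Z) (prd \<L> C Z) Z ?r (pr2 \<L> C Z)"
    by (simp add: cmp_assoc[where B = "prd \<L> B Z" and C = "prd \<L> C Z"] prd_obj prd_map_ide_hom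
        pr2_hom prd_map_ide_pr2)
qed (simp_all add: prd_obj)

lemma pull_along_ide:
  assumes [simp]: "A \<in> obj \<L>" "Y \<in> obj \<L>" "Z \<in> obj \<L>" "G \<in> hom \<L> (prd \<L> A Z) (prd \<L> A Y)"
    and "cmp \<L> (prd \<L> A Z) (prd \<L> A Y) A G (pr1 \<L> A Y) = pr1 \<L> A Z"
  shows "pull A A Y Z (ide \<L> A) G = G"
  by (rule tup_ext[of A Y "prd \<L> A Z"])
    (simp_all add: assms ide_hom prd_obj pull_hom pull_pr1 pull_pr2 prd_map_ide_ide cmp_ide_left
      cmp_hom[where B = "prd \<L> A Y"] pr2_hom)

lemma pull_ide:
  assumes [simp]: "A \<in> obj \<L>" "B \<in> obj \<L>" "Z \<in> obj \<L>" "f \<in> hom \<L> A B"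
  shows "pull A B Z Z f (ide \<L> (prd \<L> B Z)) = ide \<L> (prd \<L> A Z)"
  by (rule tup_ext[of A Z "prd \<L> A Z"])
    (simp_all add: ide_hom prd_obj pull_hom pull_pr1 pull_pr2 prd_map_ide_pr2 cmp_ide_left
      pr1_hom pr2_hom)

text \<open>The pullback square, for a leg that is itself transported: pulling \<open>H\<close> back along \<open>f;g\<close> lies
  over pulling it back along \<open>g\<close>.  First components agree since \<open>pull\<close> keeps the base point,
  second components since \<open>(f \<times> 1);(g \<times> 1) = (f;g) \<times> 1\<close>.\<close>

lemma pull_square:
  assumes [simp]: "A \<in> obj \<L>" "B \<in> obj \<L>" "C \<in> obj \<L>" "Y \<in> obj \<L>" "Z \<in> obj \<L>"
    and [simp]: "f \<in> hom \<L> A B" "g \<in> hom \<L> B C" "H \<in> hom \<L> (prd \<L> C Z) (prd \<L> C Y)"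
  shows "cmp \<L> (prd \<L> A Z) (prd \<L> A Y) (prd \<L> B Y)
      (pull A C Y Z (cmp \<L> A B C f g) H) (prd_map \<L> A Y B Y f (ide \<L> Y))
    = cmp \<L> (prd \<L> A Z) (prd \<L> B Z) (prd \<L> B Y)
      (prd_map \<L> A Z B Z f (ide \<L> Z)) (pull B C Y Z g H)" (is "?l = ?r")
proof -
  have [simp]: "cmp \<L> A B C f g \<in> hom \<L> A C"
    by (rule cmp_hom) simp_all
  note homs = prd_obj prd_map_ide_hom pull_hom pr1_hom pr2_hom
  show ?thesis
  proof (rule tup_ext[of B Y "prd \<L> A Z"])
    show "?l \<in> hom \<L> (prd \<L> A Z) (prd \<L> B Y)"
      by (rule cmp_hom[where B = "prd \<L> A Y"]) (simp_all add: homs)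
    show "?r \<in> hom \<L> (prd \<L> A Z) (prd \<L> B Y)"
      by (rule cmp_hom[where B = "prd \<L> B Z"]) (simp_all add: homs)
    have "cmp \<L> (prd \<L> A Z) (prd \<L> B Y) B ?l (pr1 \<L> B Y) = cmp \<L> (prd \<L> A Z) A B (pr1 \<L> A Z) f"
      by (simp add: homs cmp_assoc[where B = "prd \<L> A Y" and C = "prd \<L> B Y"] prd_map_ide_pr1)
        (simp add: homs cmp_assoc[where B = "prd \<L> A Y" and C = A, symmetric] pull_pr1)
    also have "\<dots> = cmp \<L> (prd \<L> A Z) (prd \<L> B Y) B ?r (pr1 \<L> B Y)"
      by (simp add: homs cmp_assoc[where B = "prd \<L> B Z" and C = "prd \<L> B Y"] prd_map_ide_pr1
          pull_pr1)
    finally show "cmp \<L> (prd \<L> A Z) (prd \<L> B Y) B ?l (pr1 \<L> B Y)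
      = cmp \<L> (prd \<L> A Z) (prd \<L> B Y) B ?r (pr1 \<L> B Y)" .
    have HY: "cmp \<L> (prd \<L> C Z) (prd \<L> C Y) Y H (pr2 \<L> C Y) \<in> hom \<L> (prd \<L> C Z) Y"
      by (rule cmp_hom[where B = "prd \<L> C Y"]) (simp_all add: homs)
    have "cmp \<L> (prd \<L> A Z) (prd \<L> B Y) Y ?l (pr2 \<L> B Y)
      = cmp \<L> (prd \<L> A Z) (prd \<L> C Z) Y (prd_map \<L> A Z C Z (cmp \<L> A B C f g) (ide \<L> Z))
        (cmp \<L> (prd \<L> C Z) (prd \<L> C Y) Y H (pr2 \<L> C Y))"
      by (simp add: homs cmp_assoc[where B = "prd \<L> A Y" and C = "prd \<L> B Y"] prd_map_ide_pr2
          pull_pr2)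
    also have "\<dots> = cmp \<L> (prd \<L> A Z) (prd \<L> B Y) Y ?r (pr2 \<L> B Y)"
      by (simp add: homs HY prd_map_ide_cmp cmp_assoc[where B = "prd \<L> B Z" and C = "prd \<L> B Y"]
          cmp_assoc[where B = "prd \<L> B Z" and C = "prd \<L> C Z"] pull_pr2)
    finally show "cmp \<L> (prd \<L> A Z) (prd \<L> B Y) Y ?l (pr2 \<L> B Y)
      = cmp \<L> (prd \<L> A Z) (prd \<L> B Y) Y ?r (pr2 \<L> B Y)" .
  qed (simp_all add: homs)
qed

text \<open>Transport respects composition of legs; this is associativity of lens composition.\<close>

lemma pull_cmp:
  assumes [simp]: "A \<in> obj \<L>" "B \<in> obj \<L>" "C \<in> obj \<L>" "X \<in> obj \<L>" "Y \<in> obj \<L>" "Z \<in> obj \<L>"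
    and [simp]: "f \<in> hom \<L> A B" "g \<in> hom \<L> B C" "G \<in> hom \<L> (prd \<L> B Y) (prd \<L> B X)"
      "H \<in> hom \<L> (prd \<L> C Z) (prd \<L> C Y)"
  shows "pull A B X Z f (cmp \<L> (prd \<L> B Z) (prd \<L> B Y) (prd \<L> B X) (pull B C Y Z g H) G)
    = cmp \<L> (prd \<L> A Z) (prd \<L> A Y) (prd \<L> A X)
        (pull A C Y Z (cmp \<L> A B C f g) H) (pull A B X Y f G)" (is "?l = ?r")
proof -
  have [simp]: "cmp \<L> A B C f g \<in> hom \<L> A C"
    by (rule cmp_hom) simp_all
  note homs = prd_obj prd_map_ide_hom pull_hom pr1_hom pr2_hom
  have [simp]: "cmp \<L> (prd \<L> B Z) (prd \<L> B Y) (prd \<L> B X) (pull B C Y Z g H) G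
      \<in> hom \<L> (prd \<L> B Z) (prd \<L> B X)"
    by (rule cmp_hom) (simp_all add: homs)
  have GX: "cmp \<L> (prd \<L> B Y) (prd \<L> B X) X G (pr2 \<L> B X) \<in> hom \<L> (prd \<L> B Y) X"
    by (rule cmp_hom[where B = "prd \<L> B X"]) (simp_all add: homs)
  show ?thesis
  proof (rule tup_ext[of A X "prd \<L> A Z"])
    show "?l \<in> hom \<L> (prd \<L> A Z) (prd \<L> A X)"
      by (simp add: homs)
    show "?r \<in> hom \<L> (prd \<L> A Z) (prd \<L> A X)"
      by (rule cmp_hom[where B = "prd \<L> A Y"]) (simp_all add: homs)
    show "cmp \<L> (prd \<L> A Z) (prd \<L> A X) A ?l (pr1 \<L> A X)
      = cmp \<L> (prd \<L> A Z) (prd \<L> A X) A ?r (pr1 \<L> A X)"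
      by (simp add: homs pull_pr1 cmp_assoc[where B = "prd \<L> A Y" and C = "prd \<L> A X"])
    have "cmp \<L> (prd \<L> A Z) (prd \<L> A X) X ?l (pr2 \<L> A X)
      = cmp \<L> (prd \<L> A Z) (prd \<L> B Y) X
          (cmp \<L> (prd \<L> A Z) (prd \<L> B Z) (prd \<L> B Y)
            (prd_map \<L> A Z B Z f (ide \<L> Z)) (pull B C Y Z g H))
          (cmp \<L> (prd \<L> B Y) (prd \<L> B X) X G (pr2 \<L> B X))"
      by (simp add: homs GX pull_pr2 cmp_assoc[where B = "prd \<L> B Y" and C = "prd \<L> B X"]
          cmp_assoc[where B = "prd \<L> B Z" and C = "prd \<L> B Y"])
    also have "\<dots> = cmp \<L> (prd \<L> A Z) (prd \<L> A X) X ?r (pr2 \<L> A X)"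
      by (simp add: homs GX pull_pr2 pull_square[symmetric]
          cmp_assoc[where B = "prd \<L> A Y" and C = "prd \<L> A X"]
          cmp_assoc[where B = "prd \<L> A Y" and C = "prd \<L> B Y"])
    finally show "cmp \<L> (prd \<L> A Z) (prd \<L> A X) X ?l (pr2 \<L> A X)
      = cmp \<L> (prd \<L> A Z) (prd \<L> A X) X ?r (pr2 \<L> A X)" .
  qed (simp_all add: homs)
qed

lemma ELens_obj: "(A, X, p) \<in> obj (ELens \<L>) \<longleftrightarrow> A \<in> obj \<L> \<and> X \<in> obj \<L> \<and> p = pr1 \<L> A X"
  by (auto simp: ELens_def first_projection_def)

lemma ELens_hom: "(f, F, R) \<in> hom (ELens \<L>) (A, X, p) (B, Y, q) \<longleftrightarrow>
    f \<in> hom \<L> A B \<and> F \<in> hom \<L> (prd \<L> A Y) (prd \<L> A X) \<and>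
    R = prd_map \<L> A Y B Y f (ide \<L> Y) \<and>
    cmp \<L> (prd \<L> A Y) (prd \<L> A X) A F (pr1 \<L> A X) = pr1 \<L> A Y"
  by (simp add: ELens_def)

lemma ELens_ide: "ide (ELens \<L>) (A, X, p) = (ide \<L> A, ide \<L> (prd \<L> A X), ide \<L> (prd \<L> A X))"
  by (simp add: ELens_def)

lemma ELens_cmp: "cmp (ELens \<L>) (A, X, p) (B, Y, q) (C, Z, r) (f, F, R) (g, G, S) =
    (cmp \<L> A B C f g,
     cmp \<L> (prd \<L> A Z) (prd \<L> A Y) (prd \<L> A X) (pull A B Y Z f G) F,
     prd_map \<L> A Z C Z (cmp \<L> A B C f g) (ide \<L> Z))"
  by (simp add: ELens_def pull_def)

theorem ELens_category: "category (ELens \<L>)"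
proof
  fix A assume "A \<in> obj (ELens \<L>)"
  then show "ide (ELens \<L>) A \<in> hom (ELens \<L>) A A"
    by (cases A) (simp add: ELens_obj ELens_hom ELens_ide ide_hom prd_map_ide_ide prd_obj
        cmp_ide_left pr1_hom)
next
  fix A B C f g
  assume "A \<in> obj (ELens \<L>)" "B \<in> obj (ELens \<L>)" "C \<in> obj (ELens \<L>)"
    "f \<in> hom (ELens \<L>) A B" "g \<in> hom (ELens \<L>) B C"
  then show "cmp (ELens \<L>) A B C f g \<in> hom (ELens \<L>) A C"
    apply (cases A; cases B; cases C; cases f; cases g)
    apply (clarsimp simp: ELens_obj ELens_hom ELens_cmp cmp_hom)
    subgoal for A X B Y C Z f F g G
      by (auto intro!: cmp_hom[where B = "prd \<L> A Y"] simp: prd_obj pull_hom pr1_hom pull_pr1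
          cmp_assoc[where B = "prd \<L> A Y" and C = "prd \<L> A X"])
    done
next
  fix A B f
  assume "A \<in> obj (ELens \<L>)" "B \<in> obj (ELens \<L>)" "f \<in> hom (ELens \<L>) A B"
  then show "cmp (ELens \<L>) A A B (ide (ELens \<L>) A) f = f"
    by (cases A; cases B; cases f) (clarsimp simp: ELens_obj ELens_hom ELens_ide ELens_cmp
        cmp_ide_left pull_along_ide cmp_ide_right prd_obj)
next
  fix A B f
  assume "A \<in> obj (ELens \<L>)" "B \<in> obj (ELens \<L>)" "f \<in> hom (ELens \<L>) A B"
  then show "cmp (ELens \<L>) A B B f (ide (ELens \<L>) B) = f"
    by (cases A; cases B; cases f) (clarsimp simp: ELens_obj ELens_hom ELens_ide ELens_cmp
        cmp_ide_left pull_ide cmp_ide_right prd_obj)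
next
  fix A B C D f g h
  assume "A \<in> obj (ELens \<L>)" "B \<in> obj (ELens \<L>)" "C \<in> obj (ELens \<L>)" "D \<in> obj (ELens \<L>)"
    "f \<in> hom (ELens \<L>) A B" "g \<in> hom (ELens \<L>) B C" "h \<in> hom (ELens \<L>) C D"
  then show "cmp (ELens \<L>) A C D (cmp (ELens \<L>) A B C f g) h
    = cmp (ELens \<L>) A B D f (cmp (ELens \<L>) B C D g h)"
    apply (cases A; cases B; cases C; cases D; cases f; cases g; cases h)
    apply (clarsimp simp: ELens_obj ELens_hom ELens_cmp cmp_assoc pull_cmp)
    subgoal for A X B Y C Z D V f F g G h H
      by (simp add: cmp_assoc[where B = "prd \<L> A Z" and C = "prd \<L> A Y"] prd_obj pull_hom
          cmp_hom[where B = B])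
    done
qed

end


section \<open>Renaming and substitution\<close>

lemma ren_up_comp: "ren_up r \<circ> ren_up q = ren_up (r \<circ> q)"
proof
  show "(ren_up r \<circ> ren_up q) n = ren_up (r \<circ> q) n" for n
    by (cases n) auto
qed

lemma ren_up_Suc: "ren_up r \<circ> Suc = Suc \<circ> r"
  by (simp add: comp_def)

lemma ren_up_case_nat: "ren_up r = case_nat 0 (\<lambda>n. Suc (r n))"
proof
  show "ren_up r n = case_nat 0 (\<lambda>n. Suc (r n)) n" for n
    by (cases n) auto
qed

lemma sub_up_case_nat: "sub_up s = case_nat (Var 0) (\<lambda>n. shift (s n))"
proof
  show "sub_up s n = case_nat (Var 0) (\<lambda>n. shift (s n)) n" for n
    by (cases n) auto
qed

lemma psub_up_case_nat: "psub_up s = case_nat (PVar 0) (\<lambda>n. pshift (s n))"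
proof
  show "psub_up s n = case_nat (PVar 0) (\<lambda>n. pshift (s n)) n" for n
    by (cases n) auto
qed

lemma ren_ren: "ren r (ren q M) = ren (r \<circ> q) M"
  by (induction M arbitrary: r q) (auto simp: ren_up_comp)

lemma sub_ren: "sub s (ren r M) = sub (s \<circ> r) M"
proof (induction M arbitrary: s r)
  case (Lam M)
  have "sub_up s \<circ> ren_up r = sub_up (s \<circ> r)"
    by (auto simp: fun_eq_iff sub_up_case_nat ren_up_case_nat split: nat.splits)
  then show ?case by (simp add: Lam comp_def)
qed auto

lemma ren_sub: "ren r (sub s M) = sub (ren r \<circ> s) M"
proof (induction M arbitrary: s r)
  case (Lam M)
  have "ren (ren_up r) \<circ> sub_up s = sub_up (ren r \<circ> s)"
    by (auto simp: fun_eq_iff sub_up_case_nat ren_up_case_nat ren_ren comp_def split: nat.splits)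
  then show ?case by (simp add: Lam comp_def)
qed auto

lemma sub_sub: "sub s (sub t M) = sub (sub s \<circ> t) M"
proof (induction M arbitrary: s t)
  case (Lam M)
  have "sub (sub_up s) \<circ> sub_up t = sub_up (sub s \<circ> t)"
    by (auto simp: fun_eq_iff sub_up_case_nat ren_sub sub_ren comp_def split: nat.splits)
  then show ?case by (simp add: Lam comp_def)
qed auto

lemma sub_Var: "sub Var M = M"
proof (induction M)
  case (Lam M)
  have "sub_up Var = Var"
    by (auto simp: fun_eq_iff sub_up_case_nat split: nat.splits)
  then show ?case by (simp add: Lam comp_def)
qed auto

lemma pren_pren: "pren r (pren q M) = pren (r \<circ> q) M"
  by (induction M arbitrary: r q) (auto simp: ren_up_comp)

lemma psub_pren: "psub s (pren r M) = psub (s \<circ> r) M"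
proof (induction M arbitrary: s r)
  case (PLam M)
  have "psub_up s \<circ> ren_up r = psub_up (s \<circ> r)"
    by (auto simp: fun_eq_iff psub_up_case_nat ren_up_case_nat split: nat.splits)
  then show ?case by (simp add: PLam comp_def)
qed auto

lemma pren_psub: "pren r (psub s M) = psub (pren r \<circ> s) M"
proof (induction M arbitrary: s r)
  case (PLam M)
  have "pren (ren_up r) \<circ> psub_up s = psub_up (pren r \<circ> s)"
    by (auto simp: fun_eq_iff psub_up_case_nat ren_up_case_nat pren_pren comp_def split: nat.splits)
  then show ?case by (simp add: PLam comp_def)
qed auto

lemma psub_psub: "psub s (psub t M) = psub (psub s \<circ> t) M"
proof (induction M arbitrary: s t)
  case (PLam M)
  have "psub (psub_up s) \<circ> psub_up t = psub_up (psub s \<circ> t)"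
    by (auto simp: fun_eq_iff psub_up_case_nat pren_psub psub_pren comp_def split: nat.splits)
  then show ?case by (simp add: PLam comp_def)
qed auto

lemma psub_PVar: "psub PVar M = M"
proof (induction M)
  case (PLam M)
  have "psub_up PVar = PVar"
    by (auto simp: fun_eq_iff psub_up_case_nat split: nat.splits)
  then show ?case by (simp add: PLam comp_def)
qed auto

lemma pren_eq_psub: "pren r M = psub (PVar \<circ> r) M"
  using psub_pren[of PVar r M] by (simp add: psub_PVar)

lemma ren_eq_sub: "ren r M = sub (Var \<circ> r) M"
  using sub_ren[of Var r M] by (simp add: sub_Var)

text \<open>Every composite of renamings and substitutions is one parallel substitution; with these
  rules an identity between such composites reduces to a pointwise comparison on indices.\<close>

lemmas psub_fuse = pinst_def psub_psub pren_psub psub_pren pren_pren pren_eq_psub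
  psub_up_case_nat ren_up_case_nat comp_def

lemmas sub_fuse = inst_def sub_sub ren_sub sub_ren ren_ren ren_eq_sub
  sub_up_case_nat ren_up_case_nat comp_def

lemma psub_ext: "(\<And>i. s i = t i) \<Longrightarrow> psub s M = psub t M"
  by (drule ext) simp

lemma sub_ext: "(\<And>i. s i = t i) \<Longrightarrow> sub s M = sub t M"
  by (drule ext) simp

lemma sub_inst: "sub s (inst N M) = inst (sub s N) (sub (sub_up s) M)"
  by (simp add: sub_fuse, rule sub_ext) (simp add: sub_sub comp_def sub_Var split: nat.split)

lemma sub_up_shift: "sub (sub_up s) (shift M) = shift (sub s M)"
  by (simp add: sub_ren ren_sub comp_def)

lemma psub_pinst: "psub s (pinst N M) = pinst (psub s N) (psub (psub_up s) M)"
  by (simp add: psub_fuse, rule psub_ext) (simp add: psub_psub comp_def psub_PVar split: nat.split)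

lemma psub_up_pshift: "psub (psub_up s) (pshift M) = pshift (psub s M)"
  by (simp add: psub_pren pren_psub comp_def)


section \<open>Typing and the equational theories\<close>

definition ren_typed :: "'t list \<Rightarrow> (nat \<Rightarrow> nat) \<Rightarrow> 't list \<Rightarrow> bool" where
  "ren_typed \<Delta> r \<Gamma> \<longleftrightarrow> (\<forall>i<length \<Gamma>. r i < length \<Delta> \<and> \<Delta> ! r i = \<Gamma> ! i)"

definition sub_typed :: "'g ty list \<Rightarrow> (nat \<Rightarrow> tm) \<Rightarrow> 'g ty list \<Rightarrow> bool" where
  "sub_typed \<Delta> s \<Gamma> \<longleftrightarrow> (\<forall>i<length \<Gamma>. \<Delta> \<turnstile> s i : \<Gamma> ! i)"

definition psub_typed :: "'p pty list \<Rightarrow> (nat \<Rightarrow> ptm) \<Rightarrow> 'p pty list \<Rightarrow> bool" where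
  "psub_typed \<Delta> s \<Gamma> \<longleftrightarrow> (\<forall>i<length \<Gamma>. \<Delta> \<turnstile>\<^sub>P s i : \<Gamma> ! i)"

lemma ren_typed_up: "ren_typed \<Delta> r \<Gamma> \<Longrightarrow> ren_typed (T # \<Delta>) (ren_up r) (T # \<Gamma>)"
  unfolding ren_typed_def by (auto simp: nth_Cons ren_up_case_nat split: nat.splits)

lemma ren_typed_Suc [simp, intro]: "ren_typed (T # \<Gamma>) Suc \<Gamma>"
  by (simp add: ren_typed_def)

lemma typed_ren: "\<Gamma> \<turnstile> M : T \<Longrightarrow> ren_typed \<Delta> r \<Gamma> \<Longrightarrow> \<Delta> \<turnstile> ren r M : T"
proof (induction arbitrary: \<Delta> r rule: typed.induct)
  case (t_Var n \<Gamma> T)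
  then show ?case by (auto simp: ren_typed_def intro!: typed.t_Var)
qed (simp_all, (blast intro: typed.intros ren_typed_up)+)

lemma ptyped_pren: "\<Gamma> \<turnstile>\<^sub>P M : T \<Longrightarrow> ren_typed \<Delta> r \<Gamma> \<Longrightarrow> \<Delta> \<turnstile>\<^sub>P pren r M : T"
proof (induction arbitrary: \<Delta> r rule: ptyped.induct)
  case (pt_Var n \<Gamma> T)
  then show ?case by (auto simp: ren_typed_def intro!: ptyped.pt_Var)
qed (simp_all, (blast intro: ptyped.intros ren_typed_up)+)

lemma typed_shift: "\<Gamma> \<turnstile> M : T \<Longrightarrow> U # \<Gamma> \<turnstile> shift M : T"
  by (erule typed_ren) simp

lemma ptyped_pshift: "\<Gamma> \<turnstile>\<^sub>P M : T \<Longrightarrow> U # \<Gamma> \<turnstile>\<^sub>P pshift M : T"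
  by (erule ptyped_pren) simp

lemma sub_typed_Cons:
  "sub_typed \<Delta> (case_nat N s) (T # \<Gamma>) \<longleftrightarrow> \<Delta> \<turnstile> N : T \<and> sub_typed \<Delta> s \<Gamma>"
  unfolding sub_typed_def by (auto simp: nth_Cons less_Suc_eq_0_disj split: nat.splits)

lemma psub_typed_Cons:
  "psub_typed \<Delta> (case_nat N s) (T # \<Gamma>) \<longleftrightarrow> \<Delta> \<turnstile>\<^sub>P N : T \<and> psub_typed \<Delta> s \<Gamma>"
  unfolding psub_typed_def by (auto simp: nth_Cons less_Suc_eq_0_disj split: nat.splits)

lemma sub_typed_Var: "sub_typed \<Gamma> Var \<Gamma>"
  by (simp add: sub_typed_def typed.t_Var)

lemma psub_typed_PVar: "psub_typed \<Gamma> PVar \<Gamma>"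
  by (simp add: psub_typed_def ptyped.pt_Var)

lemma psub_typed_PVar_Suc: "psub_typed (T # \<Gamma>) (\<lambda>i. PVar (Suc i)) \<Gamma>"
  by (simp add: psub_typed_def ptyped.pt_Var)

lemma sub_typed_up: "sub_typed \<Delta> s \<Gamma> \<Longrightarrow> sub_typed (T # \<Delta>) (sub_up s) (T # \<Gamma>)"
  unfolding sub_up_case_nat sub_typed_Cons
  by (auto simp: sub_typed_def intro: typed.t_Var typed_shift)

lemma psub_typed_up: "psub_typed \<Delta> s \<Gamma> \<Longrightarrow> psub_typed (T # \<Delta>) (psub_up s) (T # \<Gamma>)"
  unfolding psub_up_case_nat psub_typed_Cons
  by (auto simp: psub_typed_def intro: ptyped.pt_Var ptyped_pshift)

lemma typed_sub: "\<Gamma> \<turnstile> M : T \<Longrightarrow> sub_typed \<Delta> s \<Gamma> \<Longrightarrow> \<Delta> \<turnstile> sub s M : T"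
proof (induction arbitrary: \<Delta> s rule: typed.induct)
  case (t_Var n \<Gamma> T)
  then show ?case by (auto simp: sub_typed_def)
qed (simp_all, (blast intro: typed.intros sub_typed_up)+)

lemma ptyped_psub: "\<Gamma> \<turnstile>\<^sub>P M : T \<Longrightarrow> psub_typed \<Delta> s \<Gamma> \<Longrightarrow> \<Delta> \<turnstile>\<^sub>P psub s M : T"
proof (induction arbitrary: \<Delta> s rule: ptyped.induct)
  case (pt_Var n \<Gamma> T)
  then show ?case by (auto simp: psub_typed_def)
qed (simp_all, (blast intro: ptyped.intros psub_typed_up)+)

lemma typed_inst: "T # \<Gamma> \<turnstile> M : U \<Longrightarrow> \<Gamma> \<turnstile> N : T \<Longrightarrow> \<Gamma> \<turnstile> inst N M : U"
  unfolding inst_def by (erule typed_sub) (simp add: sub_typed_Cons sub_typed_Var)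

lemma ptyped_pinst: "T # \<Gamma> \<turnstile>\<^sub>P M : U \<Longrightarrow> \<Gamma> \<turnstile>\<^sub>P N : T \<Longrightarrow> \<Gamma> \<turnstile>\<^sub>P pinst N M : U"
  unfolding pinst_def by (erule ptyped_psub) (simp add: psub_typed_Cons psub_typed_PVar)

lemma typed_Var0: "T # \<Gamma> \<turnstile> Var 0 : T"
  by (simp add: typed.t_Var)

lemma ptyped_PVar0: "T # \<Gamma> \<turnstile>\<^sub>P PVar 0 : T"
  by (simp add: ptyped.pt_Var)

lemma eqtm_typed: "\<Gamma> \<turnstile> M \<approx> N : T \<Longrightarrow> \<Gamma> \<turnstile> M : T \<and> \<Gamma> \<turnstile> N : T"
proof (induction rule: eqtm.induct)
  case (e_eta \<Gamma> M E F)
  then show ?case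
    by (auto intro!: typed.t_Lam typed.t_App[where E = E] typed_shift typed.t_Var)
qed (auto intro: typed.intros typed_inst)

lemma peq_typed: "\<Gamma> \<turnstile>\<^sub>P M \<approx> N : T \<Longrightarrow> \<Gamma> \<turnstile>\<^sub>P M : T \<and> \<Gamma> \<turnstile>\<^sub>P N : T"
proof (induction rule: peq.induct)
  case (pe_eta \<Gamma> M T U)
  then show ?case
    by (auto intro!: ptyped.pt_Lam ptyped.pt_App[where T = T] ptyped_pshift ptyped.pt_Var)
next
  case (pe_bind_assoc \<Gamma> M T N U L V)
  then show ?case
    by (intro conjI ptyped.pt_Bind[where T = T] ptyped.pt_Bind[where T = U]
        ptyped.pt_Lam ptyped.pt_App[where T = T] ptyped_pshift ptyped.pt_Var) auto
next
  case (pe_bind_ret \<Gamma> M T)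
  then show ?case
    by (intro conjI ptyped.pt_Bind[where T = T] ptyped.pt_Lam ptyped.pt_Ret ptyped_PVar0)
qed (auto intro: ptyped.intros ptyped_pinst)

lemmas peq_typed1 = peq_typed[THEN conjunct1]
lemmas peq_typed2 = peq_typed[THEN conjunct2]

lemmas eqtm_cong = e_Lam e_App

lemmas peq_cong = pe_Lam pe_App pe_Pair pe_Fst pe_Snd pe_Ret pe_Bind pe_Plus

text \<open>The axioms with binders or shifts (\<open>\<beta>\<close>, \<open>\<eta>\<close> and associativity of bind) are stable because
  substitution commutes with \<open>inst\<close>, \<open>pinst\<close> and shifting.\<close>

lemma eqtm_sub: "\<Gamma> \<turnstile> M \<approx> N : T \<Longrightarrow> sub_typed \<Delta> s \<Gamma> \<Longrightarrow> \<Delta> \<turnstile> sub s M \<approx> sub s N : T"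
proof (induction arbitrary: \<Delta> s rule: eqtm.induct)
  case (e_sym \<Gamma> M N T)
  then show ?case by (blast intro: eqtm.e_sym)
next
  case (e_trans \<Gamma> M N T L)
  then show ?case by (blast intro: eqtm.e_trans)
next
  case (e_beta E \<Gamma> M F N)
  then show ?case
    unfolding sub_inst sub.simps by (intro eqtm.e_beta) (auto intro: typed_sub sub_typed_up)
next
  case (e_eta \<Gamma> M E F)
  then show ?case
    using eqtm.e_eta[OF typed_sub[OF e_eta]] by (simp add: sub_up_shift)
qed (simp_all, (blast intro: eqtm_cong e_refl typed_sub sub_typed_up)+)

lemma peq_psub:
  "\<Gamma> \<turnstile>\<^sub>P M \<approx> N : T \<Longrightarrow> psub_typed \<Delta> s \<Gamma> \<Longrightarrow> \<Delta> \<turnstile>\<^sub>P psub s M \<approx> psub s N : T"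
proof (induction arbitrary: \<Delta> s rule: peq.induct)
  case (pe_sym \<Gamma> M N T)
  then show ?case by (blast intro: peq.pe_sym)
next
  case (pe_trans \<Gamma> M N T L)
  then show ?case by (blast intro: peq.pe_trans)
next
  case (pe_beta T \<Gamma> M U N)
  then show ?case
    unfolding psub_pinst psub.simps by (intro peq.pe_beta) (auto intro: ptyped_psub psub_typed_up)
next
  case (pe_eta \<Gamma> M T U)
  then show ?case
    using peq.pe_eta[OF ptyped_psub[OF pe_eta]] by (simp add: psub_up_pshift)
next
  case (pe_bind_assoc \<Gamma> M T N U L V)
  show ?case
    using peq.pe_bind_assoc[OF pe_bind_assoc(1-3)[THEN ptyped_psub, OF pe_bind_assoc(4)]]
    by (simp add: psub_up_pshift)
next
  case (pe_fst_pair \<Gamma> M T N U)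
  then show ?case by (auto intro: peq.pe_fst_pair ptyped_psub)
next
  case (pe_snd_pair \<Gamma> M T N U)
  then show ?case by (auto intro: peq.pe_snd_pair ptyped_psub)
next
  case (pe_surj_pair \<Gamma> M T U)
  then show ?case by (auto intro: peq.pe_surj_pair ptyped_psub)
next
  case (pe_ret_bind \<Gamma> M T N U)
  then show ?case by (auto intro: peq.pe_ret_bind ptyped_psub)
next
  case (pe_zero_bind \<Gamma> N T U)
  then show ?case by (auto intro: peq.pe_zero_bind ptyped_psub)
next
  case (pe_plus_bind \<Gamma> M T M' N U)
  then show ?case by (auto intro: peq.pe_plus_bind ptyped_psub)
next
  case (pe_bind_zero \<Gamma> M T U)
  then show ?case by (auto intro: peq.pe_bind_zero ptyped_psub)
next
  case (pe_bind_plus \<Gamma> M T N U N')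
  then show ?case by (auto intro: peq.pe_bind_plus ptyped_psub psub_typed_up)
next
  case (pe_bind_ret \<Gamma> M T)
  then show ?case by (auto intro: peq.pe_bind_ret ptyped_psub)
qed (simp_all, (blast intro: peq_cong pe_refl pe_plus_zero pe_plus_comm pe_plus_assoc ptyped_psub
    psub_typed_up)+)

lemma eqtm_sub_cong:
  "\<Gamma> \<turnstile> M : T \<Longrightarrow> \<forall>i<length \<Gamma>. \<Delta> \<turnstile> s i \<approx> t i : \<Gamma> ! i \<Longrightarrow> \<Delta> \<turnstile> sub s M \<approx> sub t M : T"
proof (induction arbitrary: \<Delta> s t rule: typed.induct)
  case (t_Lam E \<Gamma> M F)
  have "E # \<Delta> \<turnstile> sub_up s i \<approx> sub_up t i : (E # \<Gamma>) ! i" if "i < length (E # \<Gamma>)" for i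
  proof (cases i)
    case 0
    then show ?thesis by (simp add: e_refl typed.t_Var)
  next
    case (Suc j)
    then have "\<Delta> \<turnstile> s j \<approx> t j : \<Gamma> ! j"
      using t_Lam.prems that by simp
    then show ?thesis
      by (simp add: Suc ren_eq_sub) (erule eqtm_sub, simp add: sub_typed_def typed.t_Var)
  qed
  then show ?case
    by (simp add: e_Lam t_Lam.IH)
qed (simp_all, (blast intro: e_App)+)

lemma peq_psub_cong:
  "\<Gamma> \<turnstile>\<^sub>P M : T \<Longrightarrow> \<forall>i<length \<Gamma>. \<Delta> \<turnstile>\<^sub>P s i \<approx> t i : \<Gamma> ! i
    \<Longrightarrow> \<Delta> \<turnstile>\<^sub>P psub s M \<approx> psub t M : T"
proof (induction arbitrary: \<Delta> s t rule: ptyped.induct)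
  case (pt_Lam T \<Gamma> M U)
  have "T # \<Delta> \<turnstile>\<^sub>P psub_up s i \<approx> psub_up t i : (T # \<Gamma>) ! i" if "i < length (T # \<Gamma>)" for i
  proof (cases i)
    case 0
    then show ?thesis by (simp add: pe_refl ptyped.pt_Var)
  next
    case (Suc j)
    then have "\<Delta> \<turnstile>\<^sub>P s j \<approx> t j : \<Gamma> ! j"
      using pt_Lam.prems that by simp
    then show ?thesis
      by (simp add: Suc pren_eq_psub) (erule peq_psub, simp add: psub_typed_def ptyped.pt_Var)
  qed
  then show ?case
    by (simp add: pe_Lam pt_Lam.IH)
qed (simp_all, (blast intro: peq_cong pe_refl ptyped.pt_Zero)+)

text \<open>Composition in the syntactic categories substitutes a term in one context for the only
  variable of another.  The indices that \<open>inst\<close> lowers lie outside the one-entry context, so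
  source and target contexts need not be related.\<close>

lemma typed_inst1: "[T] \<turnstile> M : U \<Longrightarrow> \<Delta> \<turnstile> N : T \<Longrightarrow> \<Delta> \<turnstile> inst N M : U"
  unfolding inst_def by (erule typed_sub) (simp add: sub_typed_def)

lemma ptyped_pinst1: "[T] \<turnstile>\<^sub>P M : U \<Longrightarrow> \<Delta> \<turnstile>\<^sub>P N : T \<Longrightarrow> \<Delta> \<turnstile>\<^sub>P pinst N M : U"
  unfolding pinst_def by (erule ptyped_psub) (simp add: psub_typed_def)

lemma eqtm_inst1:
  assumes "[T] \<turnstile> M \<approx> M' : U" "\<Delta> \<turnstile> N \<approx> N' : T"
  shows "\<Delta> \<turnstile> inst N M \<approx> inst N' M' : U"
proof (rule e_trans)
  show "\<Delta> \<turnstile> inst N M \<approx> inst N M' : U"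
    unfolding inst_def using assms(2)
    by (intro eqtm_sub[OF assms(1)]) (auto dest: eqtm_typed simp: sub_typed_def)
  show "\<Delta> \<turnstile> inst N M' \<approx> inst N' M' : U"
    unfolding inst_def using assms
    by (intro eqtm_sub_cong[where \<Gamma> = "[T]"]) (auto dest: eqtm_typed)
qed

lemma peq_pinst1:
  assumes "[T] \<turnstile>\<^sub>P M \<approx> M' : U" "\<Delta> \<turnstile>\<^sub>P N \<approx> N' : T"
  shows "\<Delta> \<turnstile>\<^sub>P pinst N M \<approx> pinst N' M' : U"
proof (rule pe_trans)
  show "\<Delta> \<turnstile>\<^sub>P pinst N M \<approx> pinst N M' : U"
    unfolding pinst_def using assms(2)
    by (intro peq_psub[OF assms(1)]) (auto dest: peq_typed simp: psub_typed_def)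
  show "\<Delta> \<turnstile>\<^sub>P pinst N M' \<approx> pinst N' M' : U"
    unfolding pinst_def using assms
    by (intro peq_psub_cong[where \<Gamma> = "[T]"]) (auto dest: peq_typed)
qed


section \<open>The syntactic categories\<close>

lemma in_cls: "N \<in> cls A B M \<longleftrightarrow> [A] \<turnstile> M \<approx> N : B"
  by (simp add: cls_def eq_rel_def)

lemma in_pcls: "N \<in> pcls A B M \<longleftrightarrow> [A] \<turnstile>\<^sub>P M \<approx> N : B"
  by (simp add: pcls_def peq_rel_def)

lemma cls_eqI: "[A] \<turnstile> M \<approx> N : B \<Longrightarrow> cls A B M = cls A B N"
  by (rule set_eqI) (unfold in_cls, blast intro: e_sym e_trans)

lemma pcls_eqI: "[A] \<turnstile>\<^sub>P M \<approx> N : B \<Longrightarrow> pcls A B M = pcls A B N"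
  by (rule set_eqI) (unfold in_pcls, blast intro: pe_sym pe_trans)

lemma STLC_homE:
  assumes "f \<in> hom STLC_cat A B"
  obtains M where "[A] \<turnstile> M : B" "f = cls A B M"
  using assms by (auto simp: STLC_cat_def cls_def elim!: quotientE)

lemma P_homE:
  assumes "f \<in> hom P_cat A B"
  obtains M where "[A] \<turnstile>\<^sub>P M : B" "f = pcls A B M"
  using assms by (auto simp: P_cat_def pcls_def elim!: quotientE)

lemma cls_hom: "[A] \<turnstile> M : B \<Longrightarrow> cls A B M \<in> hom STLC_cat A B"
  by (auto simp: STLC_cat_def cls_def intro: quotientI)

lemma pcls_hom: "[A] \<turnstile>\<^sub>P M : B \<Longrightarrow> pcls A B M \<in> hom P_cat A B"
  by (auto simp: P_cat_def pcls_def intro: quotientI)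

lemma UN_UN_const:
  assumes "\<And>x y. x \<in> S \<Longrightarrow> y \<in> T \<Longrightarrow> F x y = c" "a \<in> S" "b \<in> T"
  shows "(\<Union>x\<in>S. \<Union>y\<in>T. F x y) = c"
  using assms by auto

text \<open>Because substitution and pairing respect the equational theory in both arguments, the unions
  in the definitions of composition and pairing range over equal classes.\<close>

lemma cls_cmp:
  assumes "[A] \<turnstile> M : B" "[B] \<turnstile> N : C"
  shows "cmp STLC_cat A B C (cls A B M) (cls B C N) = cls A C (inst M N)"
proof -
  have "cls A C (inst M' N') = cls A C (inst M N)" if "M' \<in> cls A B M" "N' \<in> cls B C N" for M' N'
    using that by (auto simp: in_cls intro!: cls_eqI[symmetric] eqtm_inst1)
  moreover have "M \<in> cls A B M" "N \<in> cls B C N"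
    using assms by (auto simp: in_cls intro: e_refl)
  ultimately show ?thesis
    unfolding STLC_cat_def cat.simps by (intro UN_UN_const)
qed

lemma pcls_cmp:
  assumes "[A] \<turnstile>\<^sub>P M : B" "[B] \<turnstile>\<^sub>P N : C"
  shows "cmp P_cat A B C (pcls A B M) (pcls B C N) = pcls A C (pinst M N)"
proof -
  have "pcls A C (pinst M' N') = pcls A C (pinst M N)"
    if "M' \<in> pcls A B M" "N' \<in> pcls B C N" for M' N'
    using that by (auto simp: in_pcls intro!: pcls_eqI[symmetric] peq_pinst1)
  moreover have "M \<in> pcls A B M" "N \<in> pcls B C N"
    using assms by (auto simp: in_pcls intro: pe_refl)
  ultimately show ?thesis
    unfolding P_cat_def cat.simps prodcat.simps by (intro UN_UN_const)
qed

lemma pcls_tup: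
  assumes "[C] \<turnstile>\<^sub>P M : A" "[C] \<turnstile>\<^sub>P N : B"
  shows "tup P_cat C A B (pcls C A M) (pcls C B N) = pcls C (PProd A B) (PPair M N)"
proof -
  have "pcls C (PProd A B) (PPair M' N') = pcls C (PProd A B) (PPair M N)"
    if "M' \<in> pcls C A M" "N' \<in> pcls C B N" for M' N'
    using that by (auto simp: in_pcls intro!: pcls_eqI[symmetric] pe_Pair)
  moreover have "M \<in> pcls C A M" "N \<in> pcls C B N"
    using assms by (auto simp: in_pcls intro: pe_refl)
  ultimately show ?thesis
    unfolding P_cat_def cat.simps prodcat.simps by (intro UN_UN_const)
qed

text \<open>The category laws hold on the nose for terms in a one-entry context, but the two
  substitutions differ on indices beyond it; hence agreement is required only on the context.\<close>

lemma typed_sub_ext: "\<Gamma> \<turnstile> M : T \<Longrightarrow> \<forall>i<length \<Gamma>. s i = t i \<Longrightarrow> sub s M = sub t M"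
proof (induction arbitrary: s t rule: typed.induct)
  case (t_Lam E \<Gamma> M F)
  have "sub_up s i = sub_up t i" if "i < length (E # \<Gamma>)" for i
    using t_Lam.prems that by (cases i) simp_all
  then have "sub (sub_up s) M = sub (sub_up t) M"
    by (intro t_Lam.IH) blast
  then show ?case by simp
qed auto

lemma ptyped_psub_ext:
  "\<Gamma> \<turnstile>\<^sub>P M : T \<Longrightarrow> \<forall>i<length \<Gamma>. s i = t i \<Longrightarrow> psub s M = psub t M"
proof (induction arbitrary: s t rule: ptyped.induct)
  case (pt_Lam T \<Gamma> M U)
  have "psub_up s i = psub_up t i" if "i < length (T # \<Gamma>)" for i
    using pt_Lam.prems that by (cases i) simp_all
  then have "psub (psub_up s) M = psub (psub_up t) M"
    by (intro pt_Lam.IH) blast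
  then show ?case by simp
qed auto

lemma inst_Var: "[A] \<turnstile> M : B \<Longrightarrow> inst (Var 0) M = M"
  using typed_sub_ext[of "[A]" M B "case_nat (Var 0) Var" Var] by (simp add: inst_def sub_Var)

lemma pinst_PVar: "[A] \<turnstile>\<^sub>P M : B \<Longrightarrow> pinst (PVar 0) M = M"
  using ptyped_psub_ext[of "[A]" M B "case_nat (PVar 0) PVar" PVar]
  by (simp add: pinst_def psub_PVar)

lemma inst_assoc: "[A] \<turnstile> L : B \<Longrightarrow> inst (inst M N) L = inst M (inst N L)"
  unfolding inst_def sub_sub by (rule typed_sub_ext) auto

lemma pinst_assoc: "[A] \<turnstile>\<^sub>P L : B \<Longrightarrow> pinst (pinst M N) L = pinst M (pinst N L)"
  unfolding pinst_def psub_psub by (rule ptyped_psub_ext) auto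

lemma STLC_ide: "ide STLC_cat A = cls A A (Var 0)"
  by (simp add: STLC_cat_def)

lemma P_cat_sel:
  "obj P_cat = UNIV" "ide P_cat A = pcls A A (PVar 0)" "prd P_cat = PProd"
  "pr1 P_cat A B = pcls (PProd A B) A (PFst (PVar 0))"
  "pr2 P_cat A B = pcls (PProd A B) B (PSnd (PVar 0))"
  by (simp_all add: P_cat_def)

lemma STLC_category: "category (STLC_cat :: ('g ty, tm set) cat)"
proof
  show "ide STLC_cat A \<in> hom STLC_cat A A" for A :: "'g ty"
    by (simp add: cls_hom STLC_ide typed_Var0)
next
  show "cmp STLC_cat A B C f g \<in> hom STLC_cat A C"
    if "f \<in> hom STLC_cat A B" "g \<in> hom STLC_cat B C" for A B C :: "'g ty" and f g
    using that by (auto elim!: STLC_homE simp: cls_cmp intro!: cls_hom elim: typed_inst1)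
next
  show "cmp STLC_cat A A B (ide STLC_cat A) f
      = f" if "f \<in> hom STLC_cat A B" for A B :: "'g ty" and f
    using that by (auto elim!: STLC_homE simp: STLC_ide cls_cmp typed_Var0 inst_Var)
next
  show "cmp STLC_cat A B B f (ide STLC_cat B)
      = f" if "f \<in> hom STLC_cat A B" for A B :: "'g ty" and f
    using that by (auto elim!: STLC_homE simp: STLC_ide cls_cmp typed_Var0 inst_def)
next
  show "cmp STLC_cat A C D (cmp STLC_cat A B C f g) h
      = cmp STLC_cat A B D f (cmp STLC_cat B C D g h)"
    if "f \<in> hom STLC_cat A B" "g \<in> hom STLC_cat B C" "h \<in> hom STLC_cat C D"
    for A B C D :: "'g ty" and f g h
    using that by (auto elim!: STLC_homE simp: cls_cmp typed_inst1 inst_assoc)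
qed

lemma P_category_with_products: "category_with_products (P_cat :: ('p pty, ptm set) prodcat)"
proof
  show "ide P_cat A \<in> hom P_cat A A" for A :: "'p pty"
    by (simp add: pcls_hom P_cat_sel ptyped_PVar0)
next
  show "cmp P_cat A B C f g \<in> hom P_cat A C"
    if "f \<in> hom P_cat A B" "g \<in> hom P_cat B C" for A B C :: "'p pty" and f g
    using that by (auto elim!: P_homE simp: pcls_cmp intro!: pcls_hom elim: ptyped_pinst1)
next
  show "cmp P_cat A A B (ide P_cat A) f = f" if "f \<in> hom P_cat A B" for A B :: "'p pty" and f
    using that by (auto elim!: P_homE simp: P_cat_sel pcls_cmp ptyped_PVar0 pinst_PVar)
next
  show "cmp P_cat A B B f (ide P_cat B) = f" if "f \<in> hom P_cat A B" for A B :: "'p pty" and f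
    using that by (auto elim!: P_homE simp: P_cat_sel pcls_cmp ptyped_PVar0 pinst_def)
next
  show "cmp P_cat A C D (cmp P_cat A B C f g) h = cmp P_cat A B D f (cmp P_cat B C D g h)"
    if "f \<in> hom P_cat A B" "g \<in> hom P_cat B C" "h \<in> hom P_cat C D"
    for A B C D :: "'p pty" and f g h
    using that by (auto elim!: P_homE simp: pcls_cmp ptyped_pinst1 pinst_assoc)
next
  show "prd P_cat A B \<in> obj P_cat" for A B :: "'p pty"
    by (simp add: P_cat_sel)
next
  show "pr1 P_cat A B \<in> hom P_cat (prd P_cat A B) A" for A B :: "'p pty"
    by (auto simp: P_cat_sel intro!: pcls_hom ptyped.pt_Fst ptyped_PVar0)
next
  show "pr2 P_cat A B \<in> hom P_cat (prd P_cat A B) B" for A B :: "'p pty"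
    by (auto simp: P_cat_sel intro!: pcls_hom ptyped.pt_Snd ptyped_PVar0)
next
  show "tup P_cat C A B f g \<in> hom P_cat C (prd P_cat A B)"
    if "f \<in> hom P_cat C A" "g \<in> hom P_cat C B" for A B C :: "'p pty" and f g
    using that by (auto elim!: P_homE simp: P_cat_sel pcls_tup intro!: pcls_hom ptyped.pt_Pair)
next
  fix A B C :: "'p pty" and f g
  assume "f \<in> hom P_cat C A" "g \<in> hom P_cat C B"
  then obtain M N where M: "[C] \<turnstile>\<^sub>P M : A" "f = pcls C A M" and N: "[C] \<turnstile>\<^sub>P N : B" "g = pcls C B N"
    by (auto elim!: P_homE)
  show "cmp P_cat C (prd P_cat A B) A (tup P_cat C A B f g) (pr1 P_cat A B) = f"
    using M N pcls_cmp[OF ptyped.pt_Pair[OF M(1) N(1)] ptyped.pt_Fst[OF ptyped_PVar0]]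
    by (auto simp: P_cat_sel pcls_tup pinst_def intro!: pcls_eqI pe_fst_pair)
  show "cmp P_cat C (prd P_cat A B) B (tup P_cat C A B f g) (pr2 P_cat A B) = g"
    using M N pcls_cmp[OF ptyped.pt_Pair[OF M(1) N(1)] ptyped.pt_Snd[OF ptyped_PVar0]]
    by (auto simp: P_cat_sel pcls_tup pinst_def intro!: pcls_eqI pe_snd_pair)
next
  fix A B C :: "'p pty" and f g h
  assume "h \<in> hom P_cat C (prd P_cat A B)"
    and f: "cmp P_cat C (prd P_cat A B) A h (pr1 P_cat A B) = f"
    and g: "cmp P_cat C (prd P_cat A B) B h (pr2 P_cat A B) = g"
  then obtain M where M: "[C] \<turnstile>\<^sub>P M : PProd A B" "h = pcls C (PProd A B) M"
    by (auto elim!: P_homE simp: P_cat_sel)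
  have "f = pcls C A (PFst M)"
    using f pcls_cmp[OF M(1) ptyped.pt_Fst[OF ptyped_PVar0]] by (simp add: P_cat_sel M(2) pinst_def)
  moreover have "g = pcls C B (PSnd M)"
    using g pcls_cmp[OF M(1) ptyped.pt_Snd[OF ptyped_PVar0]] by (simp add: P_cat_sel M(2) pinst_def)
  ultimately show "h = tup P_cat C A B f g"
    using M by (auto simp: pcls_tup ptyped.pt_Fst ptyped.pt_Snd intro!: pcls_eqI[symmetric]
        pe_surj_pair)
qed

interpretation P: category_with_products "P_cat :: ('p pty, ptm set) prodcat"
  by (rule P_category_with_products)

lemma prd_map_pcls:
  assumes "[A] \<turnstile>\<^sub>P M : B"
  shows "prd_map P_cat A X B X (pcls A B M) (ide P_cat X)
    = pcls (PProd A X) (PProd B X) (PPair (pinst (PFst (PVar 0)) M) (PSnd (PVar 0)))"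
proof -
  have fst: "[PProd A X] \<turnstile>\<^sub>P PFst (PVar 0) : A" and snd: "[PProd A X] \<turnstile>\<^sub>P PSnd (PVar 0) : X"
    by (rule ptyped.pt_Fst[OF ptyped_PVar0], rule ptyped.pt_Snd[OF ptyped_PVar0])
  have "pinst (PSnd (PVar 0)) (PVar 0) = PSnd (PVar 0)"
    by (simp add: pinst_def)
  then show ?thesis
    by (simp add: prd_map_def P_cat_sel pcls_cmp[OF fst assms] pcls_cmp[OF snd ptyped_PVar0]
        pcls_tup[OF ptyped_pinst1[OF assms fst] snd])
qed


section \<open>Sequencing and finite sums in P\<close>

text \<open>Bind with an explicit abstraction on the right.  Derivatives always have this form, and
  substituting into it creates no redex.\<close>

abbreviation plet :: "ptm \<Rightarrow> ptm \<Rightarrow> ptm" where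
  "plet M N \<equiv> PBind M (PLam N)"

declare pe_trans [trans]

lemma ptyped_plet: "\<Gamma> \<turnstile>\<^sub>P M : PMon T \<Longrightarrow> T # \<Gamma> \<turnstile>\<^sub>P N : PMon U \<Longrightarrow> \<Gamma> \<turnstile>\<^sub>P plet M N : PMon U"
  by (blast intro: ptyped.intros)

lemma plet_cong:
  "\<Gamma> \<turnstile>\<^sub>P M \<approx> M' : PMon T \<Longrightarrow> T # \<Gamma> \<turnstile>\<^sub>P N \<approx> N' : PMon U \<Longrightarrow> \<Gamma> \<turnstile>\<^sub>P plet M N \<approx> plet M' N' : PMon U"
  by (rule pe_Bind) (assumption, rule pe_Lam)

lemma ptyped_pren_up_Suc: "U # \<Gamma> \<turnstile>\<^sub>P M : V \<Longrightarrow> U # T # \<Gamma> \<turnstile>\<^sub>P pren (ren_up Suc) M : V"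
  by (erule ptyped_pren) (simp add: ren_typed_up)

text \<open>The translation shifts an abstraction past \<open>\<pi>\<close> before applying it.  The \<open>\<beta>\<close>-step then keeps
  the rest of the context shifted, whence the tail \<open>\<lambda>i. PVar (Suc i)\<close>.\<close>

lemma beta_pshift:
  assumes "T # \<Gamma> \<turnstile>\<^sub>P X : U" "D # \<Gamma> \<turnstile>\<^sub>P N : T"
  shows "D # \<Gamma> \<turnstile>\<^sub>P PApp (pshift (PLam X)) N \<approx> psub (case_nat N (\<lambda>i. PVar (Suc i))) X : U"
proof -
  have "D # \<Gamma> \<turnstile>\<^sub>P PApp (PLam (pren (ren_up Suc) X)) N \<approx> pinst N (pren (ren_up Suc) X) : U"
    by (rule pe_beta[OF ptyped_pren_up_Suc[OF assms(1)] assms(2)])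
  also have "pinst N (pren (ren_up Suc) X) = psub (case_nat N (\<lambda>i. PVar (Suc i))) X"
    unfolding pinst_def psub_pren by (rule psub_ext) (simp add: ren_up_case_nat split: nat.split)
  finally show ?thesis by simp
qed

lemma beta2_pshift:
  assumes "V # T # \<Gamma> \<turnstile>\<^sub>P X : U" "D # \<Gamma> \<turnstile>\<^sub>P N : T" "D # \<Gamma> \<turnstile>\<^sub>P L : V"
  shows "D # \<Gamma> \<turnstile>\<^sub>P PApp (PApp (pshift (PLam (PLam X))) N) L
    \<approx> psub (case_nat L (case_nat N (\<lambda>i. PVar (Suc i)))) X : U"
proof -
  let ?s = "case_nat N (\<lambda>i. PVar (Suc i))"
  have s: "psub_typed (D # \<Gamma>) ?s (T # \<Gamma>)"
    using assms(2) by (simp add: psub_typed_Cons psub_typed_PVar_Suc)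
  have "D # \<Gamma> \<turnstile>\<^sub>P PApp (PApp (pshift (PLam (PLam X))) N) L \<approx> PApp (psub ?s (PLam X)) L : U"
    by (rule pe_App[OF beta_pshift[OF ptyped.pt_Lam[OF assms(1)] assms(2)] pe_refl[OF assms(3)]])
  also have "psub ?s (PLam X) = PLam (psub (psub_up ?s) X)"
    by simp
  also have "D # \<Gamma> \<turnstile>\<^sub>P PApp \<dots> L \<approx> pinst L (psub (psub_up ?s) X) : U"
    by (rule pe_beta[OF ptyped_psub[OF assms(1) psub_typed_up[OF s]] assms(3)])
  also have "pinst L (psub (psub_up ?s) X) = psub (case_nat L ?s) X"
    unfolding pinst_def psub_psub
    by (rule psub_ext) (simp add: psub_up_case_nat psub_pren comp_def psub_PVar split: nat.split)
  finally show ?thesis .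
qed

lemma plet_PRet:
  assumes "T # \<Gamma> \<turnstile>\<^sub>P N : PMon U" "\<Gamma> \<turnstile>\<^sub>P M : T"
  shows "\<Gamma> \<turnstile>\<^sub>P plet (PRet M) N \<approx> pinst M N : PMon U"
  using pe_ret_bind[OF assms(2) ptyped.pt_Lam[OF assms(1)]] pe_beta[OF assms]
  by (rule pe_trans)

lemma plet_assoc:
  assumes "\<Gamma> \<turnstile>\<^sub>P M : PMon T" "T # \<Gamma> \<turnstile>\<^sub>P N : PMon U" "U # \<Gamma> \<turnstile>\<^sub>P L : PMon V"
  shows "\<Gamma> \<turnstile>\<^sub>P plet (plet M N) L \<approx> plet M (plet N (pren (ren_up Suc) L)) : PMon V"
proof -
  have "T # \<Gamma> \<turnstile>\<^sub>P PApp (pshift (PLam N)) (PVar 0)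
      \<approx> psub (case_nat (PVar 0) (\<lambda>i. PVar (Suc i))) N : PMon U"
    by (rule beta_pshift[OF assms(2) ptyped_PVar0])
  also have "psub (case_nat (PVar 0) (\<lambda>i. PVar (Suc i))) N = psub PVar N"
    by (rule psub_ext) (simp split: nat.split)
  finally have N: "T # \<Gamma> \<turnstile>\<^sub>P PApp (pshift (PLam N)) (PVar 0) \<approx> N : PMon U"
    by (simp only: psub_PVar)
  have "T # \<Gamma> \<turnstile>\<^sub>P pshift (PLam L) : PArr U (PMon V)"
    using assms(3) by (intro ptyped_pshift ptyped.pt_Lam)
  then have "\<Gamma> \<turnstile>\<^sub>P plet M (PBind (PApp (pshift (PLam N)) (PVar 0)) (pshift (PLam L)))
      \<approx> plet M (PBind N (pshift (PLam L))) : PMon V"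
    using assms N by (blast intro: plet_cong pe_Bind pe_refl)
  with pe_bind_assoc[OF assms(1) ptyped.pt_Lam[OF assms(2)] ptyped.pt_Lam[OF assms(3)]]
  have "\<Gamma> \<turnstile>\<^sub>P plet (plet M N) L \<approx> plet M (PBind N (pshift (PLam L))) : PMon V"
    by (rule pe_trans)
  then show ?thesis by simp
qed

text \<open>Summand \<open>0\<close> is split off first, since entering a binder adds a variable with index \<open>0\<close> to
  the context over which the chain rule sums.\<close>

primrec psum :: "nat \<Rightarrow> (nat \<Rightarrow> ptm) \<Rightarrow> ptm" where
  "psum 0 f = PZero"
| "psum (Suc n) f = PPlus (f 0) (psum n (\<lambda>i. f (Suc i)))"

lemma psub_psum: "psub s (psum n f) = psum n (\<lambda>i. psub s (f i))"
  by (induction n arbitrary: f) auto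

lemma pren_psum: "pren r (psum n f) = psum n (\<lambda>i. pren r (f i))"
  by (induction n arbitrary: f) auto

lemma ptyped_psum: "(\<And>i. i < n \<Longrightarrow> \<Gamma> \<turnstile>\<^sub>P f i : PMon T) \<Longrightarrow> \<Gamma> \<turnstile>\<^sub>P psum n f : PMon T"
  by (induction n arbitrary: f) (auto intro: ptyped.pt_Zero ptyped.pt_Plus)

lemma psum_cong:
  "(\<And>i. i < n \<Longrightarrow> \<Gamma> \<turnstile>\<^sub>P f i \<approx> g i : PMon T) \<Longrightarrow> \<Gamma> \<turnstile>\<^sub>P psum n f \<approx> psum n g : PMon T"
  by (induction n arbitrary: f g) (auto intro: pe_refl ptyped.pt_Zero pe_Plus)

lemma pplus_zero_left: "\<Gamma> \<turnstile>\<^sub>P M : PMon T \<Longrightarrow> \<Gamma> \<turnstile>\<^sub>P PPlus PZero M \<approx> M : PMon T"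
  by (rule pe_trans[OF pe_plus_comm pe_plus_zero]) (auto intro: ptyped.pt_Zero)

lemma pplus_zeros:
  "\<Gamma> \<turnstile>\<^sub>P M \<approx> PZero : PMon T \<Longrightarrow> \<Gamma> \<turnstile>\<^sub>P N \<approx> PZero : PMon T \<Longrightarrow> \<Gamma> \<turnstile>\<^sub>P PPlus M N \<approx> PZero : PMon T"
  by (rule pe_trans[OF pe_Plus pe_plus_zero[OF ptyped.pt_Zero]])

lemma psum_PZero:
  "(\<And>i. i < n \<Longrightarrow> \<Gamma> \<turnstile>\<^sub>P f i \<approx> PZero : PMon T) \<Longrightarrow> \<Gamma> \<turnstile>\<^sub>P psum n f \<approx> PZero : PMon T"
  by (induction n arbitrary: f) (auto intro: pe_refl ptyped.pt_Zero pplus_zeros)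

lemma psum_single:
  assumes "k < n" "\<Gamma> \<turnstile>\<^sub>P f k \<approx> X : PMon T"
    and "\<And>i. i < n \<Longrightarrow> i \<noteq> k \<Longrightarrow> \<Gamma> \<turnstile>\<^sub>P f i \<approx> PZero : PMon T"
  shows "\<Gamma> \<turnstile>\<^sub>P psum n f \<approx> X : PMon T"
  using assms
proof (induction n arbitrary: f k)
  case (Suc n)
  have X: "\<Gamma> \<turnstile>\<^sub>P X : PMon T"
    by (rule peq_typed2[OF Suc.prems(2)])
  show ?case
  proof (cases k)
    case 0
    have "\<Gamma> \<turnstile>\<^sub>P psum n (\<lambda>i. f (Suc i)) \<approx> PZero : PMon T"
      by (rule psum_PZero) (simp add: Suc.prems(3) 0)
    with Suc.prems(2) have "\<Gamma> \<turnstile>\<^sub>P psum (Suc n) f \<approx> PPlus X PZero : PMon T"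
      by (simp add: 0 pe_Plus)
    then show ?thesis
      by (rule pe_trans[OF _ pe_plus_zero[OF X]])
  next
    case (Suc j)
    have "\<Gamma> \<turnstile>\<^sub>P psum n (\<lambda>i. f (Suc i)) \<approx> X : PMon T"
      by (rule Suc.IH[of j]) (use Suc.prems Suc in auto)
    moreover have "\<Gamma> \<turnstile>\<^sub>P f 0 \<approx> PZero : PMon T"
      by (rule Suc.prems(3)) (simp_all add: Suc)
    ultimately have "\<Gamma> \<turnstile>\<^sub>P psum (Suc n) f \<approx> PPlus PZero X : PMon T"
      by (simp add: pe_Plus)
    then show ?thesis
      by (rule pe_trans[OF _ pplus_zero_left[OF X]])
  qed
qed simp

lemma pplus_interchange:
  assumes "\<Gamma> \<turnstile>\<^sub>P a : PMon T" "\<Gamma> \<turnstile>\<^sub>P b : PMon T" "\<Gamma> \<turnstile>\<^sub>P c : PMon T" "\<Gamma> \<turnstile>\<^sub>P d : PMon T"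
  shows "\<Gamma> \<turnstile>\<^sub>P PPlus (PPlus a b) (PPlus c d) \<approx> PPlus (PPlus a c) (PPlus b d) : PMon T"
proof -
  note plus = ptyped.pt_Plus
  have "\<Gamma> \<turnstile>\<^sub>P PPlus (PPlus a b) (PPlus c d) \<approx> PPlus a (PPlus b (PPlus c d)) : PMon T"
    using assms by (intro pe_plus_assoc plus)
  also have "\<Gamma> \<turnstile>\<^sub>P PPlus a (PPlus b (PPlus c d)) \<approx> PPlus a (PPlus (PPlus b c) d) : PMon T"
    using assms by (intro pe_Plus pe_refl[OF assms(1)] pe_sym[OF pe_plus_assoc])
  also have "\<Gamma> \<turnstile>\<^sub>P PPlus a (PPlus (PPlus b c) d) \<approx> PPlus a (PPlus (PPlus c b) d) : PMon T"
    using assms by (intro pe_Plus pe_refl[OF assms(1)] pe_refl[OF assms(4)] pe_plus_comm)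
  also have "\<Gamma> \<turnstile>\<^sub>P PPlus a (PPlus (PPlus c b) d) \<approx> PPlus a (PPlus c (PPlus b d)) : PMon T"
    using assms by (intro pe_Plus pe_refl[OF assms(1)] pe_plus_assoc)
  also have "\<Gamma> \<turnstile>\<^sub>P PPlus a (PPlus c (PPlus b d)) \<approx> PPlus (PPlus a c) (PPlus b d) : PMon T"
    using assms by (intro pe_sym[OF pe_plus_assoc] plus)
  finally show ?thesis .
qed

lemma psum_pplus:
  "(\<And>i. i < n \<Longrightarrow> \<Gamma> \<turnstile>\<^sub>P f i : PMon T) \<Longrightarrow> (\<And>i. i < n \<Longrightarrow> \<Gamma> \<turnstile>\<^sub>P g i : PMon T) \<Longrightarrow>
    \<Gamma> \<turnstile>\<^sub>P PPlus (psum n f) (psum n g) \<approx> psum n (\<lambda>i. PPlus (f i) (g i)) : PMon T"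
proof (induction n arbitrary: f g)
  case 0
  then show ?case by (simp add: pe_plus_zero ptyped.pt_Zero)
next
  case (Suc n)
  let ?F = "psum n (\<lambda>i. f (Suc i))" and ?G = "psum n (\<lambda>i. g (Suc i))"
  have "\<Gamma> \<turnstile>\<^sub>P PPlus (PPlus (f 0) ?F) (PPlus (g 0) ?G)
      \<approx> PPlus (PPlus (f 0) (g 0)) (PPlus ?F ?G) : PMon T"
    by (intro pplus_interchange ptyped_psum Suc.prems) auto
  also have "\<Gamma> \<turnstile>\<^sub>P PPlus (PPlus (f 0) (g 0)) (PPlus ?F ?G)
      \<approx> PPlus (PPlus (f 0) (g 0)) (psum n (\<lambda>i. PPlus (f (Suc i)) (g (Suc i)))) : PMon T"
    by (rule pe_Plus[OF pe_refl[OF ptyped.pt_Plus]]) (auto intro: Suc.prems Suc.IH)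
  finally show ?case by simp
qed

lemma plet_psum:
  "\<Gamma> \<turnstile>\<^sub>P M : PMon T \<Longrightarrow> (\<And>i. i < n \<Longrightarrow> T # \<Gamma> \<turnstile>\<^sub>P f i : PMon U) \<Longrightarrow>
    \<Gamma> \<turnstile>\<^sub>P plet M (psum n f) \<approx> psum n (\<lambda>i. plet M (f i)) : PMon U"
proof (induction n arbitrary: f)
  case 0
  then show ?case by (simp add: pe_bind_zero)
next
  case (Suc n)
  have "\<Gamma> \<turnstile>\<^sub>P plet M (PPlus (f 0) (psum n (\<lambda>i. f (Suc i))))
      \<approx> PPlus (plet M (f 0)) (plet M (psum n (\<lambda>i. f (Suc i)))) : PMon U"
    by (intro pe_bind_plus[OF Suc.prems(1)] ptyped_psum Suc.prems(2)) auto
  also have "\<Gamma> \<turnstile>\<^sub>P PPlus (plet M (f 0)) (plet M (psum n (\<lambda>i. f (Suc i))))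
      \<approx> PPlus (plet M (f 0)) (psum n (\<lambda>i. plet M (f (Suc i)))) : PMon U"
    by (rule pe_Plus[OF pe_refl[OF ptyped_plet]]) (auto intro: Suc)
  finally show ?case by simp
qed


section \<open>Substitutions performed by the translation\<close>

text \<open>The effect of \<open>(\<lambda>x. \<lambda>\<pi>. X) \<pi>\<^sup>1 \<pi>\<^sup>2\<close> in the translation of an abstraction: index \<open>0\<close>, the
  old \<open>\<pi>\<close>, becomes \<open>\<pi>\<^sup>2\<close>, and index \<open>1\<close>, the bound variable \<open>x\<close>, becomes \<open>\<pi>\<^sup>1\<close>.\<close>

definition split_sub :: "nat \<Rightarrow> ptm" where
  "split_sub = case_nat (PSnd (PVar 0)) (case_nat (PFst (PVar 0)) (\<lambda>i. PVar (Suc i)))"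

text \<open>The effect of supplying \<open>\<langle>N, \<pi>\<rangle>\<close> for the old \<open>\<pi>\<close> in the translation of an application.\<close>

definition arg_sub :: "ptm \<Rightarrow> nat \<Rightarrow> ptm" where
  "arg_sub N = case_nat (PPair (pshift N) (PVar 0)) (\<lambda>i. PVar (Suc i))"

lemma psub_typed_split_sub: "psub_typed (PProd T U # \<Gamma>) split_sub (U # T # \<Gamma>)"
  unfolding split_sub_def psub_typed_Cons
  by (intro conjI ptyped.pt_Snd[OF ptyped_PVar0] ptyped.pt_Fst[OF ptyped_PVar0] psub_typed_PVar_Suc)

lemma psub_typed_arg_sub: "\<Gamma> \<turnstile>\<^sub>P N : T \<Longrightarrow> psub_typed (U # \<Gamma>) (arg_sub N) (PProd T U # \<Gamma>)"
  unfolding arg_sub_def psub_typed_Cons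
  by (intro conjI ptyped.pt_Pair ptyped_pshift ptyped_PVar0 psub_typed_PVar_Suc)

lemma psub_arg_sub_cong:
  assumes "PProd T U # \<Gamma> \<turnstile>\<^sub>P X \<approx> X' : V" "\<Gamma> \<turnstile>\<^sub>P N \<approx> N' : T"
  shows "U # \<Gamma> \<turnstile>\<^sub>P psub (arg_sub N) X \<approx> psub (arg_sub N') X' : V"
proof (rule pe_trans)
  show "U # \<Gamma> \<turnstile>\<^sub>P psub (arg_sub N) X \<approx> psub (arg_sub N) X' : V"
    by (rule peq_psub[OF assms(1) psub_typed_arg_sub[OF peq_typed1[OF assms(2)]]])
  have "U # \<Gamma> \<turnstile>\<^sub>P pshift N \<approx> pshift N' : T"
    unfolding pren_eq_psub comp_def by (rule peq_psub[OF assms(2) psub_typed_PVar_Suc])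
  then have "U # \<Gamma> \<turnstile>\<^sub>P PPair (pshift N) (PVar 0) \<approx> PPair (pshift N') (PVar 0) : PProd T U"
    by (rule pe_Pair[OF _ pe_refl[OF ptyped_PVar0]])
  then show "U # \<Gamma> \<turnstile>\<^sub>P psub (arg_sub N) X' \<approx> psub (arg_sub N') X' : V"
    by (intro peq_psub_cong[OF peq_typed2[OF assms(1)]])
      (auto simp: arg_sub_def nth_Cons split: nat.split intro!: pe_refl ptyped.pt_Var)
qed

lemma peq_pshift: "\<Gamma> \<turnstile>\<^sub>P M \<approx> N : T \<Longrightarrow> U # \<Gamma> \<turnstile>\<^sub>P pshift M \<approx> pshift N : T"
  unfolding pren_eq_psub comp_def by (erule peq_psub[OF _ psub_typed_PVar_Suc])

lemma psub_typed_up_Suc: "psub_typed (U # T # \<Gamma>) (PVar \<circ> ren_up Suc) (U # \<Gamma>)"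
  by (simp add: psub_typed_def nth_Cons ren_up_case_nat ptyped.pt_Var split: nat.split)

lemma peq_pren_up_Suc:
  "U # \<Gamma> \<turnstile>\<^sub>P M \<approx> N : V \<Longrightarrow> U # T # \<Gamma> \<turnstile>\<^sub>P pren (ren_up Suc) M \<approx> pren (ren_up Suc) N : V"
  unfolding pren_eq_psub by (erule peq_psub[OF _ psub_typed_up_Suc])

text \<open>What the function with witness \<open>M\<close>, applied to \<open>N\<close>, sends back to its argument for the
  counter \<open>\<pi>\<close> of the result: \<open>M\<^sup>2 \<langle>N, \<pi>\<rangle>\<close>.\<close>

abbreviation send_back :: "ptm \<Rightarrow> ptm \<Rightarrow> ptm" where
  "send_back M N \<equiv> PApp (PSnd (pshift M)) (PPair (pshift N) (PVar 0))"

lemma ptyped_send_back: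
  assumes "\<Gamma> \<turnstile>\<^sub>P M : PProd S (PArr (PProd T U) V)" "\<Gamma> \<turnstile>\<^sub>P N : T"
  shows "U # \<Gamma> \<turnstile>\<^sub>P send_back M N : V"
  by (rule ptyped.pt_App[OF ptyped.pt_Snd[OF ptyped_pshift[OF assms(1)]]
        ptyped.pt_Pair[OF ptyped_pshift[OF assms(2)] ptyped_PVar0]])

lemma send_back_cong:
  assumes "\<Gamma> \<turnstile>\<^sub>P M \<approx> M' : PProd S (PArr (PProd T U) V)" "\<Gamma> \<turnstile>\<^sub>P N \<approx> N' : T"
  shows "U # \<Gamma> \<turnstile>\<^sub>P send_back M N \<approx> send_back M' N' : V"
  by (rule pe_App[OF pe_Snd[OF peq_pshift[OF assms(1)]]
        pe_Pair[OF peq_pshift[OF assms(2)] pe_refl[OF ptyped_PVar0]]])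

text \<open>Substitutions into the context, weakenings past \<open>\<pi>\<close> and the two substitutions above
  commute.\<close>

lemma psub_split_sub: "psub (psub_up s) (psub split_sub M)
    = psub split_sub (psub (psub_up (psub_up s)) M)"
  unfolding psub_psub
  by (rule psub_ext) (simp add: split_sub_def psub_up_case_nat psub_pren pren_eq_psub psub_psub
      comp_def
      split: nat.split)

lemma psub_arg_sub: "psub (psub_up s) (psub (arg_sub N) M)
    = psub (arg_sub (psub s N)) (psub (psub_up s) M)"
  unfolding psub_psub
  by (rule psub_ext) (simp add: arg_sub_def psub_up_case_nat psub_pren pren_eq_psub psub_psub
      comp_def
      split: nat.split)

lemma psub_split_sub_up_Suc2:
  "psub (psub_up split_sub) (pren (ren_up Suc) (pren (ren_up Suc) M)) = pren (ren_up Suc) M"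
  unfolding psub_pren unfolding pren_eq_psub
  by (rule psub_ext) (simp add: split_sub_def psub_up_case_nat ren_up_case_nat split: nat.split)

lemma psub_arg_sub_up_Suc: "psub (psub_up (arg_sub N)) (pren (ren_up Suc) M) = pren (ren_up Suc) M"
  unfolding psub_pren unfolding pren_eq_psub
  by (rule psub_ext) (simp add: arg_sub_def psub_up_case_nat ren_up_case_nat split: nat.split)

lemma pren_up_up_Suc: "pren (ren_up (ren_up Suc)) (pren (ren_up Suc) M)
    = pren (ren_up Suc) (pren (ren_up Suc) M)"
  by (simp add: pren_pren ren_up_comp ren_up_Suc)

lemma psub_up_up_Suc: "psub (psub_up (psub_up s)) (pren (ren_up Suc) M)
    = pren (ren_up Suc) (psub (psub_up s) M)"
  unfolding psub_pren pren_psub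
  by (rule psub_ext) (simp add: psub_up_case_nat ren_up_case_nat pren_pren comp_def split:
      nat.split)

lemma pinst_PVar0_up_Suc: "pinst (PVar 0) (pren (ren_up Suc) M) = M"
proof -
  have "psub (case_nat (PVar 0) PVar \<circ> ren_up Suc) M = psub PVar M"
    by (rule psub_ext) (simp add: ren_up_case_nat split: nat.split)
  then show ?thesis by (simp add: pinst_def psub_pren psub_PVar)
qed

lemma plet_zero_right:
  assumes "\<Gamma> \<turnstile>\<^sub>P M : PMon T" "T # \<Gamma> \<turnstile>\<^sub>P N \<approx> PZero : PMon U"
  shows "\<Gamma> \<turnstile>\<^sub>P plet M N \<approx> PZero : PMon U"
  by (rule pe_trans[OF plet_cong[OF pe_refl[OF assms(1)] assms(2)] pe_bind_zero[OF assms(1)]])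

text \<open>Supplying \<open>\<langle>N, \<pi>\<rangle>\<close> and then projecting it apart instantiates the bound variable with \<open>N\<close> and
  leaves \<open>\<pi>\<close> alone; the projections have to be computed, so this holds only up to equality in P.\<close>

lemma arg_split_sub:
  assumes "U # T # \<Gamma> \<turnstile>\<^sub>P X : V" "\<Gamma> \<turnstile>\<^sub>P N : T"
  shows "U # \<Gamma> \<turnstile>\<^sub>P psub (arg_sub N) (psub split_sub X) \<approx> psub (psub_up (case_nat N PVar)) X : V"
  unfolding psub_psub
proof (rule peq_psub_cong[OF assms(1)], intro allI impI)
  fix i assume i: "i < length (U # T # \<Gamma>)"
  have N: "U # \<Gamma> \<turnstile>\<^sub>P pshift N : T"
    by (rule ptyped_pshift[OF assms(2)])
  consider "i = 0" | "i = 1" | j where "i = Suc (Suc j)" "j < length \<Gamma>"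
    using i by (cases i; cases "i - 1") auto
  then show "U # \<Gamma> \<turnstile>\<^sub>P (psub (arg_sub N) \<circ> split_sub) i
      \<approx> psub_up (case_nat N PVar) i : (U # T # \<Gamma>) ! i"
  proof cases
    case 1
    then show ?thesis
      by (simp add: split_sub_def arg_sub_def pe_snd_pair[OF N ptyped_PVar0])
  next
    case 2
    then show ?thesis
      using pe_fst_pair[OF N ptyped_PVar0] by (simp add: split_sub_def arg_sub_def psub_up_case_nat)
  next
    case 3
    then show ?thesis
      by (simp add: split_sub_def arg_sub_def psub_up_case_nat pe_refl ptyped.pt_Var)
  qed
qed

lemma send_back_PPair:
  assumes "\<Gamma> \<turnstile>\<^sub>P M : S" "PProd T U # \<Gamma> \<turnstile>\<^sub>P X : V" "\<Gamma> \<turnstile>\<^sub>P N : T"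
  shows "U # \<Gamma> \<turnstile>\<^sub>P send_back (PPair M (PLam X)) N \<approx> psub (arg_sub N) X : V"
proof -
  have N: "U # \<Gamma> \<turnstile>\<^sub>P PPair (pshift N) (PVar 0) : PProd T U"
    by (rule ptyped.pt_Pair[OF ptyped_pshift[OF assms(3)] ptyped_PVar0])
  have "U # \<Gamma> \<turnstile>\<^sub>P PSnd (PPair (pshift M) (pshift (PLam X))) \<approx> pshift (PLam X) : PArr (PProd T U) V"
    by (rule pe_snd_pair[OF ptyped_pshift[OF assms(1)] ptyped_pshift[OF ptyped.pt_Lam[OF
        assms(2)]]])
  then have "U # \<Gamma> \<turnstile>\<^sub>P send_back (PPair M (PLam X)) N
      \<approx> PApp (pshift (PLam X)) (PPair (pshift N) (PVar 0)) : V"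
    unfolding pren.simps(4) by (rule pe_App[OF _ pe_refl[OF N]])
  then show ?thesis
    unfolding arg_sub_def by (rule pe_trans[OF _ beta_pshift[OF assms(2) N]])
qed

text \<open>Splitting \<open>\<pi>\<close> and pairing the parts up again is harmless by surjective pairing.  This is the
  \<open>\<eta>\<close>-rule as seen by derivatives.\<close>

lemma split_arg_sub_PVar0:
  assumes "PProd T U # \<Gamma> \<turnstile>\<^sub>P X : V"
  shows "PProd T U # \<Gamma> \<turnstile>\<^sub>P psub split_sub (psub (arg_sub (PVar 0)) (pren (ren_up Suc) X)) \<approx> X : V"
proof -
  have "PProd T U # \<Gamma> \<turnstile>\<^sub>P psub ((psub split_sub \<circ> arg_sub (PVar 0)) \<circ> ren_up Suc) X
      \<approx> psub PVar X : V"
  proof (rule peq_psub_cong[OF assms], intro allI impI)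
    fix i assume "i < length (PProd T U # \<Gamma>)"
    then show "PProd T U # \<Gamma> \<turnstile>\<^sub>P ((psub split_sub \<circ> arg_sub (PVar 0)) \<circ> ren_up Suc) i \<approx> PVar i
        : (PProd T U # \<Gamma>) ! i"
      using pe_surj_pair[OF ptyped_PVar0[of "PProd T U" \<Gamma>]]
      by (cases i) (simp_all add: split_sub_def arg_sub_def pe_refl ptyped.pt_Var)
  qed
  then show ?thesis
    by (simp only: psub_PVar psub_psub psub_pren comp_assoc)
qed

definition fst_sub :: "nat \<Rightarrow> ptm" where
  "fst_sub = case_nat (PFst (PVar 0)) PVar"

lemma psub_typed_fst_sub: "psub_typed [PProd T U] fst_sub [T]"
  by (simp add: psub_typed_def fst_sub_def ptyped.pt_Fst[OF ptyped_PVar0])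

lemma pinst_fst: "pinst (PFst (PVar 0)) M = psub fst_sub M"
  by (simp add: pinst_def fst_sub_def)

text \<open>Derivatives at \<open>z\<^sup>1\<close> depend on \<open>z\<close> only through its first projection.\<close>

lemma psub_up_case_fst:
  assumes "[U, T] \<turnstile>\<^sub>P X : V" "\<Delta> \<turnstile>\<^sub>P PFst N \<approx> L : T"
  shows "U # \<Delta> \<turnstile>\<^sub>P psub (psub_up (case_nat N PVar)) (psub (psub_up fst_sub) X)
    \<approx> psub (psub_up (case_nat L PVar)) X : V"
  unfolding psub_psub
proof (rule peq_psub_cong[OF assms(1)], intro allI impI)
  fix i assume "i < length [U, T]"
  then consider "i = 0" | "i = 1"
    by fastforce
  then show "U # \<Delta> \<turnstile>\<^sub>P (psub (psub_up (case_nat N PVar)) \<circ> psub_up fst_sub) i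
      \<approx> psub_up (case_nat L PVar) i : [U, T] ! i"
  proof cases
    case 1
    then show ?thesis by (simp add: pe_refl ptyped_PVar0)
  next
    case 2
    then show ?thesis
      using peq_pshift[OF assms(2)] by (simp add: fst_sub_def)
  qed
qed


section \<open>The Dialectica translation: renaming and typing\<close>

text \<open>A derivative is always an abstraction over \<open>\<pi>\<close>.  Its body, with \<open>\<pi>\<close> as index \<open>0\<close>, is handled
  directly, so that applying a derivative to a counter becomes a substitution.  The value on terms
  that are not abstractions is never reached, by \<open>der_dbody\<close>.\<close>

definition dbody :: "nat \<Rightarrow> tm \<Rightarrow> ptm" where
  "dbody y M = (case der y M of PLam X \<Rightarrow> X | X \<Rightarrow> X)"

lemma der_dbody: "der y M = PLam (dbody y M)"
  by (cases M) (simp_all add: dbody_def)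

lemma dbody_simps:
  "dbody y (Var x) = (if x = y then PRet (PVar 0) else PZero)"
  "dbody y (Lam M) = PApp (PApp (pshift (PLam (PLam (dbody (Suc y) M)))) (PFst (PVar 0))) (PSnd
      (PVar 0))"
  "dbody y (App P Q) = PPlus
     (PApp (pshift (PLam (dbody y P))) (PPair (pshift (bul Q)) (PVar 0)))
     (plet (PApp (PSnd (pshift (bul P))) (PPair (pshift (bul Q)) (PVar 0)))
       (pren (ren_up Suc) (dbody y Q)))"
  using der_dbody[of y "Var x", unfolded der.simps] der_dbody[of y "Lam M", unfolded der.simps]
    der_dbody[of y "App P Q", unfolded der.simps]
  by (auto simp: der_dbody split: if_splits)

lemma pren_up_pshift: "pren (ren_up r) (pshift M) = pshift (pren r M)"
  by (simp add: pren_pren comp_def)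

lemma inj_ren_up:
  assumes "inj r"
  shows "inj (ren_up r)"
proof (rule injI)
  fix m n
  assume "ren_up r m = ren_up r n"
  then show "m = n"
    using assms by (cases m; cases n) (simp_all add: inj_eq)
qed

text \<open>Renaming commutes with the translation on the nose.  Injectivity is needed because a
  derivative compares the variable it meets with the one it differentiates by.\<close>

lemma bul_der_ren:
  "inj r \<Longrightarrow> bul (ren r M) = pren r (bul M) \<and> der (r y) (ren r M) = pren r (der y M)"
proof (induction M arbitrary: r y)
  case (Var x)
  then show ?case by (simp add: inj_eq)
next
  case (Lam M)
  note IH = Lam.IH[OF inj_ren_up[OF Lam.prems]]
  have "der (Suc (r y)) (ren (ren_up r) M) = pren (ren_up r) (der (Suc y) M)"
    using IH[of "Suc y"] by simp
  moreover have "der 0 (ren (ren_up r) M) = pren (ren_up r) (der 0 M)"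
    using IH[of 0] by simp
  ultimately show ?case
    using IH by (simp add: pren_pren ren_up_comp ren_up_Suc)
next
  case (App P Q)
  then show ?case by (simp add: pren_up_pshift)
qed

lemma bul_shift: "bul (shift M) = pshift (bul M)"
  by (simp add: bul_der_ren)

lemma dbody_shift: "dbody (Suc y) (shift M) = pren (ren_up Suc) (dbody y M)"
  using bul_der_ren[of Suc M y] by (simp add: der_dbody)

context
  fixes gW gC :: "'g \<Rightarrow> 'p"
begin

abbreviation (input) wty :: "'g ty \<Rightarrow> 'p pty" where "wty \<equiv> WT gW gC"
abbreviation (input) cty :: "'g ty \<Rightarrow> 'p pty" where "cty \<equiv> CT gW gC"
abbreviation (input) wctx :: "'g ty list \<Rightarrow> 'p pty list" where "wctx \<equiv> map (WT gW gC)"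

lemma bul_dbody_typed:
  "\<Gamma> \<turnstile> M : B \<Longrightarrow> wctx \<Gamma> \<turnstile>\<^sub>P bul M : wty B \<and>
    (\<forall>y<length \<Gamma>. cty B # wctx \<Gamma> \<turnstile>\<^sub>P dbody y M : PMon (cty (\<Gamma> ! y)))"
proof (induction rule: typed.induct)
  case (t_Var n \<Gamma> T)
  then show ?case
    by (auto simp: dbody_simps intro: ptyped.pt_Var ptyped.pt_Ret ptyped.pt_Zero ptyped_PVar0)
next
  case (t_Lam E \<Gamma> M F)
  have body: "cty (Arr E F) # wctx \<Gamma> \<turnstile>\<^sub>P PApp (PApp (pshift (PLam (PLam X))) (PFst (PVar 0)))
      (PSnd (PVar 0)) : V"
    if "cty F # wty E # wctx \<Gamma> \<turnstile>\<^sub>P X : V" for X V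
    unfolding CT.simps
    by (rule ptyped.pt_App[OF ptyped.pt_App[OF ptyped_pshift[OF ptyped.pt_Lam[OF ptyped.pt_Lam[OF
        that]]]
          ptyped.pt_Fst[OF ptyped_PVar0]] ptyped.pt_Snd[OF ptyped_PVar0]])
  have IH: "cty F # wty E # wctx \<Gamma> \<turnstile>\<^sub>P dbody y M
      : PMon (cty ((E # \<Gamma>) ! y))" if "y < Suc (length \<Gamma>)" for y
    using t_Lam.IH that by simp
  have "cty (Arr E F) # wctx \<Gamma> \<turnstile>\<^sub>P dbody y (Lam M) : PMon (cty (\<Gamma> ! y))" if "y < length \<Gamma>" for y
    unfolding dbody_simps using IH[of "Suc y"] that by (intro body) simp
  moreover have "wctx \<Gamma> \<turnstile>\<^sub>P bul (Lam M) : wty (Arr E F)"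
    unfolding bul.simps der_dbody WT.simps using IH[of 0] t_Lam.IH
    by (intro ptyped.pt_Pair ptyped.pt_Lam body[unfolded CT.simps]) auto
  ultimately show ?case by blast
next
  case (t_App \<Gamma> P E F Q)
  then have P: "wctx \<Gamma> \<turnstile>\<^sub>P bul P : wty (Arr E F)" and Q: "wctx \<Gamma> \<turnstile>\<^sub>P bul Q : wty E"
    by auto
  have arg: "cty F # wctx \<Gamma> \<turnstile>\<^sub>P PPair (pshift (bul Q)) (PVar 0) : cty (Arr E F)"
    unfolding CT.simps by (intro ptyped.pt_Pair ptyped_pshift Q ptyped_PVar0)
  have "wctx \<Gamma> \<turnstile>\<^sub>P bul (App P Q) : wty F"
    using ptyped.pt_App[OF ptyped.pt_Fst[OF P[unfolded WT.simps]] Q] by simp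
  moreover have "cty F # wctx \<Gamma> \<turnstile>\<^sub>P dbody y (App P Q)
      : PMon (cty (\<Gamma> ! y))" if y: "y < length \<Gamma>" for y
    unfolding dbody_simps
  proof (intro ptyped.pt_Plus ptyped_plet)
    show "cty F # wctx \<Gamma> \<turnstile>\<^sub>P PApp (pshift (PLam (dbody y P))) (PPair (pshift (bul Q)) (PVar 0))
        : PMon (cty (\<Gamma> ! y))"
      using t_App.IH y by (intro ptyped.pt_App[OF _ arg] ptyped_pshift ptyped.pt_Lam) auto
    show "cty F # wctx \<Gamma> \<turnstile>\<^sub>P PApp (PSnd (pshift (bul P))) (PPair (pshift (bul Q)) (PVar 0))
        : PMon (cty E)"
      using P by (intro ptyped.pt_App[OF _ arg] ptyped.pt_Snd[OF ptyped_pshift]) auto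
    show "cty E # cty F # wctx \<Gamma> \<turnstile>\<^sub>P pren (ren_up Suc) (dbody y Q) : PMon (cty (\<Gamma> ! y))"
      using t_App.IH y by (intro ptyped_pren_up_Suc) auto
  qed
  ultimately show ?case by blast
qed

lemma bul_typed: "\<Gamma> \<turnstile> M : B \<Longrightarrow> wctx \<Gamma> \<turnstile>\<^sub>P bul M : wty B"
  by (simp add: bul_dbody_typed)

lemma dbody_typed: "\<Gamma> \<turnstile> M : B \<Longrightarrow> y < length \<Gamma> \<Longrightarrow> cty B # wctx \<Gamma> \<turnstile>\<^sub>P dbody y M : PMon (cty (\<Gamma> ! y))"
  by (simp add: bul_dbody_typed)

text \<open>Up to equality in P, the translation of abstractions and applications is given by the
  substitutions above: the redexes in their definitions are contracted once and for all.\<close>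

lemma dbody_Lam_eq:
  assumes "E # \<Gamma> \<turnstile> M : F" "y < length \<Gamma>"
  shows "cty (Arr E F) # wctx \<Gamma> \<turnstile>\<^sub>P dbody y (Lam M)
      \<approx> psub split_sub (dbody (Suc y) M) : PMon (cty (\<Gamma> ! y))"
  using dbody_typed[OF assms(1), of "Suc y"] assms(2)
  unfolding dbody_simps split_sub_def CT.simps
  by (intro beta2_pshift[OF _ ptyped.pt_Fst[OF ptyped_PVar0] ptyped.pt_Snd[OF ptyped_PVar0]]) simp

lemma bul_Lam_eq:
  assumes "E # \<Gamma> \<turnstile> M : F"
  shows "wctx \<Gamma> \<turnstile>\<^sub>P bul (Lam M) \<approx> PPair (PLam (bul M)) (PLam (psub split_sub (dbody 0 M)))
      : wty (Arr E F)"
  using dbody_typed[OF assms, of 0] bul_typed[OF assms]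
  unfolding split_sub_def WT.simps bul.simps der_dbody
  by (intro pe_Pair pe_refl[OF ptyped.pt_Lam] pe_Lam[OF beta2_pshift[OF _
        ptyped.pt_Fst[OF ptyped_PVar0] ptyped.pt_Snd[OF ptyped_PVar0]]]) simp_all

lemma dbody_App_eq:
  assumes "\<Gamma> \<turnstile> P : Arr E F" "\<Gamma> \<turnstile> Q : E" "y < length \<Gamma>"
  shows "cty F # wctx \<Gamma> \<turnstile>\<^sub>P dbody y (App P Q) \<approx> PPlus (psub (arg_sub (bul Q)) (dbody y P))
     (plet (PApp (PSnd (pshift (bul P))) (PPair (pshift (bul Q)) (PVar 0)))
       (pren (ren_up Suc) (dbody y Q))) : PMon (cty (\<Gamma> ! y))"
  unfolding dbody_simps arg_sub_def
proof (rule pe_Plus[OF beta_pshift pe_refl[OF ptyped_plet]])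
  have P: "wctx \<Gamma> \<turnstile>\<^sub>P bul P : wty (Arr E F)" and Q: "wctx \<Gamma> \<turnstile>\<^sub>P bul Q : wty E"
    using assms by (auto intro: bul_typed simp del: WT.simps)
  show arg: "cty F # wctx \<Gamma> \<turnstile>\<^sub>P PPair (pshift (bul Q)) (PVar 0) : cty (Arr E F)"
    unfolding CT.simps by (intro ptyped.pt_Pair ptyped_pshift Q ptyped_PVar0)
  show "cty (Arr E F) # wctx \<Gamma> \<turnstile>\<^sub>P dbody y P : PMon (cty (\<Gamma> ! y))"
    by (rule dbody_typed[OF assms(1,3)])
  show "cty F # wctx \<Gamma> \<turnstile>\<^sub>P PApp (PSnd (pshift (bul P))) (PPair (pshift (bul Q)) (PVar 0))
      : PMon (cty E)"
    using P by (intro ptyped.pt_App[OF _ arg] ptyped.pt_Snd[OF ptyped_pshift]) auto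
  show "cty E # cty F # wctx \<Gamma> \<turnstile>\<^sub>P pren (ren_up Suc) (dbody y Q) : PMon (cty (\<Gamma> ! y))"
    by (rule ptyped_pren_up_Suc[OF dbody_typed[OF assms(2,3)]])
qed


section \<open>Substitution and the Dialectica translation: the chain rule\<close>

text \<open>The right-hand side of the chain rule for \<open>M[s]\<close>, where \<open>M\<close> has \<open>n\<close> variables and \<open>\<pi>\<close> is
  index \<open>0\<close>.\<close>

definition chain_sum :: "nat \<Rightarrow> (nat \<Rightarrow> tm) \<Rightarrow> nat \<Rightarrow> tm \<Rightarrow> ptm" where
  "chain_sum n s y M = psum n (\<lambda>i. plet (psub (psub_up (bul \<circ> s)) (dbody i M))
     (pren (ren_up Suc) (dbody y (s i))))"

lemma ptyped_send_back_bul: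
  assumes "\<Gamma> \<turnstile> P : Arr E F" "\<Gamma> \<turnstile> Q : E"
  shows "cty F # wctx \<Gamma> \<turnstile>\<^sub>P send_back (bul P) (bul Q) : PMon (cty E)"
  by (rule ptyped_send_back[OF bul_typed[OF assms(1), unfolded WT.simps] bul_typed[OF assms(2)]])

text \<open>A variable that does not occur has derivative zero, because no return is ever reached and
  zero is absorbed by bind.  Non-occurrence is phrased by a renaming that misses the variable, as
  \<open>shift\<close> misses \<open>0\<close>.\<close>

lemma dbody_ren_fresh:
  "\<Gamma> \<turnstile> M : B \<Longrightarrow> ren_typed \<Delta> r \<Gamma> \<Longrightarrow> y < length \<Delta> \<Longrightarrow> y \<notin> range r \<Longrightarrow>
    cty B # wctx \<Delta> \<turnstile>\<^sub>P dbody y (ren r M) \<approx> PZero : PMon (cty (\<Delta> ! y))"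
proof (induction arbitrary: \<Delta> r y rule: typed.induct)
  case (t_Var n \<Gamma> T)
  then have "dbody y (ren r (Var n)) = PZero"
    by (auto simp: dbody_simps)
  then show ?case
    by (simp add: pe_refl ptyped.pt_Zero)
next
  case (t_Lam E \<Gamma> M F)
  have "Suc y \<notin> range (ren_up r)"
    using t_Lam.prems(3) by (auto simp: ren_up_case_nat split: nat.splits)
  then have "cty F # wctx (E # \<Delta>) \<turnstile>\<^sub>P dbody (Suc y) (ren (ren_up r) M)
      \<approx> PZero : PMon (cty ((E # \<Delta>) ! Suc y))"
    using t_Lam.prems by (intro t_Lam.IH ren_typed_up) simp_all
  then have IH: "cty F # wty E # wctx \<Delta> \<turnstile>\<^sub>P dbody (Suc y) (ren (ren_up r) M)
      \<approx> PZero : PMon (cty (\<Delta> ! y))"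
    by simp
  have "cty (Arr E F) # wctx \<Delta> \<turnstile>\<^sub>P dbody y (Lam (ren (ren_up r) M))
      \<approx> psub split_sub (dbody (Suc y) (ren (ren_up r) M)) : PMon (cty (\<Delta> ! y))"
    by (rule dbody_Lam_eq[OF typed_ren[OF t_Lam.hyps ren_typed_up[OF t_Lam.prems(1)]]
        t_Lam.prems(2)])
  also have "cty (Arr E F) # wctx \<Delta> \<turnstile>\<^sub>P psub split_sub (dbody (Suc y) (ren (ren_up r) M))
      \<approx> psub split_sub PZero : PMon (cty (\<Delta> ! y))"
    using peq_psub[OF IH psub_typed_split_sub] by simp
  finally show ?case by simp
next
  case (t_App \<Gamma> P E F Q)
  let ?P = "ren r P" and ?Q = "ren r Q"
  have P: "\<Delta> \<turnstile> ?P : Arr E F" and Q: "\<Delta> \<turnstile> ?Q : E"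
    using t_App by (auto intro: typed_ren)
  have "cty F # wctx \<Delta> \<turnstile>\<^sub>P dbody y (App ?P ?Q) \<approx> PPlus (psub (arg_sub (bul ?Q)) (dbody y ?P))
     (plet (send_back (bul ?P) (bul ?Q)) (pren (ren_up Suc) (dbody y ?Q))) : PMon (cty (\<Delta> ! y))"
         (is "_ \<turnstile>\<^sub>P _ \<approx> ?x1 : _")
    by (rule dbody_App_eq[OF P Q t_App.prems(2)])
  also have "cty F # wctx \<Delta> \<turnstile>\<^sub>P ?x1 \<approx> PZero : PMon (cty (\<Delta> ! y))"
  proof (rule pplus_zeros)
    show "cty F # wctx \<Delta> \<turnstile>\<^sub>P psub (arg_sub (bul ?Q)) (dbody y ?P) \<approx> PZero : PMon (cty (\<Delta> ! y))"
      using peq_psub[OF t_App.IH(1)[OF t_App.prems, unfolded CT.simps] psub_typed_arg_sub[OF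
          bul_typed[OF Q]]]
      by simp
    show "cty F # wctx \<Delta> \<turnstile>\<^sub>P plet (send_back (bul ?P) (bul ?Q)) (pren (ren_up Suc) (dbody y ?Q))
        \<approx> PZero
        : PMon (cty (\<Delta> ! y))"
      using peq_pren_up_Suc[OF t_App.IH(2)[OF t_App.prems]]
      by (intro plet_zero_right[OF ptyped_send_back_bul[OF P Q]]) simp
  qed
  finally show ?case by simp
qed

lemma dbody_shift_fresh:
  assumes "\<Gamma> \<turnstile> M : B"
  shows "cty B # wty E # wctx \<Gamma> \<turnstile>\<^sub>P dbody 0 (shift M) \<approx> PZero : PMon (cty E)"
  using dbody_ren_fresh[OF assms ren_typed_Suc, of 0 E] by auto

lemma psub_typed_bul: "sub_typed \<Delta> s \<Gamma> \<Longrightarrow> psub_typed (wctx \<Delta>) (bul \<circ> s) (wctx \<Gamma>)"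
  by (simp add: sub_typed_def psub_typed_def bul_typed)

lemma chain_sum_term_typed:
  assumes "\<Gamma> \<turnstile> M : B" "sub_typed \<Delta> s \<Gamma>" "y < length \<Delta>" "i < length \<Gamma>"
  shows "cty B # wctx \<Delta> \<turnstile>\<^sub>P psub (psub_up (bul \<circ> s)) (dbody i M) : PMon (cty (\<Gamma> ! i))"
    and "cty (\<Gamma> ! i) # U # wctx \<Delta> \<turnstile>\<^sub>P pren (ren_up Suc) (dbody y (s i)) : PMon (cty (\<Delta> ! y))"
proof -
  show "cty B # wctx \<Delta> \<turnstile>\<^sub>P psub (psub_up (bul \<circ> s)) (dbody i M) : PMon (cty (\<Gamma> ! i))"
    by (rule ptyped_psub[OF dbody_typed[OF assms(1,4)] psub_typed_up[OF psub_typed_bul[OF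
        assms(2)]]])
  show "cty (\<Gamma> ! i) # U # wctx \<Delta> \<turnstile>\<^sub>P pren (ren_up Suc) (dbody y (s i)) : PMon (cty (\<Delta> ! y))"
    using assms by (intro ptyped_pren_up_Suc dbody_typed) (auto simp: sub_typed_def)
qed

lemma plet_dbody_Var:
  assumes "G \<turnstile>\<^sub>P X : PMon (cty T)"
  shows "G \<turnstile>\<^sub>P plet X (pren (ren_up Suc) (dbody y (Var y))) \<approx> X : PMon (cty T)"
    and "x \<noteq> y \<Longrightarrow> G \<turnstile>\<^sub>P plet X (pren (ren_up Suc) (dbody y (Var x))) \<approx> PZero : PMon U"
  using pe_bind_ret[OF assms] pe_bind_zero[OF assms] by (simp_all add: dbody_simps)

text \<open>Only the summand of \<open>x\<close> survives, and return is a unit for bind.\<close>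

lemma dbody_sub_Var:
  assumes "x < length \<Gamma>" "sub_typed \<Delta> s \<Gamma>" "y < length \<Delta>"
  shows "cty (\<Gamma> ! x) # wctx \<Delta> \<turnstile>\<^sub>P dbody y (s x)
      \<approx> chain_sum (length \<Gamma>) s y (Var x) : PMon (cty (\<Delta> ! y))"
  unfolding chain_sum_def
proof (rule pe_sym, rule psum_single[OF assms(1)])
  have sx: "\<Delta> \<turnstile> s x : \<Gamma> ! x"
    using assms by (simp add: sub_typed_def)
  have "cty (\<Gamma> ! x) # wctx \<Delta> \<turnstile>\<^sub>P plet (PRet (PVar 0)) (pren (ren_up Suc) (dbody y (s x)))
      \<approx> pinst (PVar 0) (pren (ren_up Suc) (dbody y (s x))) : PMon (cty (\<Delta> ! y))"
    by (rule plet_PRet[OF ptyped_pren_up_Suc[OF dbody_typed[OF sx assms(3)]] ptyped_PVar0])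
  then show "cty (\<Gamma> ! x) # wctx \<Delta> \<turnstile>\<^sub>P plet (psub (psub_up (bul \<circ> s)) (dbody x (Var x)))
      (pren (ren_up Suc) (dbody y (s x))) \<approx> dbody y (s x) : PMon (cty (\<Delta> ! y))"
    by (simp add: dbody_simps pinst_PVar0_up_Suc)
  fix i assume i: "i < length \<Gamma>" "i \<noteq> x"
  then have si: "\<Delta> \<turnstile> s i : \<Gamma> ! i"
    using assms by (simp add: sub_typed_def)
  have "cty (\<Gamma> ! x) # wctx \<Delta> \<turnstile>\<^sub>P plet PZero (pren (ren_up Suc) (dbody y (s i)))
      \<approx> PZero : PMon (cty (\<Delta> ! y))"
    by (rule pe_zero_bind[OF ptyped.pt_Lam[OF ptyped_pren_up_Suc[OF dbody_typed[OF si assms(3)]]]])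
  then show "cty (\<Gamma> ! x) # wctx \<Delta> \<turnstile>\<^sub>P plet (psub (psub_up (bul \<circ> s)) (dbody i (Var x)))
      (pren (ren_up Suc) (dbody y (s i))) \<approx> PZero : PMon (cty (\<Delta> ! y))"
    using i by (simp add: dbody_simps)
qed

lemma bul_sub_up: "bul \<circ> sub_up s = psub_up (bul \<circ> s)"
  by (simp add: fun_eq_iff sub_up_case_nat psub_up_case_nat bul_shift split: nat.split)

text \<open>Under the binder the sum gets a new summand, for the bound variable.  It vanishes, since the
  derivative is taken with respect to another variable.\<close>

lemma dbody_sub_Lam:
  assumes M: "E # \<Gamma> \<turnstile> M : F" and s: "sub_typed \<Delta> s \<Gamma>" and y: "y < length \<Delta>"
    and IH: "cty F # wctx (E # \<Delta>) \<turnstile>\<^sub>P dbody (Suc y) (sub (sub_up s) M)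
      \<approx> chain_sum (length (E # \<Gamma>)) (sub_up s) (Suc y) M : PMon (cty ((E # \<Delta>) ! Suc y))"
  shows "cty (Arr E F) # wctx \<Delta> \<turnstile>\<^sub>P dbody y (Lam (sub (sub_up s) M))
      \<approx> chain_sum (length \<Gamma>) s y (Lam M) : PMon (cty (\<Delta> ! y))"
proof -
  let ?G = "cty (Arr E F) # wctx \<Delta>" and ?T = "PMon (cty (\<Delta> ! y))"
  let ?S = "psub_up (bul \<circ> s)" and ?D = "\<lambda>i. pren (ren_up Suc) (dbody y (s i))"
  have "?G \<turnstile>\<^sub>P dbody y (Lam (sub (sub_up s) M))
      \<approx> psub split_sub (dbody (Suc y) (sub (sub_up s) M)) : ?T" (is "_ \<turnstile>\<^sub>P _ \<approx> ?x2 : _")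
    by (rule dbody_Lam_eq[OF typed_sub[OF M sub_typed_up[OF s]] y])
  also have "?G \<turnstile>\<^sub>P ?x2 \<approx> psub split_sub (chain_sum (length (E # \<Gamma>)) (sub_up s) (Suc y) M) : ?T"
    using peq_psub[OF IH[unfolded list.map] psub_typed_split_sub] by simp
  also have "psub split_sub (chain_sum (length (E # \<Gamma>)) (sub_up s) (Suc y) M) =
      PPlus (plet (psub split_sub (psub (psub_up ?S) (dbody 0 M))) PZero)
        (psum (length \<Gamma>) (\<lambda>i. plet (psub ?S (psub split_sub (dbody (Suc i) M))) (?D i)))"
    by (simp add: chain_sum_def psub_psum bul_sub_up dbody_simps dbody_shift psub_split_sub
        psub_split_sub_up_Suc2)
  also have "?G \<turnstile>\<^sub>P \<dots> \<approx> PPlus PZero (chain_sum (length \<Gamma>) s y (Lam M)) : ?T"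
      (is "_ \<turnstile>\<^sub>P _ \<approx> ?x8 : _")
    unfolding chain_sum_def
  proof (intro pe_Plus psum_cong plet_cong)
    have S: "psub_typed (cty F # wty E # wctx \<Delta>) (psub_up ?S) (cty F # wty E # wctx \<Gamma>)"
      by (intro psub_typed_up psub_typed_bul s)
    have "?G \<turnstile>\<^sub>P psub split_sub (psub (psub_up ?S) (dbody 0 M)) : PMon (cty E)"
      unfolding CT.simps
      by (rule ptyped_psub[OF ptyped_psub[OF _ S] psub_typed_split_sub])
        (use dbody_typed[OF M, of 0] in simp)
    then show "?G \<turnstile>\<^sub>P plet (psub split_sub (psub (psub_up ?S) (dbody 0 M))) PZero \<approx> PZero : ?T"
      by (rule pe_bind_zero)
    fix i assume i: "i < length \<Gamma>"
    show "?G \<turnstile>\<^sub>P psub ?S (psub split_sub (dbody (Suc i) M))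
        \<approx> psub ?S (dbody i (Lam M)) : PMon (cty (\<Gamma> ! i))"
      by (rule peq_psub[OF pe_sym[OF dbody_Lam_eq[OF M i]] psub_typed_up[OF psub_typed_bul[OF s]]])
    show "cty (\<Gamma> ! i) # ?G \<turnstile>\<^sub>P ?D i \<approx> ?D i : ?T"
      by (rule pe_refl[OF chain_sum_term_typed(2)[OF typed.t_Lam[OF M] s y i]])
  qed
  also have "?G \<turnstile>\<^sub>P ?x8 \<approx> chain_sum (length \<Gamma>) s y (Lam M) : ?T"
    unfolding chain_sum_def
    by (rule pplus_zero_left[OF ptyped_psum[OF ptyped_plet]];
        rule chain_sum_term_typed[OF typed.t_Lam[OF M] s y])
  finally show ?thesis .
qed

text \<open>Here the derivative is taken with respect to the bound variable.  Now its summand is the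
  only one to survive: the terms substituted for the other variables do not mention it.\<close>

lemma bul_sub_Lam:
  assumes M: "E # \<Gamma> \<turnstile> M : F" and s: "sub_typed \<Delta> s \<Gamma>"
    and IH1: "wctx (E # \<Delta>) \<turnstile>\<^sub>P bul (sub (sub_up s) M) \<approx> psub (bul \<circ> sub_up s) (bul M) : wty F"
    and IH2: "cty F # wctx (E # \<Delta>) \<turnstile>\<^sub>P dbody 0 (sub (sub_up s) M)
      \<approx> chain_sum (length (E # \<Gamma>)) (sub_up s) 0 M : PMon (cty ((E # \<Delta>) ! 0))"
  shows "wctx \<Delta> \<turnstile>\<^sub>P bul (Lam (sub (sub_up s) M)) \<approx> psub (bul \<circ> s) (bul (Lam M)) : wty (Arr E F)"
proof -
  let ?G = "cty F # wty E # wctx \<Delta>" and ?S = "psub_up (bul \<circ> s)"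
  have S: "psub_typed ?G (psub_up ?S) (cty F # wty E # wctx \<Gamma>)"
    by (intro psub_typed_up psub_typed_bul s)
  have X: "?G \<turnstile>\<^sub>P psub (psub_up ?S) (dbody i M)
      : PMon (cty ((E # \<Gamma>) ! i))" if "i < length (E # \<Gamma>)" for i
    using ptyped_psub[OF dbody_typed[OF M that, unfolded list.map] S] .
  have "?G \<turnstile>\<^sub>P chain_sum (length (E # \<Gamma>)) (sub_up s) 0 M
      \<approx> psub (psub_up ?S) (dbody 0 M) : PMon (cty E)"
    unfolding chain_sum_def bul_sub_up
  proof (rule psum_single[of 0])
    show "?G \<turnstile>\<^sub>P plet (psub (psub_up ?S) (dbody 0 M)) (pren (ren_up Suc) (dbody 0 (sub_up s 0)))
        \<approx> psub (psub_up ?S) (dbody 0 M) : PMon (cty E)"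
      using plet_dbody_Var(1)[OF X[of 0], of 0] by simp
    fix i assume i: "i < length (E # \<Gamma>)" "i \<noteq> 0"
    then obtain j where j: "i = Suc j" "j < length \<Gamma>"
      by (cases i) auto
    then have "\<Delta> \<turnstile> s j : \<Gamma> ! j"
      using s by (simp add: sub_typed_def)
    from peq_pren_up_Suc[OF dbody_shift_fresh[OF this]]
    show "?G \<turnstile>\<^sub>P plet (psub (psub_up ?S) (dbody i M)) (pren (ren_up Suc) (dbody 0 (sub_up s i)))
        \<approx> PZero : PMon (cty E)"
      using X[OF i(1)] j(1) by (auto intro: plet_zero_right)
  qed simp
  with IH2 have "?G \<turnstile>\<^sub>P dbody 0 (sub (sub_up s) M) \<approx> psub (psub_up ?S) (dbody 0 M) : PMon (cty E)"
    by (simp add: pe_trans)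
  from peq_psub[OF this psub_typed_split_sub]
  have "cty (Arr E F) # wctx \<Delta> \<turnstile>\<^sub>P psub split_sub (dbody 0 (sub (sub_up s) M))
      \<approx> psub ?S (psub split_sub (dbody 0 M)) : PMon (cty E)"
    by (simp add: psub_split_sub)
  moreover have "wty E # wctx \<Delta> \<turnstile>\<^sub>P bul (sub (sub_up s) M) \<approx> psub ?S (bul M) : wty F"
    using IH1 by (simp add: bul_sub_up)
  ultimately have "wctx \<Delta> \<turnstile>\<^sub>P PPair (PLam (bul (sub (sub_up s) M))) (PLam (psub split_sub (dbody 0
      (sub (sub_up s) M))))
      \<approx> psub (bul \<circ> s) (PPair (PLam (bul M)) (PLam (psub split_sub (dbody 0 M)))) : wty (Arr E F)"
    unfolding WT.simps psub.simps by (intro pe_Pair pe_Lam) simp_all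
  from pe_trans[OF bul_Lam_eq[OF typed_sub[OF M sub_typed_up[OF s]]] this]
  show ?thesis
    by (rule pe_trans) (rule pe_sym[OF peq_psub[OF bul_Lam_eq[OF M] psub_typed_bul[OF s]]])
qed

text \<open>The definition of \<open>(P Q)\<^sub>y\<close> feeds the sum for \<open>P\<close> with \<open>\<langle>Q\<^sup>\<bullet>, \<pi>\<rangle>\<close> and binds into the sum for
  \<open>Q\<close>.  Distributing bind over the second sum, reassociating it and merging the two sums leaves, in
  front of each \<open>(s i)\<^sub>y\<close>, exactly the two summands of \<open>(P Q)\<^sub>i\<close>.\<close>

lemma dbody_sub_App:
  assumes P: "\<Gamma> \<turnstile> P : Arr E F" and Q: "\<Gamma> \<turnstile> Q : E" and s: "sub_typed \<Delta> s \<Gamma>" and y: "y < length \<Delta>"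
    and bulP: "wctx \<Delta> \<turnstile>\<^sub>P bul (sub s P) \<approx> psub (bul \<circ> s) (bul P) : wty (Arr E F)"
    and bulQ: "wctx \<Delta> \<turnstile>\<^sub>P bul (sub s Q) \<approx> psub (bul \<circ> s) (bul Q) : wty E"
    and dP: "cty (Arr E F) # wctx \<Delta> \<turnstile>\<^sub>P dbody y (sub s P)
        \<approx> chain_sum (length \<Gamma>) s y P : PMon (cty (\<Delta> ! y))"
    and dQ: "cty E # wctx \<Delta> \<turnstile>\<^sub>P dbody y (sub s Q) \<approx> chain_sum (length \<Gamma>) s y Q : PMon (cty (\<Delta> ! y))"
  shows "cty F # wctx \<Delta> \<turnstile>\<^sub>P dbody y (App (sub s P) (sub s Q)) \<approx> chain_sum (length \<Gamma>) s y (App P Q)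
    : PMon (cty (\<Delta> ! y))"
proof -
  let ?G = "cty F # wctx \<Delta>" and ?T = "PMon (cty (\<Delta> ! y))" and ?n = "length \<Gamma>"
  let ?S = "psub_up (bul \<circ> s)" and ?r = "pren (ren_up Suc)"
  let ?D = "\<lambda>i. ?r (dbody y (s i))"
  let ?p = "psub (bul \<circ> s) (bul P)" and ?q = "psub (bul \<circ> s) (bul Q)"
  let ?a = "\<lambda>i. psub (arg_sub ?q) (psub ?S (dbody i P))"
  let ?b = "\<lambda>i. ?r (psub ?S (dbody i Q))"
  note D = chain_sum_term_typed(2)[OF P s y]
  have a: "?G \<turnstile>\<^sub>P ?a i : PMon (cty (\<Gamma> ! i))" if "i < ?n" for i
    by (rule ptyped_psub[OF chain_sum_term_typed(1)[OF P s y that, unfolded CT.simps]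
          psub_typed_arg_sub[OF peq_typed2[OF bulQ]]])
  have b: "cty E # ?G \<turnstile>\<^sub>P ?b i : PMon (cty (\<Gamma> ! i))" if "i < ?n" for i
    by (rule ptyped_pren_up_Suc[OF chain_sum_term_typed(1)[OF Q s y that]])
  have pq: "?G \<turnstile>\<^sub>P send_back ?p ?q : PMon (cty E)"
    by (rule ptyped_send_back[OF peq_typed2[OF bulP, unfolded WT.simps] peq_typed2[OF bulQ]])
  have "?G \<turnstile>\<^sub>P dbody y (App (sub s P) (sub s Q))
      \<approx> PPlus (psub (arg_sub (bul (sub s Q))) (dbody y (sub s P)))
     (plet (send_back (bul (sub s P)) (bul (sub s Q))) (?r (dbody y (sub s Q)))) : ?T"
         (is "_ \<turnstile>\<^sub>P _ \<approx> ?x3 : _")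
    by (rule dbody_App_eq[OF typed_sub[OF P s] typed_sub[OF Q s] y])
  also have "?G \<turnstile>\<^sub>P ?x3 \<approx> PPlus (psub (arg_sub ?q) (chain_sum ?n s y P)) (plet (send_back ?p ?q)
      (?r (chain_sum ?n s y Q))) : ?T"
    by (rule pe_Plus[OF psub_arg_sub_cong[OF dP[unfolded CT.simps] bulQ]
        plet_cong[OF send_back_cong[OF bulP[unfolded WT.simps] bulQ] peq_pren_up_Suc[OF dQ]]])
  also have "PPlus (psub (arg_sub ?q) (chain_sum ?n s y P)) (plet (send_back ?p ?q) (?r (chain_sum
      ?n s y Q))) =
      PPlus (psum ?n (\<lambda>i. plet (?a i) (?D i)))
        (plet (send_back ?p ?q) (psum ?n (\<lambda>i. plet (?b i) (?r (?D i)))))"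
    by (simp add: chain_sum_def psub_psum pren_psum psub_arg_sub_up_Suc pren_up_up_Suc)
  also have "?G \<turnstile>\<^sub>P \<dots> \<approx> PPlus (psum ?n (\<lambda>i. plet (?a i) (?D i)))
      (psum ?n (\<lambda>i. plet (plet (send_back ?p ?q) (?b i)) (?D i))) : ?T" (is "_ \<turnstile>\<^sub>P _ \<approx> ?x5 : _")
  proof (rule pe_Plus[OF pe_refl[OF ptyped_psum[OF ptyped_plet]]])
    have "?G \<turnstile>\<^sub>P plet (send_back ?p ?q) (psum ?n (\<lambda>i. plet (?b i) (?r (?D i))))
        \<approx> psum ?n (\<lambda>i. plet (send_back ?p ?q) (plet (?b i) (?r (?D i)))) : ?T"
            (is "_ \<turnstile>\<^sub>P _ \<approx> ?x4 : _")
      by (rule plet_psum[OF pq ptyped_plet[OF b ptyped_pren_up_Suc[OF D]]])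
    also have "?G \<turnstile>\<^sub>P ?x4 \<approx> psum ?n (\<lambda>i. plet (plet (send_back ?p ?q) (?b i)) (?D i)) : ?T"
      by (rule psum_cong[OF pe_sym[OF plet_assoc[OF pq b D]]])
    finally show "?G \<turnstile>\<^sub>P plet (send_back ?p ?q) (psum ?n (\<lambda>i. plet (?b i) (?r (?D i))))
        \<approx> psum ?n (\<lambda>i. plet (plet (send_back ?p ?q) (?b i)) (?D i)) : ?T" .
  qed (rule a D; assumption)+
  also have "?G \<turnstile>\<^sub>P ?x5 \<approx> psum ?n (\<lambda>i. PPlus (plet (?a i) (?D i)) (plet (plet (send_back ?p ?q)
      (?b i)) (?D i))) : ?T" (is "_ \<turnstile>\<^sub>P _ \<approx> ?x6 : _")
    by (rule psum_pplus[OF ptyped_plet[OF a D] ptyped_plet[OF ptyped_plet[OF pq b] D]])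
  also have "?G \<turnstile>\<^sub>P ?x6 \<approx> psum ?n (\<lambda>i. plet (PPlus (?a i) (plet (send_back ?p ?q) (?b i))) (?D i))
      : ?T" (is "_ \<turnstile>\<^sub>P _ \<approx> ?x7 : _")
    by (rule psum_cong[OF pe_sym[OF pe_plus_bind[OF a ptyped_plet[OF pq b] ptyped.pt_Lam[OF D]]]])
  also have "?G \<turnstile>\<^sub>P ?x7 \<approx> chain_sum ?n s y (App P Q) : ?T"
    unfolding chain_sum_def
  proof (rule psum_cong, rule plet_cong[OF pe_sym pe_refl[OF D]])
    fix i assume i: "i < ?n"
    from peq_psub[OF dbody_App_eq[OF P Q i] psub_typed_up[OF psub_typed_bul[OF s]]]
    show "?G \<turnstile>\<^sub>P psub ?S (dbody i (App P Q))
        \<approx> PPlus (?a i) (plet (send_back ?p ?q) (?b i)) : PMon (cty (\<Gamma> ! i))"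
      by (simp add: psub_arg_sub psub_up_pshift psub_up_up_Suc)
  qed
  finally show ?thesis .
qed

theorem bul_dbody_sub:
  "\<Gamma> \<turnstile> M : B \<Longrightarrow> sub_typed \<Delta> s \<Gamma> \<Longrightarrow>
    wctx \<Delta> \<turnstile>\<^sub>P bul (sub s M) \<approx> psub (bul \<circ> s) (bul M) : wty B \<and>
    (\<forall>y<length \<Delta>. cty B # wctx \<Delta> \<turnstile>\<^sub>P dbody y (sub s M)
        \<approx> chain_sum (length \<Gamma>) s y M : PMon (cty (\<Delta> ! y)))"
proof (induction arbitrary: \<Delta> s rule: typed.induct)
  case (t_Var n \<Gamma> T)
  then have "\<Delta> \<turnstile> s n : T"
    by (auto simp: sub_typed_def)
  then show ?case
    using dbody_sub_Var[OF t_Var(1) t_Var.prems] t_Var(2)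
    by (simp add: pe_refl bul_typed)
next
  case (t_Lam E \<Gamma> M F)
  note IH = t_Lam.IH[OF sub_typed_up[OF t_Lam.prems]]
  have "wctx \<Delta> \<turnstile>\<^sub>P bul (Lam (sub (sub_up s) M)) \<approx> psub (bul \<circ> s) (bul (Lam M)) : wty (Arr E F)"
    by (rule bul_sub_Lam[OF t_Lam.hyps t_Lam.prems IH[THEN conjunct1] IH[THEN conjunct2,
        rule_format]]) simp
  moreover have "cty (Arr E F) # wctx \<Delta> \<turnstile>\<^sub>P dbody y (Lam (sub (sub_up s) M))
      \<approx> chain_sum (length \<Gamma>) s y (Lam M) : PMon (cty (\<Delta> ! y))" if "y < length \<Delta>" for y
    by (rule dbody_sub_Lam[OF t_Lam.hyps t_Lam.prems that IH[THEN conjunct2, rule_format]])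
      (simp add: that)
  ultimately show ?case by (simp only: sub.simps) blast
next
  case (t_App \<Gamma> P E F Q)
  note IH = t_App.IH[OF t_App.prems]
  have "wctx \<Delta> \<turnstile>\<^sub>P bul (App (sub s P) (sub s Q)) \<approx> psub (bul \<circ> s) (bul (App P Q)) : wty F"
    unfolding bul.simps psub.simps
    by (rule pe_App[OF pe_Fst[OF IH(1)[THEN conjunct1, unfolded WT.simps]] IH(2)[THEN conjunct1]])
  moreover have "cty F # wctx \<Delta> \<turnstile>\<^sub>P dbody y (App (sub s P) (sub s Q))
      \<approx> chain_sum (length \<Gamma>) s y (App P Q)
      : PMon (cty (\<Delta> ! y))" if "y < length \<Delta>" for y
    by (rule dbody_sub_App[OF t_App.hyps t_App.prems that IH[THEN conjunct1]
          IH[THEN conjunct2, rule_format, OF that]])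
  ultimately show ?case by (simp only: sub.simps) blast
qed


section \<open>Soundness of the translation\<close>

definition translates_eq :: "'g ty list \<Rightarrow> tm \<Rightarrow> tm \<Rightarrow> 'g ty \<Rightarrow> bool" where
  "translates_eq \<Gamma> M N B \<longleftrightarrow> (wctx \<Gamma> \<turnstile>\<^sub>P bul M \<approx> bul N : wty B) \<and>
    (\<forall>y<length \<Gamma>. cty B # wctx \<Gamma> \<turnstile>\<^sub>P dbody y M \<approx> dbody y N : PMon (cty (\<Gamma> ! y)))"

lemma translates_eqI:
  assumes "wctx \<Gamma> \<turnstile>\<^sub>P bul M \<approx> bul N : wty B"
    and "\<And>y. y < length \<Gamma> \<Longrightarrow> cty B # wctx \<Gamma> \<turnstile>\<^sub>P dbody y M \<approx> dbody y N : PMon (cty (\<Gamma> ! y))"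
  shows "translates_eq \<Gamma> M N B"
  using assms by (simp add: translates_eq_def)

lemma translates_eqD:
  assumes "translates_eq \<Gamma> M N B"
  shows "wctx \<Gamma> \<turnstile>\<^sub>P bul M \<approx> bul N : wty B"
    and "y < length \<Gamma> \<Longrightarrow> cty B # wctx \<Gamma> \<turnstile>\<^sub>P dbody y M \<approx> dbody y N : PMon (cty (\<Gamma> ! y))"
  using assms by (simp_all add: translates_eq_def)

lemma bul_case_nat: "bul \<circ> case_nat N Var = case_nat (bul N) PVar"
  by (simp add: fun_eq_iff split: nat.split)

text \<open>The application contributes \<open>M\<^sub>y + (M\<^sub>x >>= N\<^sub>y)\<close>, with \<open>x\<close> replaced by \<open>N\<^sup>\<bullet>\<close> throughout.
  In the chain rule for \<open>(N, id)\<close> the second term is the summand of \<open>x\<close>, and the remaining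
  summands add up to the first term.\<close>

lemma translates_eq_beta:
  assumes M: "E # \<Gamma> \<turnstile> M : F" and N: "\<Gamma> \<turnstile> N : E"
  shows "translates_eq \<Gamma> (App (Lam M) N) (inst N M) F"
proof (rule translates_eqI)
  let ?s = "case_nat N Var" and ?S = "psub_up (case_nat (bul N) PVar)"
  let ?Z = "psub split_sub (dbody 0 M)"
  have s: "sub_typed \<Gamma> ?s (E # \<Gamma>)"
    by (simp add: sub_typed_Cons N sub_typed_Var)
  have bM: "wty E # wctx \<Gamma> \<turnstile>\<^sub>P bul M : wty F"
    using bul_typed[OF M] by simp
  have bN: "wctx \<Gamma> \<turnstile>\<^sub>P bul N : wty E"
    by (rule bul_typed[OF N])
  have dM: "cty F # wty E # wctx \<Gamma> \<turnstile>\<^sub>P dbody i M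
      : PMon (cty ((E # \<Gamma>) ! i))" if "i < Suc (length \<Gamma>)" for i
    using dbody_typed[OF M, of i] that by simp
  have Z: "PProd (wty E) (cty F) # wctx \<Gamma> \<turnstile>\<^sub>P ?Z : PMon (cty E)"
    using ptyped_psub[OF dM[of 0] psub_typed_split_sub] by simp
  \<comment> \<open>The chain rule for the substitution of \<open>N\<close> for \<open>x\<close> and of the other variables for themselves.\<close>
  note sub = bul_dbody_sub[OF M s, unfolded bul_case_nat, folded inst_def]

  have "wctx \<Gamma> \<turnstile>\<^sub>P PFst (bul (Lam M)) \<approx> PFst (PPair (PLam (bul M)) (PLam ?Z))
      : PArr (wty E) (wty F)"
    by (rule pe_Fst[OF bul_Lam_eq[OF M, unfolded WT.simps]])
  also have "wctx \<Gamma> \<turnstile>\<^sub>P PFst (PPair (PLam (bul M)) (PLam ?Z)) \<approx> PLam (bul M) : PArr (wty E) (wty F)"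
    by (rule pe_fst_pair[OF ptyped.pt_Lam[OF bM] ptyped.pt_Lam[OF Z]])
  finally have "wctx \<Gamma> \<turnstile>\<^sub>P bul (App (Lam M) N) \<approx> PApp (PLam (bul M)) (bul N) : wty F"
    unfolding bul.simps(3) by (rule pe_App[OF _ pe_refl[OF bN]])
  also have "wctx \<Gamma> \<turnstile>\<^sub>P PApp (PLam (bul M)) (bul N) \<approx> pinst (bul N) (bul M) : wty F"
    by (rule pe_beta[OF bM bN])
  also have "wctx \<Gamma> \<turnstile>\<^sub>P pinst (bul N) (bul M) \<approx> bul (inst N M) : wty F"
    using sub by (simp add: pinst_def pe_sym)
  finally show "wctx \<Gamma> \<turnstile>\<^sub>P bul (App (Lam M) N) \<approx> bul (inst N M) : wty F" .
  fix y assume y: "y < length \<Gamma>"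
  let ?G = "cty F # wctx \<Gamma>" and ?T = "PMon (cty (\<Gamma> ! y))"
  let ?D = "\<lambda>i. pren (ren_up Suc) (dbody y (?s i))"
  have S: "psub_typed ?G ?S (cty F # wty E # wctx \<Gamma>)"
    by (rule psub_typed_up) (simp add: psub_typed_Cons bN psub_typed_PVar)
  have SdM: "?G \<turnstile>\<^sub>P psub ?S (dbody i M) : PMon (cty ((E # \<Gamma>) ! i))" if "i < Suc (length \<Gamma>)" for i
    by (rule ptyped_psub[OF dM[OF that] S])
  have dN: "cty E # ?G \<turnstile>\<^sub>P pren (ren_up Suc) (dbody y N) : ?T"
    by (rule ptyped_pren_up_Suc[OF dbody_typed[OF N y]])
  let ?x = "psub ?S (dbody (Suc y) M)" and ?z
      = "plet (psub ?S (dbody 0 M)) (pren (ren_up Suc) (dbody y N))"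
  have x: "?G \<turnstile>\<^sub>P ?x : ?T"
    using SdM[of "Suc y"] y by simp
  have z: "?G \<turnstile>\<^sub>P ?z : ?T"
    using SdM[of 0] by (intro ptyped_plet[OF _ dN]) simp
  have "?G \<turnstile>\<^sub>P dbody y (App (Lam M) N) \<approx> PPlus (psub (arg_sub (bul N)) (dbody y (Lam M)))
      (plet (send_back (bul (Lam M)) (bul N)) (pren (ren_up Suc) (dbody y N))) : ?T"
          (is "_ \<turnstile>\<^sub>P _ \<approx> ?x1 : _")
    by (rule dbody_App_eq[OF typed.t_Lam[OF M] N y])
  also have "?G \<turnstile>\<^sub>P ?x1 \<approx> PPlus ?x ?z : ?T"
  proof (rule pe_Plus[OF _ plet_cong[OF _ pe_refl[OF dN]]])
    have "?G \<turnstile>\<^sub>P psub (arg_sub (bul N)) (dbody y (Lam M))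
        \<approx> psub (arg_sub (bul N)) (psub split_sub (dbody (Suc y) M)) : ?T"
      by (rule psub_arg_sub_cong[OF dbody_Lam_eq[OF M y, unfolded CT.simps] pe_refl[OF bN]])
    then show "?G \<turnstile>\<^sub>P psub (arg_sub (bul N)) (dbody y (Lam M)) \<approx> ?x : ?T"
      using arg_split_sub[OF dM[of "Suc y"] bN] y by (simp add: pe_trans)
    have "?G \<turnstile>\<^sub>P send_back (bul (Lam M)) (bul N)
        \<approx> send_back (PPair (PLam (bul M)) (PLam ?Z)) (bul N) : PMon (cty E)"
      by (rule send_back_cong[OF bul_Lam_eq[OF M, unfolded WT.simps] pe_refl[OF bN]])
    also have "?G \<turnstile>\<^sub>P send_back (PPair (PLam (bul M)) (PLam ?Z)) (bul N)
        \<approx> psub (arg_sub (bul N)) ?Z : PMon (cty E)"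
      by (rule send_back_PPair[OF ptyped.pt_Lam[OF bM] Z bN])
    also have "?G \<turnstile>\<^sub>P psub (arg_sub (bul N)) ?Z \<approx> psub ?S (dbody 0 M) : PMon (cty E)"
      using arg_split_sub[OF dM[of 0] bN] by simp
    finally show "?G \<turnstile>\<^sub>P send_back (bul (Lam M)) (bul N) \<approx> psub ?S (dbody 0 M) : PMon (cty E)" .
  qed
  also have "?G \<turnstile>\<^sub>P PPlus ?x ?z \<approx> PPlus ?z ?x : ?T"
    by (rule pe_plus_comm[OF x z])
  also have "?G \<turnstile>\<^sub>P PPlus ?z ?x \<approx> chain_sum (length (E # \<Gamma>)) ?s y M : ?T"
  proof -
    have "?G \<turnstile>\<^sub>P psum (length \<Gamma>) (\<lambda>i. plet (psub ?S (dbody (Suc i) M)) (?D (Suc i))) \<approx> ?x : ?T"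
    \<comment> \<open>\<open>i\<^sub>y\<close> is return for \<open>i = y\<close> and zero otherwise.\<close>
    proof (rule psum_single[OF y])
      show "?G \<turnstile>\<^sub>P plet ?x (?D (Suc y)) \<approx> ?x : ?T"
        using plet_dbody_Var(1)[OF x, of y] by simp
      show "?G \<turnstile>\<^sub>P plet (psub ?S (dbody (Suc i) M)) (?D (Suc i)) \<approx> PZero : ?T"
        if "i < length \<Gamma>" "i \<noteq> y" for i
        using plet_dbody_Var(2)[of ?G "psub ?S (dbody (Suc i) M)", OF _ that(2)] SdM[of "Suc i"]
            that by simp
    qed
    then show ?thesis
      by (simp add: chain_sum_def bul_case_nat pe_Plus[OF pe_refl[OF z] pe_sym])
  qed
  also have "?G \<turnstile>\<^sub>P chain_sum (length (E # \<Gamma>)) ?s y M \<approx> dbody y (inst N M) : ?T"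
    using sub y by (simp add: pe_sym)
  finally show "?G \<turnstile>\<^sub>P dbody y (App (Lam M) N) \<approx> dbody y (inst N M) : ?T" .
qed

text \<open>With \<open>x\<close> not in \<open>M\<close>, the derivative \<open>M\<^sub>x\<close> vanishes, so that \<open>(M x)\<^sub>x\<close> is what \<open>M\<^sup>\<bullet>\<close> sends
  back to its argument; and \<open>x\<^sub>y\<close> vanishes, so that \<open>(M x)\<^sub>y\<close> is \<open>M\<^sub>y\<close> at \<open>\<langle>x, \<pi>\<rangle>\<close>.  The \<open>\<eta>\<close>-rules
  of P for functions and pairs recover \<open>M\<^sup>\<bullet>\<close> and \<open>M\<^sub>y\<close>.\<close>

lemma translates_eq_eta:
  assumes M: "\<Gamma> \<turnstile> M : Arr E F"
  shows "translates_eq \<Gamma> (Lam (App (shift M) (Var 0))) M (Arr E F)"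
proof (rule translates_eqI)
  let ?K = "App (shift M) (Var 0)" and ?m = "bul M"
  have M': "E # \<Gamma> \<turnstile> shift M : Arr E F"
    by (rule typed_shift[OF M])
  have K: "E # \<Gamma> \<turnstile> ?K : F"
    by (rule typed.t_App[OF M' typed_Var0])
  have m: "wctx \<Gamma> \<turnstile>\<^sub>P ?m : PProd (PArr (wty E) (wty F)) (PArr (PProd (wty E) (cty F)) (PMon (cty
      E)))"
    using bul_typed[OF M] by simp
  let ?B = "send_back (pshift ?m) (PVar 0)"
  have B: "cty F # wty E # wctx \<Gamma> \<turnstile>\<^sub>P ?B : PMon (cty E)"
    by (rule ptyped_send_back[OF ptyped_pshift[OF m] ptyped_PVar0])
  have dK: "cty F # wty E # wctx \<Gamma> \<turnstile>\<^sub>P dbody y ?K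
      \<approx> PPlus (psub (arg_sub (PVar 0)) (dbody y (shift M)))
      (plet ?B (pren (ren_up Suc) (dbody y (Var 0))))
          : PMon (cty ((E # \<Gamma>) ! y))" if "y < Suc (length \<Gamma>)" for y
    using dbody_App_eq[OF M' typed_Var0, of y] that by (simp add: bul_shift)
  let ?P = "PProd (wty E) (cty F)"

  have "cty F # wty E # wctx \<Gamma> \<turnstile>\<^sub>P dbody 0 ?K \<approx> PPlus (psub (arg_sub (PVar 0)) (dbody 0 (shift M)))
      (plet ?B (pren (ren_up Suc) (dbody 0 (Var 0)))) : PMon (cty E)" (is "_ \<turnstile>\<^sub>P _ \<approx> ?x : _")
    using dK[of 0] by simp
  also have "cty F # wty E # wctx \<Gamma> \<turnstile>\<^sub>P ?x \<approx> PPlus PZero ?B : PMon (cty E)"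
  proof (rule pe_Plus)
    have "cty (Arr E F) # wty E # wctx \<Gamma> \<turnstile>\<^sub>P dbody 0 (shift M) \<approx> PZero : PMon (cty E)"
      by (rule dbody_shift_fresh[OF M])
    from psub_arg_sub_cong[OF this[unfolded CT.simps] pe_refl[OF ptyped_PVar0]]
    show "cty F # wty E # wctx \<Gamma> \<turnstile>\<^sub>P psub (arg_sub (PVar 0)) (dbody 0 (shift M))
        \<approx> PZero : PMon (cty E)"
      by simp
    show "cty F # wty E # wctx \<Gamma> \<turnstile>\<^sub>P plet ?B (pren (ren_up Suc) (dbody 0 (Var 0)))
        \<approx> ?B : PMon (cty E)"
      by (rule plet_dbody_Var(1)[OF B])
  qed
  also have "cty F # wty E # wctx \<Gamma> \<turnstile>\<^sub>P PPlus PZero ?B \<approx> ?B : PMon (cty E)"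
    by (rule pplus_zero_left[OF B])
  finally have "?P # wctx \<Gamma> \<turnstile>\<^sub>P psub split_sub (dbody 0 ?K) \<approx> psub split_sub ?B : PMon (cty E)"
    by (rule peq_psub[OF _ psub_typed_split_sub])
  also have "psub split_sub ?B = PApp (PSnd (pshift ?m)) (PPair (PFst (PVar 0)) (PSnd (PVar 0)))"
    by (simp add: psub_psub pren_eq_psub comp_def split_sub_def)
  also have "?P # wctx \<Gamma> \<turnstile>\<^sub>P PApp (PSnd (pshift ?m)) (PPair (PFst (PVar 0)) (PSnd (PVar 0)))
      \<approx> PApp (PSnd (pshift ?m)) (PVar 0) : PMon (cty E)"
    by (rule pe_App[OF pe_refl[OF ptyped.pt_Snd[OF ptyped_pshift[OF m]]] pe_surj_pair[OF
        ptyped_PVar0]])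
  finally have "wctx \<Gamma> \<turnstile>\<^sub>P PLam (psub split_sub (dbody 0 ?K))
      \<approx> PLam (PApp (PSnd (pshift ?m)) (PVar 0))
      : PArr ?P (PMon (cty E))"
    by (rule pe_Lam)
  also have "wctx \<Gamma> \<turnstile>\<^sub>P PLam (PApp (PSnd (pshift ?m)) (PVar 0)) \<approx> PSnd ?m : PArr ?P (PMon (cty E))"
    using pe_eta[OF ptyped.pt_Snd[OF m]] by simp
  finally have snd: "wctx \<Gamma> \<turnstile>\<^sub>P PLam (psub split_sub (dbody 0 ?K))
      \<approx> PSnd ?m : PArr ?P (PMon (cty E))" .
  have fst: "wctx \<Gamma> \<turnstile>\<^sub>P PLam (bul ?K) \<approx> PFst ?m : PArr (wty E) (wty F)"
    using pe_eta[OF ptyped.pt_Fst[OF m]] by (simp add: bul_shift)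
  have "wctx \<Gamma> \<turnstile>\<^sub>P bul (Lam ?K) \<approx> PPair (PLam (bul ?K)) (PLam (psub split_sub (dbody 0 ?K)))
      : wty (Arr E F)"
    by (rule bul_Lam_eq[OF K])
  also have "wctx \<Gamma> \<turnstile>\<^sub>P PPair (PLam (bul ?K)) (PLam (psub split_sub (dbody 0 ?K)))
      \<approx> PPair (PFst ?m) (PSnd ?m) : wty (Arr E F)"
    unfolding WT.simps by (rule pe_Pair[OF fst snd])
  also have "wctx \<Gamma> \<turnstile>\<^sub>P PPair (PFst ?m) (PSnd ?m) \<approx> ?m : wty (Arr E F)"
    unfolding WT.simps by (rule pe_surj_pair[OF m])
  finally show "wctx \<Gamma> \<turnstile>\<^sub>P bul (Lam ?K) \<approx> ?m : wty (Arr E F)" .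
  fix y assume y: "y < length \<Gamma>"
  let ?T = "PMon (cty (\<Gamma> ! y))" and ?d = "pren (ren_up Suc) (dbody y M)"
  have dM: "?P # wctx \<Gamma> \<turnstile>\<^sub>P dbody y M : ?T"
    using dbody_typed[OF M y] by simp
  have x: "cty F # wty E # wctx \<Gamma> \<turnstile>\<^sub>P psub (arg_sub (PVar 0)) ?d : ?T"
    by (rule ptyped_psub[OF ptyped_pren_up_Suc[OF dM] psub_typed_arg_sub[OF ptyped_PVar0]])
  have "cty F # wty E # wctx \<Gamma> \<turnstile>\<^sub>P dbody (Suc y) ?K \<approx> PPlus (psub (arg_sub (PVar 0)) ?d) PZero : ?T"
    using dK[of "Suc y"] pe_Plus[OF pe_refl[OF x] plet_dbody_Var(2)[OF B, of 0 "Suc y"]] y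
    by (simp add: dbody_shift pe_trans)
  also have "cty F # wty E # wctx \<Gamma> \<turnstile>\<^sub>P PPlus (psub (arg_sub (PVar 0)) ?d) PZero
      \<approx> psub (arg_sub (PVar 0)) ?d : ?T"
    by (rule pe_plus_zero[OF x])
  finally have *: "cty F # wty E # wctx \<Gamma> \<turnstile>\<^sub>P dbody (Suc y) ?K \<approx> psub (arg_sub (PVar 0)) ?d : ?T" .
  have "cty (Arr E F) # wctx \<Gamma> \<turnstile>\<^sub>P dbody y (Lam ?K) \<approx> psub split_sub (dbody (Suc y) ?K) : ?T"
    by (rule dbody_Lam_eq[OF K y])
  also have "cty (Arr E F) # wctx \<Gamma> \<turnstile>\<^sub>P psub split_sub (dbody (Suc y) ?K)
      \<approx> psub split_sub (psub (arg_sub (PVar 0)) ?d) : ?T"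
    unfolding CT.simps by (rule peq_psub[OF * psub_typed_split_sub])
  also have "cty (Arr E F) # wctx \<Gamma> \<turnstile>\<^sub>P psub split_sub (psub (arg_sub (PVar 0)) ?d)
      \<approx> dbody y M : ?T"
    unfolding CT.simps by (rule split_arg_sub_PVar0[OF dM])
  finally show "cty (Arr E F) # wctx \<Gamma> \<turnstile>\<^sub>P dbody y (Lam ?K) \<approx> dbody y M : ?T" .
qed

lemma translates_eq_Lam:
  assumes "E # \<Gamma> \<turnstile> M \<approx> M' : F" and IH: "translates_eq (E # \<Gamma>) M M' F"
  shows "translates_eq \<Gamma> (Lam M) (Lam M') (Arr E F)"
proof (rule translates_eqI)
  have M: "E # \<Gamma> \<turnstile> M : F" and M': "E # \<Gamma> \<turnstile> M' : F"
    using eqtm_typed[OF assms(1)] by auto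
  have *: "cty (Arr E F) # wctx \<Gamma> \<turnstile>\<^sub>P psub split_sub (dbody y M) \<approx> psub split_sub (dbody y M')
      : PMon (cty ((E # \<Gamma>) ! y))" if "y < length (E # \<Gamma>)" for y
    unfolding CT.simps by (rule peq_psub[OF translates_eqD(2)[OF IH that, unfolded list.map]
        psub_typed_split_sub])
  have "wctx \<Gamma> \<turnstile>\<^sub>P PPair (PLam (bul M)) (PLam (psub split_sub (dbody 0 M)))
      \<approx> PPair (PLam (bul M')) (PLam (psub split_sub (dbody 0 M'))) : wty (Arr E F)"
    using translates_eqD(1)[OF IH] *[of 0] by (simp add: pe_Pair pe_Lam)
  from pe_trans[OF pe_trans[OF bul_Lam_eq[OF M] this] pe_sym[OF bul_Lam_eq[OF M']]]
  show "wctx \<Gamma> \<turnstile>\<^sub>P bul (Lam M) \<approx> bul (Lam M') : wty (Arr E F)" .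
  fix y assume y: "y < length \<Gamma>"
  from pe_trans[OF pe_trans[OF dbody_Lam_eq[OF M y]] pe_sym[OF dbody_Lam_eq[OF M' y]]]
  show "cty (Arr E F) # wctx \<Gamma> \<turnstile>\<^sub>P dbody y (Lam M) \<approx> dbody y (Lam M') : PMon (cty (\<Gamma> ! y))"
    using *[of "Suc y"] y by simp
qed

lemma translates_eq_App:
  assumes "\<Gamma> \<turnstile> M \<approx> M' : Arr E F" "\<Gamma> \<turnstile> N \<approx> N' : E"
    and IH1: "translates_eq \<Gamma> M M' (Arr E F)" and IH2: "translates_eq \<Gamma> N N' E"
  shows "translates_eq \<Gamma> (App M N) (App M' N') F"
proof (rule translates_eqI)
  have t: "\<Gamma> \<turnstile> M : Arr E F" "\<Gamma> \<turnstile> N : E" "\<Gamma> \<turnstile> M' : Arr E F" "\<Gamma> \<turnstile> N' : E"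
    using eqtm_typed[OF assms(1)] eqtm_typed[OF assms(2)] by auto
  note m = translates_eqD(1)[OF IH1, unfolded WT.simps] and n = translates_eqD(1)[OF IH2]
  show "wctx \<Gamma> \<turnstile>\<^sub>P bul (App M N) \<approx> bul (App M' N') : wty F"
    unfolding bul.simps by (rule pe_App[OF pe_Fst[OF m] n])
  fix y assume y: "y < length \<Gamma>"
  show "cty F # wctx \<Gamma> \<turnstile>\<^sub>P dbody y (App M N) \<approx> dbody y (App M' N') : PMon (cty (\<Gamma> ! y))"
    by (rule pe_trans[OF pe_trans[OF dbody_App_eq[OF t(1,2) y]] pe_sym[OF dbody_App_eq[OF t(3,4)
        y]]],
      rule pe_Plus[OF psub_arg_sub_cong[OF translates_eqD(2)[OF IH1 y, unfolded CT.simps] n]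
        plet_cong[OF send_back_cong[OF m n] peq_pren_up_Suc[OF translates_eqD(2)[OF IH2 y]]]])
qed

theorem translation_sound: "\<Gamma> \<turnstile> M \<approx> N : B \<Longrightarrow> translates_eq \<Gamma> M N B"
proof (induction rule: eqtm.induct)
  case (e_refl \<Gamma> M T)
  then show ?case
    by (intro translates_eqI pe_refl bul_typed dbody_typed)
next
  case (e_sym \<Gamma> M N T)
  then show ?case
    by (simp add: translates_eq_def pe_sym)
next
  case (e_trans \<Gamma> M N T L)
  then show ?case
    unfolding translates_eq_def by (blast intro: pe_trans)
qed (blast intro: translates_eq_Lam translates_eq_App translates_eq_beta translates_eq_eta)+


section \<open>The functor\<close>

abbreviation left_leg :: "tm \<Rightarrow> ptm" where
  "left_leg M \<equiv> PPair (PFst (PVar 0)) (PBind (PSnd (PVar 0)) (pinst (PFst (PVar 0)) (der 0 M)))"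

lemma left_leg_eq:
  "left_leg M = PPair (PFst (PVar 0)) (plet (PSnd (PVar 0)) (psub (psub_up fst_sub) (dbody 0 M)))"
  by (simp add: der_dbody pinst_fst)

definition lens :: "'g ty \<Rightarrow> 'g ty \<Rightarrow> tm \<Rightarrow> ptm set \<times> ptm set \<times> ptm set" where
  "lens A B M = (pcls (wty A) (wty B) (bul M),
    pcls (PProd (wty A) (PMon (cty B))) (PProd (wty A) (PMon (cty A))) (left_leg M),
    pcls (PProd (wty A) (PMon (cty B))) (PProd (wty B) (PMon (cty B)))
      (PPair (pinst (PFst (PVar 0)) (bul M)) (PSnd (PVar 0))))"

lemma bul_typed1: "[A] \<turnstile> M : B \<Longrightarrow> [wty A] \<turnstile>\<^sub>P bul M : wty B"
  using bul_typed[of "[A]" M B] by simp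

lemma dbody_typed1: "[A] \<turnstile> M : B \<Longrightarrow> [cty B, wty A] \<turnstile>\<^sub>P dbody 0 M : PMon (cty A)"
  using dbody_typed[of "[A]" M B 0] by simp

lemma fst_dbody_typed:
  assumes "[A] \<turnstile> M : B"
  shows "[cty B, PProd (wty A) U] \<turnstile>\<^sub>P psub (psub_up fst_sub) (dbody 0 M) : PMon (cty A)"
  by (rule ptyped_psub[OF dbody_typed1[OF assms] psub_typed_up[OF psub_typed_fst_sub]])

lemma left_leg_typed:
  assumes "[A] \<turnstile> M : B"
  shows "[PProd (wty A) (PMon (cty B))] \<turnstile>\<^sub>P left_leg M : PProd (wty A) (PMon (cty A))"
  unfolding left_leg_eq
  by (rule ptyped.pt_Pair[OF ptyped.pt_Fst[OF ptyped_PVar0]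
        ptyped_plet[OF ptyped.pt_Snd[OF ptyped_PVar0] fst_dbody_typed[OF assms]]])

text \<open>Being \<open>f \<times> 1\<close>, the right leg is determined by the first component, so identities between
  these lenses need only be checked on the other two components.\<close>

lemma lens_eq:
  assumes "[A] \<turnstile> M : B"
  shows "lens A B M = (pcls (wty A) (wty B) (bul M),
    pcls (PProd (wty A) (PMon (cty B))) (PProd (wty A) (PMon (cty A))) (left_leg M),
    prd_map P_cat (wty A) (PMon (cty B)) (wty B) (PMon (cty B))
      (pcls (wty A) (wty B) (bul M)) (ide P_cat (PMon (cty B))))"
  by (simp add: lens_def prd_map_pcls[OF bul_typed1[OF assms]])

text \<open>Soundness of the translation makes the lens independent of the representative of an arrow.\<close>

lemma lens_cong:
  assumes "[A] \<turnstile> M \<approx> N : B"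
  shows "lens A B M = lens A B N"
proof -
  have M: "[A] \<turnstile> M : B" and N: "[A] \<turnstile> N : B"
    using eqtm_typed[OF assms] by auto
  note sound = translation_sound[OF assms]
  have "[cty B, wty A] \<turnstile>\<^sub>P dbody 0 M \<approx> dbody 0 N : PMon (cty A)"
    using translates_eqD(2)[OF sound, of 0] by simp
  from peq_psub[OF this psub_typed_up[OF psub_typed_fst_sub]]
  have "[PProd (wty A) (PMon (cty B))] \<turnstile>\<^sub>P left_leg M \<approx> left_leg N : PProd (wty A) (PMon (cty A))"
    unfolding left_leg_eq
    by (intro pe_Pair[OF pe_refl[OF ptyped.pt_Fst[OF ptyped_PVar0]]
          plet_cong[OF pe_refl[OF ptyped.pt_Snd[OF ptyped_PVar0]]]])
  moreover have "[wty A] \<turnstile>\<^sub>P bul M \<approx> bul N : wty B"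
    using translates_eqD(1)[OF sound] by simp
  ultimately show ?thesis
    unfolding lens_eq[OF M] lens_eq[OF N] by (simp add: pcls_eqI)
qed

abbreviation lens_obj :: "'g ty \<Rightarrow> 'p pty \<times> 'p pty \<times> ptm set" where
  "lens_obj A \<equiv> (wty A, PMon (cty A), pcls (PProd (wty A) (PMon (cty A))) (wty A) (PFst (PVar 0)))"

lemma lens_hom:
  assumes "[A] \<turnstile> M : B"
  shows "lens A B M \<in> hom (ELens P_cat) (lens_obj A) (lens_obj B)"
proof -
  let ?A = "PProd (wty A) (PMon (cty A))" and ?B = "PProd (wty A) (PMon (cty B))"
  have "[?B] \<turnstile>\<^sub>P PFst (left_leg M) \<approx> PFst (PVar 0) : wty A"
    unfolding left_leg_eq
    by (rule pe_fst_pair[OF ptyped.pt_Fst[OF ptyped_PVar0]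
          ptyped_plet[OF ptyped.pt_Snd[OF ptyped_PVar0] fst_dbody_typed[OF assms]]])
  then have "pcls ?B (wty A) (pinst (left_leg M) (PFst (PVar 0))) = pcls ?B (wty A) (PFst (PVar 0))"
    by (simp add: pinst_def pcls_eqI)
  then show ?thesis
    unfolding lens_eq[OF assms] P.ELens_hom
    by (simp add: P_cat_sel pcls_hom bul_typed1[OF assms] left_leg_typed[OF assms]
        pcls_cmp[OF left_leg_typed[OF assms] ptyped.pt_Fst[OF ptyped_PVar0]])
qed

lemma lens_Var: "lens A A (Var 0) = ide (ELens P_cat) (lens_obj A)"
proof -
  let ?A = "PProd (wty A) (PMon (cty A))"
  have v: "[?A] \<turnstile>\<^sub>P PPair (PFst (PVar 0)) (PSnd (PVar 0)) \<approx> PVar 0 : ?A"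
    by (rule pe_surj_pair[OF ptyped_PVar0])
  have "[?A] \<turnstile>\<^sub>P left_leg (Var 0) \<approx> PPair (PFst (PVar 0)) (PSnd (PVar 0)) : ?A"
    unfolding left_leg_eq
    using pe_bind_ret[OF ptyped.pt_Snd[OF ptyped_PVar0]]
    by (intro pe_Pair[OF pe_refl[OF ptyped.pt_Fst[OF ptyped_PVar0]]]) (simp add: dbody_simps)
  then have "pcls ?A ?A (left_leg (Var 0)) = pcls ?A ?A (PVar 0)"
    by (rule pcls_eqI[OF pe_trans[OF _ v]])
  moreover have "pcls ?A ?A (PPair (pinst (PFst (PVar 0)) (PVar 0)) (PSnd (PVar 0)))
      = pcls ?A ?A (PVar 0)"
    using pcls_eqI[OF v] by (simp add: pinst_def)
  ultimately show ?thesis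
    by (simp add: lens_def P.ELens_ide P_cat_sel)
qed

lemma bul_inst1:
  assumes M: "[A] \<turnstile> M : B" and N: "[B] \<turnstile> N : D"
  shows "[wty A] \<turnstile>\<^sub>P bul (inst M N) \<approx> pinst (bul M) (bul N) : wty D"
  using bul_dbody_sub[OF N, of "[A]" "case_nat M Var"] M
  by (simp add: sub_typed_def bul_case_nat inst_def pinst_def)

text \<open>The chain rule over a one-variable context, where the sum has one summand and a trailing
  zero.\<close>

lemma dbody_inst1:
  assumes M: "[A] \<turnstile> M : B" and N: "[B] \<turnstile> N : D"
  shows "[cty D, wty A] \<turnstile>\<^sub>P dbody 0 (inst M N) \<approx>
    plet (psub (psub_up (case_nat (bul M) PVar)) (dbody 0 N)) (pren (ren_up Suc) (dbody 0 M))
        : PMon (cty A)"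
    (is "_ \<turnstile>\<^sub>P _ \<approx> ?t : _")
proof -
  have s: "sub_typed [A] (case_nat M Var) [B]"
    using M by (simp add: sub_typed_def)
  have "[cty D, wty A] \<turnstile>\<^sub>P dbody 0 (inst M N) \<approx> PPlus ?t PZero : PMon (cty A)"
    using bul_dbody_sub[OF N s]
    by (simp add: chain_sum_def bul_case_nat inst_def)
  also have "[cty D, wty A] \<turnstile>\<^sub>P PPlus ?t PZero \<approx> ?t : PMon (cty A)"
    using chain_sum_term_typed[OF N s, of 0 0]
    by (intro pe_plus_zero ptyped_plet) (auto simp: bul_case_nat)
  finally show ?thesis .
qed

text \<open>The left leg of the composite span, on the left, runs the counter \<open>z\<^sup>2\<close> through \<open>N\<^sub>z\<close> at
  \<open>M\<^sup>\<bullet>[z\<^sup>1]\<close> and the outcome through \<open>M\<^sub>z\<close> at \<open>z\<^sup>1\<close>.  By the chain rule the right-hand side runs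
  \<open>z\<^sup>2\<close> through the sequence of both; these are the two bracketings of a threefold bind.\<close>

lemma left_leg_inst:
  assumes M: "[A] \<turnstile> M : B" and N: "[B] \<turnstile> N : D"
  shows "[PProd (wty A) (PMon (cty D))] \<turnstile>\<^sub>P
    pinst (PPair (PFst (PVar 0)) (pinst (PPair (pinst (PFst (PVar 0)) (bul M)) (PSnd (PVar 0)))
      (PSnd (left_leg N)))) (left_leg M) \<approx> left_leg (inst M N) : PProd (wty A) (PMon (cty A))"
proof -
  let ?G = "[PProd (wty A) (PMon (cty D))]" and ?T = "PMon (cty A)"
  let ?m = "pinst (PFst (PVar 0)) (bul M)"
  let ?r = "PPair ?m (PSnd (PVar 0))"
  let ?y = "pinst ?r (PSnd (left_leg N))"
  let ?w = "PPair (PFst (PVar 0)) ?y"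
  let ?N = "psub (psub_up (case_nat ?m PVar)) (dbody 0 N)"
  let ?M = "psub (psub_up fst_sub) (dbody 0 M)"
  have fst: "?G \<turnstile>\<^sub>P PFst (PVar 0) : wty A" and snd: "?G \<turnstile>\<^sub>P PSnd (PVar 0) : PMon (cty D)"
    by (rule ptyped.pt_Fst[OF ptyped_PVar0], rule ptyped.pt_Snd[OF ptyped_PVar0])
  have m: "?G \<turnstile>\<^sub>P ?m : wty B"
    by (rule ptyped_pinst1[OF bul_typed1[OF M] fst])
  have r: "?G \<turnstile>\<^sub>P ?r : PProd (wty B) (PMon (cty D))"
    by (rule ptyped.pt_Pair[OF m snd])
  have y: "?G \<turnstile>\<^sub>P ?y : PMon (cty B)"
    by (rule ptyped_pinst1[OF ptyped.pt_Snd[OF left_leg_typed[OF N]] r])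
  have w1: "?G \<turnstile>\<^sub>P PFst ?w \<approx> PFst (PVar 0) : wty A" and w2: "?G \<turnstile>\<^sub>P PSnd ?w \<approx> ?y : PMon (cty B)"
    by (rule pe_fst_pair[OF fst y], rule pe_snd_pair[OF fst y])
  have Nty: "cty D # ?G \<turnstile>\<^sub>P ?N : PMon (cty B)"
    by (rule ptyped_psub[OF dbody_typed1[OF N] psub_typed_up]) (simp add: psub_typed_def m)

  have "[PProd (wty B) (PMon (cty D))] \<turnstile>\<^sub>P PSnd (left_leg N)
      \<approx> plet (PSnd (PVar 0)) (psub (psub_up fst_sub) (dbody 0 N)) : PMon (cty B)"
    unfolding left_leg_eq
    by (rule pe_snd_pair[OF ptyped.pt_Fst[OF ptyped_PVar0]
          ptyped_plet[OF ptyped.pt_Snd[OF ptyped_PVar0] fst_dbody_typed[OF N]]])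
  from peq_pinst1[OF this pe_refl[OF r]]
  have "?G \<turnstile>\<^sub>P ?y \<approx> plet (PSnd ?r) (psub (psub_up (case_nat ?r PVar)) (psub (psub_up fst_sub)
      (dbody 0 N))) : PMon (cty B)"
    (is "_ \<turnstile>\<^sub>P _ \<approx> ?x1 : _")
    by (simp add: pinst_def)
  also have "?G \<turnstile>\<^sub>P ?x1 \<approx> plet (PSnd (PVar 0)) ?N : PMon (cty B)"
    by (rule plet_cong[OF pe_snd_pair[OF m snd] psub_up_case_fst[OF dbody_typed1[OF N]
        pe_fst_pair[OF m snd]]])
  \<comment> \<open>\<open>?y\<close> is the outcome of running \<open>z\<^sup>2\<close> backwards through \<open>N\<close>.\<close>
  finally have y_eq: "?G \<turnstile>\<^sub>P ?y \<approx> plet (PSnd (PVar 0)) ?N : PMon (cty B)" .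

  have "?G \<turnstile>\<^sub>P plet (PSnd ?w) (psub (psub_up (case_nat ?w PVar)) ?M)
      \<approx> plet (plet (PSnd (PVar 0)) ?N) ?M : ?T"
    using psub_up_case_fst[OF dbody_typed1[OF M] w1] unfolding fst_sub_def
    by (rule plet_cong[OF pe_trans[OF w2 y_eq]])
  also have "?G \<turnstile>\<^sub>P plet (plet (PSnd (PVar 0)) ?N) ?M
      \<approx> plet (PSnd (PVar 0)) (plet ?N (pren (ren_up Suc) ?M)) : ?T"
    by (rule plet_assoc[OF snd Nty fst_dbody_typed[OF M]])
  also have "?G \<turnstile>\<^sub>P plet (PSnd (PVar 0)) (plet ?N (pren (ren_up Suc) ?M))
      \<approx> plet (PSnd (PVar 0)) (psub (psub_up fst_sub) (dbody 0 (inst M N))) : ?T"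
  proof (rule plet_cong[OF pe_refl[OF snd] pe_sym])
    have "psub (psub_up fst_sub) (psub (psub_up (case_nat (bul M) PVar)) (dbody 0 N)) = ?N"
      unfolding psub_psub
      by (rule ptyped_psub_ext[OF dbody_typed1[OF N]])
        (simp add: less_Suc_eq psub_up_pshift pinst_fst)
    with peq_psub[OF dbody_inst1[OF M N] psub_typed_up[OF psub_typed_fst_sub]]
    show "cty D # ?G \<turnstile>\<^sub>P psub (psub_up fst_sub) (dbody 0 (inst M N))
        \<approx> plet ?N (pren (ren_up Suc) ?M) : ?T"
      by (simp add: psub_up_up_Suc)
  qed
  finally have "?G \<turnstile>\<^sub>P plet (PSnd ?w) (psub (psub_up (case_nat ?w PVar)) ?M)
      \<approx> plet (PSnd (PVar 0)) (psub (psub_up fst_sub) (dbody 0 (inst M N))) : ?T" .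
  from pe_Pair[OF w1 this] show ?thesis
    unfolding left_leg_eq by (simp add: pinst_def)
qed

lemma lens_inst:
  assumes M: "[A] \<turnstile> M : B" and N: "[B] \<turnstile> N : D"
  shows "lens A D (inst M N)
    = cmp (ELens P_cat) (lens_obj A) (lens_obj B) (lens_obj D) (lens A B M) (lens B D N)"
proof -
  let ?A = "PProd (wty A) (PMon (cty A))" and ?B = "PProd (wty A) (PMon (cty B))"
    and ?D = "PProd (wty A) (PMon (cty D))" and ?BD = "PProd (wty B) (PMon (cty D))"
    and ?BB = "PProd (wty B) (PMon (cty B))"
  let ?r = "PPair (pinst (PFst (PVar 0)) (bul M)) (PSnd (PVar 0))"
  have m: "[wty A] \<turnstile>\<^sub>P bul M : wty B" and n: "[wty B] \<turnstile>\<^sub>P bul N : wty D"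
    using M N by (auto intro: bul_typed1)
  note fst = ptyped.pt_Fst[OF ptyped_PVar0] and snd = ptyped.pt_Snd[OF ptyped_PVar0]
  have r: "[?D] \<turnstile>\<^sub>P ?r : ?BD"
    by (rule ptyped.pt_Pair[OF ptyped_pinst1[OF m fst] snd])
  have G: "[?BD] \<turnstile>\<^sub>P PSnd (left_leg N) : PMon (cty B)"
    by (rule ptyped.pt_Snd[OF left_leg_typed[OF N]])
  have y: "[?D] \<turnstile>\<^sub>P pinst ?r (PSnd (left_leg N)) : PMon (cty B)"
    by (rule ptyped_pinst1[OF G r])
  have 1: "cmp P_cat (wty A) (wty B) (wty D) (pcls (wty A) (wty B) (bul M)) (pcls (wty B) (wty D)
      (bul N))
      = pcls (wty A) (wty D) (bul (inst M N))"
    unfolding pcls_cmp[OF m n] by (rule pcls_eqI[OF bul_inst1[OF M N], symmetric])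
  have "cmp P_cat ?BD ?BB (PMon (cty B)) (pcls ?BD ?BB (left_leg N)) (pr2 P_cat (wty B) (PMon (cty
      B)))
      = pcls ?BD (PMon (cty B)) (PSnd (left_leg N))"
    unfolding P_cat_sel pcls_cmp[OF left_leg_typed[OF N] snd] by (simp add: pinst_def)
  then have "P.pull (wty A) (wty B) (PMon (cty B)) (PMon (cty D)) (pcls (wty A) (wty B) (bul M))
      (pcls ?BD ?BB (left_leg N))
    = pcls ?D ?B (PPair (PFst (PVar 0)) (pinst ?r (PSnd (left_leg N))))"
    unfolding P.pull_def prd_map_pcls[OF m]
    by (simp only: P_cat_sel pcls_cmp[OF r G] pcls_tup[OF fst y])
  then have 2: "cmp P_cat ?D ?B ?A (P.pull (wty A) (wty B) (PMon (cty B)) (PMon (cty D))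
      (pcls (wty A) (wty B) (bul M)) (pcls ?BD ?BB (left_leg N))) (pcls ?B ?A (left_leg M))
    = pcls ?D ?A (left_leg (inst M N))"
    by (simp only: pcls_cmp[OF ptyped.pt_Pair[OF fst y] left_leg_typed[OF M]] pcls_eqI[OF
        left_leg_inst[OF M N]])
  have "[A] \<turnstile> inst M N : D"
    by (rule typed_inst1[OF N M])
  then show ?thesis
    by (simp only: lens_eq[OF M] lens_eq[OF N] lens_eq P.ELens_cmp P_cat_sel(3) 1 2)
qed

text \<open>An arrow is an equivalence class; by \<open>lens_cong\<close> any member may be chosen.\<close>

definition lens_map :: "'g ty \<Rightarrow> 'g ty \<Rightarrow> tm set \<Rightarrow> ptm set \<times> ptm set \<times> ptm set" where
  "lens_map A B f = lens A B (SOME M. M \<in> f)"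

lemma lens_map_cls:
  assumes "[A] \<turnstile> M : B"
  shows "lens_map A B (cls A B M) = lens A B M"
proof -
  have "M \<in> cls A B M"
    by (simp add: in_cls e_refl assms)
  then have "(SOME N. N \<in> cls A B M) \<in> cls A B M"
    by (rule someI)
  then show ?thesis
    unfolding lens_map_def in_cls by (rule lens_cong[symmetric])
qed

theorem lens_functor: "cat_functor STLC_cat (ELens P_cat) lens_obj lens_map"
proof (intro cat_functor.intro cat_functor_axioms.intro)
  show "category (STLC_cat :: ('g ty, tm set) cat)"
    by (rule STLC_category)
  show "category (ELens (P_cat :: ('p pty, ptm set) prodcat))"
    by (rule P.ELens_category)
  show "lens_obj A \<in> obj (ELens P_cat)" for A
    by (simp add: P.ELens_obj P_cat_sel)
  show "lens_map A B f \<in> hom (ELens P_cat) (lens_obj A) (lens_obj B)" if "f \<in> hom STLC_cat A B"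
      for A B f
    using that by (auto elim!: STLC_homE simp: lens_map_cls lens_hom)
  show "lens_map A A (ide STLC_cat A) = ide (ELens P_cat) (lens_obj A)" for A
    by (simp add: STLC_ide lens_map_cls typed_Var0 lens_Var)
  show "lens_map A D (cmp STLC_cat A B D f g)
      = cmp (ELens P_cat) (lens_obj A) (lens_obj B) (lens_obj D) (lens_map A B f) (lens_map B D g)"
    if "f \<in> hom STLC_cat A B" "g \<in> hom STLC_cat B D" for A B D f g
  proof -
    from that obtain M N where M: "[A] \<turnstile> M : B" "f = cls A B M" and N: "[B] \<turnstile> N : D" "g = cls B D N"
      by (auto elim!: STLC_homE)
    show ?thesis
      by (simp only: M N cls_cmp[OF M(1) N(1)] lens_map_cls[OF M(1)] lens_map_cls[OF N(1)]
          lens_map_cls[OF typed_inst1[OF N(1) M(1)]] lens_inst[OF M(1) N(1)])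
  qed
qed

end

theorem proposition4p7:
  fixes gW gC :: "'g \<Rightarrow> 'p"
  defines "W \<equiv> WT gW gC" and "C \<equiv> CT gW gC"
  shows "category_with_products (P_cat :: ('p pty, ptm set) prodcat) \<and>
    (\<exists>Fo Fa. cat_functor (STLC_cat :: ('g ty, tm set) cat) (ELens P_cat) Fo Fa \<and>
      (\<forall>A. Fo A = (W A, PMon (C A),
         pcls (PProd (W A) (PMon (C A))) (W A) (PFst (PVar 0)))) \<and>
      (\<forall>A B M. [A] \<turnstile> M : B \<longrightarrow>
         Fa A B (cls A B M) =
           (pcls (W A) (W B) (bul M),
            pcls (PProd (W A) (PMon (C B))) (PProd (W A) (PMon (C A)))
              (PPair (PFst (PVar 0))
                (PBind (PSnd (PVar 0)) (pinst (PFst (PVar 0)) (der 0 M)))),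
            pcls (PProd (W A) (PMon (C B))) (PProd (W B) (PMon (C B)))
              (PPair (pinst (PFst (PVar 0)) (bul M)) (PSnd (PVar 0))))))"
  unfolding W_def C_def
proof (intro conjI exI allI impI)
  show "category_with_products (P_cat :: ('p pty, ptm set) prodcat)"
    by (rule P_category_with_products)
  show "cat_functor STLC_cat (ELens P_cat) (lens_obj gW gC) (lens_map gW gC)"
    by (rule lens_functor)
qed (simp_all only: lens_map_cls lens_def)

end
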